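(* Let $\beta>0$ and let $\bar\rho_0\in W^{2,1}\cap W^{2,\infty}(\mathbb{R}^2)$ be a positive probability density satisfying $$|\nabla\log\bar\rho_0(x)|\lesssim1+|x|,\qquad |\nabla^2\log\bar\rho_0(x)|\lesssim1+|x|^2,$$ and $\bar\rho_0(x)\le C_0\exp(-C_0^{-1}|x|^2)$ for some $C_0>0$. Let $\bar\rho$ be the solution of the Cauchy problem for the limit equation with initial datum $\bar\rho_0$. Then there is $C=C(\beta,C_0,\bar\rho_0)>0$ such that for all $t\ge0$, $x\in\mathbb{R}^2$, $$|\nabla\log\bar\rho(t,x)|^2\le\frac{C}{1+t}\Big(1+\log(1+t)+\frac{|x|^2}{1+t}\Big).$$
   Context: $K(x)=\frac{1}{2\pi}\frac{x}{|x|^2}$ on $\mathbb{R}^2$. Limit equation (Cauchy problem): $\partial_t\bar\rho+\mathrm{div}_x(\bar\rho\,K*\bar\rho)=\frac1\beta\Delta\bar\rho$ on $\mathbb{R}^2$, $\bar\rho(0)=\bar\rho_0$. *)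

theory Defs
  imports "HOL-Analysis.Analysis"
begin

type_synonym pt = "real^2"

text \<open>The kernel K(x) = x / (2 pi |x|^2)  (K(0) = 0 by Isabelle's division convention;
  this only affects a null set).\<close>
definition Kern :: "pt \<Rightarrow> pt" where
  "Kern x = (1 / (2 * pi * (norm x)\<^sup>2)) *\<^sub>R x"

definition Kconv :: "(pt \<Rightarrow> real) \<Rightarrow> pt \<Rightarrow> pt" where
  "Kconv f x = (\<integral>y. f y *\<^sub>R Kern (x - y) \<partial>lborel)"

definition tr2 :: "(pt \<Rightarrow> pt) \<Rightarrow> real" where
  "tr2 L = (\<Sum>i\<in>UNIV. L (axis i 1) $ i)"

definition is_solution :: "real \<Rightarrow> (pt \<Rightarrow> real) \<Rightarrow> (real \<Rightarrow> pt \<Rightarrow> real) \<Rightarrow> bool" where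
  "is_solution \<beta> \<rho>0 \<rho> \<longleftrightarrow>
     (\<forall>x. \<rho> 0 x = \<rho>0 x) \<and>
     continuous_on ({0..} \<times> UNIV) (\<lambda>(t, x). \<rho> t x) \<and>
     (\<forall>t\<ge>0. integrable lborel (\<rho> t)) \<and>
     (\<forall>s\<ge>0. ((\<lambda>t. \<integral>x. \<bar>\<rho> t x - \<rho> s x\<bar> \<partial>lborel) \<longlongrightarrow> 0) (at s within {0..})) \<and>
     (\<forall>T. \<exists>M. \<forall>t\<in>{0..T}. \<forall>x. \<bar>\<rho> t x\<bar> \<le> M) \<and>
     (\<exists>\<rho>t G H DF.
        (\<forall>t\<ge>0. \<forall>x. (\<rho> t has_derivative (\<lambda>h. G t x \<bullet> h)) (at x)) \<and>
        continuous_on ({0..} \<times> UNIV) (\<lambda>(t, x). G t x) \<and>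
        (\<forall>t>0. \<forall>x. ((\<lambda>s. \<rho> s x) has_real_derivative \<rho>t t x) (at t)) \<and>
        continuous_on ({0<..} \<times> UNIV) (\<lambda>(t, x). \<rho>t t x) \<and>
        (\<forall>t>0. \<forall>x. (G t has_derivative H t x) (at x)) \<and>
        (\<forall>i j. continuous_on ({0<..} \<times> UNIV) (\<lambda>(t, x). H t x (axis j 1) $ i)) \<and>
        (\<forall>t>0. \<forall>x. ((\<lambda>y. \<rho> t y *\<^sub>R Kconv (\<rho> t) y) has_derivative DF t x) (at x)) \<and>
        (\<forall>t>0. \<forall>x. \<rho>t t x + tr2 (DF t x) = (1 / \<beta>) * tr2 (H t x)))"

end

theory Submission
  imports Defs
begin

text \<open>
  Write \<open>\<tau> = 1 + t\<close> and \<open>u = K * \<rho>\<close>. The flux is repulsive, \<open>div u = \<rho>\<close>, so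
  \<open>\<partial>\<^sub>t \<rho> = \<Delta>\<rho> / \<beta> - u \<bullet> \<nabla>\<rho> - \<rho>\<^sup>2\<close>. The maximum principle gives \<open>\<rho> \<le> M / \<tau>\<close>, and together with
  conservation of mass \<open>\<bar>u\<bar> \<le> W / sqrt \<tau>\<close>; Gaussian barriers then give
  \<open>- log \<rho> \<le> A0 + A1 log \<tau> + a \<bar>x\<bar>\<^sup>2 / \<tau>\<close>.

  Put \<open>\<psi> = sqrt (c - log \<rho>) \<ge> 1\<close>, so that \<open>\<bar>\<nabla> log \<rho>\<bar> = 2 \<psi> \<bar>\<nabla>\<psi>\<bar>\<close>; it remains to show that \<open>\<psi>\<close> is
  Lipschitz in space with constant of order \<open>1 / sqrt \<tau>\<close>. It solves
  \<open>\<partial>\<^sub>t \<psi> = (\<Delta>\<psi> - (2 \<psi> - 1 / \<psi>) \<bar>\<nabla>\<psi>\<bar>\<^sup>2) / \<beta> - u \<bullet> \<nabla>\<psi> + \<rho> / (2 \<psi>)\<close>, and \<open>\<rho> / (2 \<psi>)\<close> is decreasing in \<open>\<psi>\<close>.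
  A two-point maximum principle therefore propagates the modulus of continuity \<open>k f (\<bar>x - y\<bar> / sqrt \<tau>)\<close>
  with \<open>f\<close> concave and \<open>1 \<le> f' \<le> 2\<close>. This uses no derivative of \<open>u\<close> and only second derivatives
  of \<open>\<rho>\<close>, so neither singular integrals nor higher regularity are needed.
\<close>

subsection \<open>The kernel\<close>

text \<open>For Gaussian-like data \<open>log \<rho>\<close> is quadratic, so its gradient grows
  linearly and no uniform Lipschitz bound can be propagated for it. The square root makes the growth
  linear, and the upper and gradient bounds on the datum then imply that \<open>\<psi>\<close>
  starts out Lipschitz. In \<open>2 \<psi> \<bar>\<nabla>\<psi>\<bar>\<close> the square of the
  first factor produces the bracket with the logarithm and the quadratic term, that of the second
  the prefactor \<open>1 / (1 + t)\<close>.

  The shape of \<open>f\<close> answers the roughness of \<open>u\<close>. Since only the size of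
  \<open>u\<close> is used, the drift terms at two close points are not known to cancel and cost an
  amount that does not vanish as the points merge; a strictly negative \<open>f''\<close> pays for
  it there. At larger separation the difference of the absorption terms pays, as it grows with the
  gap in \<open>\<psi>\<close>. Hence the order of constants: drift bound \<open>W\<close>,
  concavity \<open>b\<close>, slope \<open>k\<close>.

  The solution notion gives the flux a derivative at each point but no continuity of it, so
  \<open>div u = \<rho>\<close> is first obtained weakly and then converted into a pointwise
  identity for the flux.\<close>

lemma ball_borel [measurable]: "ball x r \<in> sets borel" and cball_borel [measurable]: "cball x r \<in> sets borel"
  for x :: "'a::euclidean_space"
  by auto

lemma norm_Kern: "norm (Kern z) = 1 / (2 * pi * norm z)"
  by (simp add: Kern_def power2_eq_square divide_simps)

lemma Kern_borel [measurable]: "Kern \<in> borel_measurable borel"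
  unfolding Kern_def by measurable

lemma emeasure_ball_2:
  assumes "r \<ge> 0" shows "emeasure lborel (ball (x::pt) r) = ennreal (pi * r\<^sup>2)"
  using assms by (simp add: emeasure_ball unit_ball_vol_2)

lemma emeasure_cball_2:
  assumes "r \<ge> 0" shows "emeasure lborel (cball (x::pt) r) = ennreal (pi * r\<^sup>2)"
  using assms by (simp add: emeasure_cball unit_ball_vol_2)

lemma integrable_indicator_ball [simp]:
  "integrable lborel (indicator (ball (x::pt) r) :: pt \<Rightarrow> real)"
  "integrable lborel (indicator (cball (x::pt) r) :: pt \<Rightarrow> real)"
  using emeasure_bounded_finite[of "ball x r"] emeasure_bounded_finite[of "cball x r"]
  by (auto intro: integrable_real_indicator)

lemma measure_ball_2:
  assumes "r \<ge> 0" shows "measure lborel (ball (x::pt) r) = pi * r\<^sup>2"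
  using assms by (simp add: measure_def emeasure_ball_2)

lemma nn_integral_inverse_square_tail:
  assumes "a > 0" "c \<ge> 0"
  shows "(\<integral>\<^sup>+l. ennreal (c / l\<^sup>2) * indicator {a..} l \<partial>lborel) = ennreal (c / a)"
proof -
  have "(\<integral>\<^sup>+l. ennreal (c / l\<^sup>2) * indicator {a..} l \<partial>lborel) = ennreal (0 - (- c / a))"
  proof (rule nn_integral_FTC_atLeast[where F = "\<lambda>l. - c / l"])
    show "((\<lambda>l. - c / l) \<longlongrightarrow> 0) at_top"
      by (rule tendsto_divide_0[OF tendsto_const filterlim_at_top_imp_at_infinity[OF filterlim_ident]])
  qed (use assms in \<open>auto intro!: derivative_eq_intros simp: power2_eq_square field_simps\<close>)
  then show ?thesis by simp
qed

text \<open>Layer-cake argument: \<open>1 / \<bar>z\<bar>\<close> is the integral of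
  \<open>1 / l^2\<close> over \<open>l \<ge> \<bar>z\<bar>\<close>, so after exchanging the
  integrals only areas of discs are needed, and no polar coordinates. The bound is the exact
  value.\<close>

lemma nn_integral_Kern_ball:
  assumes R: "R > 0"
  shows "(\<integral>\<^sup>+z. indicator (ball 0 R) z * ennreal (norm (Kern z)) \<partial>lborel) \<le> ennreal R"
proof -
  define w where "w l = ennreal ((1/(2*pi)) / l\<^sup>2)" for l :: real
  define F where "F = (\<lambda>(z::pt) (l::real). indicator (ball 0 R) z * (w l * indicator {0<..} l * indicator (cball 0 l) z))"
  have [measurable]: "w \<in> borel_measurable borel" unfolding w_def by measurable
  have Fm: "(\<lambda>(z,l). F z l) \<in> borel_measurable (lborel \<Otimes>\<^sub>M lborel)"
    unfolding F_def mem_cball indicator_def dist_norm mem_ball by measurable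
  have ae: "AE z in lborel. z \<noteq> (0::pt)"
    by (rule AE_lborel_singleton)
  have "(\<integral>\<^sup>+z. indicator (ball 0 R) z * ennreal (norm (Kern z)) \<partial>lborel)
      = (\<integral>\<^sup>+z. (\<integral>\<^sup>+l. F z l \<partial>lborel) \<partial>lborel)"
  proof (rule nn_integral_cong_AE, rule AE_mp[OF ae], rule AE_I2, rule impI)
    fix z :: pt assume z: "z \<noteq> 0"
    have "(\<integral>\<^sup>+l. F z l \<partial>lborel) = (\<integral>\<^sup>+l. indicator (ball 0 R) z * (w l * indicator {norm z..} l) \<partial>lborel)"
      using z by (intro nn_integral_cong) (auto simp: F_def indicator_def intro: less_le_trans[of 0 "norm z"])
    also have "\<dots> = indicator (ball 0 R) z * (\<integral>\<^sup>+l. w l * indicator {norm z..} l \<partial>lborel)"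
      by (rule nn_integral_cmult) measurable
    also have "(\<integral>\<^sup>+l. w l * indicator {norm z..} l \<partial>lborel) = ennreal (1/(2*pi) / norm z)"
      unfolding w_def by (rule nn_integral_inverse_square_tail) (use z in auto)
    finally show "indicator (ball 0 R) z * ennreal (norm (Kern z)) = (\<integral>\<^sup>+l. F z l \<partial>lborel)"
      by (simp add: norm_Kern)
  qed
  also have "\<dots> = (\<integral>\<^sup>+l. (\<integral>\<^sup>+z. F z l \<partial>lborel) \<partial>lborel)"
    by (rule lborel_pair.Fubini'[symmetric]) (use Fm in simp)
  \<comment> \<open>The inner integral is at most the weight times the area of the disc of radius
    \<open>min l R\<close>; the ranges below and above \<open>R\<close> contribute
    \<open>R / 2\<close> each.\<close>
  also have "\<dots> \<le> (\<integral>\<^sup>+l. ennreal (1/2) * indicator {0..R} l + ennreal ((R\<^sup>2/2) / l\<^sup>2) * indicator {R..} l \<partial>lborel)"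
  proof (rule nn_integral_mono)
    fix l :: real
    show "(\<integral>\<^sup>+z. F z l \<partial>lborel) \<le> ennreal (1/2) * indicator {0..R} l + ennreal ((R\<^sup>2/2) / l\<^sup>2) * indicator {R..} l"
    proof (cases "l > 0")
      case False
      then show ?thesis by (simp add: F_def)
    next
      case True
      have le1: "(\<integral>\<^sup>+z. F z l \<partial>lborel) \<le> w l * ennreal (pi * r\<^sup>2)" if "r \<ge> 0" "r = l \<or> r = R" for r
      proof -
        have "(\<integral>\<^sup>+z. F z l \<partial>lborel) \<le> (\<integral>\<^sup>+z. w l * indicator (cball (0::pt) r) z \<partial>lborel)"
          using that by (intro nn_integral_mono) (auto simp: F_def indicator_def)
        also have "\<dots> = w l * ennreal (pi * r\<^sup>2)"
          using that by (subst nn_integral_cmult) (auto simp: emeasure_cball_2)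
        finally show ?thesis .
      qed
      show ?thesis
      proof (cases "l \<le> R")
        case True
        have "w l * ennreal (pi * l\<^sup>2) = ennreal (1/2)"
          using \<open>l > 0\<close> by (simp add: w_def flip: ennreal_mult)
        then have "(\<integral>\<^sup>+z. F z l \<partial>lborel) \<le> ennreal (1/2)"
          using le1[of l] \<open>l > 0\<close> by simp
        then show ?thesis using True \<open>l > 0\<close>
          by (auto simp: indicator_def intro: add_increasing2)
      next
        case False
        have "w l * ennreal (pi * R\<^sup>2) = ennreal ((R\<^sup>2/2) / l\<^sup>2)"
          using \<open>l > 0\<close> by (simp add: w_def flip: ennreal_mult)
        then show ?thesis using le1[of R] False R by simp
      qed
    qed
  qed
  also have "\<dots> = ennreal (1/2) * ennreal R + ennreal (R\<^sup>2/2 / R)"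
    using R nn_integral_inverse_square_tail[OF R, of "R\<^sup>2/2"]
    by (subst nn_integral_add) (auto simp: nn_integral_cmult)
  also have "\<dots> = ennreal (1/2 * R + R\<^sup>2/2 / R)"
  proof -
    have "ennreal (1/2 * R + R\<^sup>2/2 / R) = ennreal (1/2 * R) + ennreal (R\<^sup>2/2 / R)"
      using R by (intro ennreal_plus) auto
    moreover have "ennreal (1/2 * R) = ennreal (1/2) * ennreal R"
      using R by (intro ennreal_mult) auto
    ultimately show ?thesis by (simp only:)
  qed
  also have "1/2 * R + R\<^sup>2/2 / R = R"
    using R by (simp add: power2_eq_square)
  finally show ?thesis .
qed

lemma integrable_Kern_ball:
  assumes "R > 0"
  shows "integrable lborel (\<lambda>z. indicator (ball 0 R) z * norm (Kern z))"
    and "(\<integral>z. indicator (ball 0 R) z * norm (Kern z) \<partial>lborel) \<le> R"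
proof -
  have e: "(\<integral>\<^sup>+z. ennreal (indicator (ball 0 R) z * norm (Kern z)) \<partial>lborel) \<le> ennreal R"
    using nn_integral_Kern_ball[OF assms] by (simp add: ennreal_mult' ennreal_indicator)
  show i: "integrable lborel (\<lambda>z. indicator (ball 0 R) z * norm (Kern z))"
  proof (rule integrableI_nonneg)
    show "(\<lambda>z. indicator (ball 0 R) z * norm (Kern z)) \<in> borel_measurable lborel" by measurable
  qed (use e in \<open>auto intro: le_less_trans\<close>)
  show "(\<integral>z. indicator (ball 0 R) z * norm (Kern z) \<partial>lborel) \<le> R"
    using e assms by (subst integral_eq_nn_integral) (auto intro!: enn2real_leI)
qed

section \<open>Invariance of Lebesgue measure under translation and reflection\<close>

lemma lborel_distr_affine_pm:
  assumes "c = 1 \<or> c = -1"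
  shows "distr lborel borel (\<lambda>x. t + c *\<^sub>R x) = (lborel :: 'a::euclidean_space measure)"
  using lborel_affine[of c t] assms by (auto simp: density_1)

lemma
  fixes f :: "'a::euclidean_space \<Rightarrow> 'b::{banach, second_countable_topology}"
  assumes [measurable]: "f \<in> borel_measurable borel"
  shows integral_lborel_translate: "(\<integral>x. f (t + x) \<partial>lborel) = (\<integral>x. f x \<partial>lborel)"
    and integral_lborel_reflect: "(\<integral>x. f (t - x) \<partial>lborel) = (\<integral>x. f x \<partial>lborel)"
    and integrable_lborel_translate: "integrable lborel (\<lambda>x. f (t + x)) \<longleftrightarrow> integrable lborel f"
    and integrable_lborel_reflect: "integrable lborel (\<lambda>x. f (t - x)) \<longleftrightarrow> integrable lborel f"
proof -
  have 1: "distr lborel borel (\<lambda>x. t + x) = (lborel :: 'a measure)"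
    using lborel_distr_affine_pm[of 1 t] by simp
  have 2: "distr lborel borel (\<lambda>x. t - x) = (lborel :: 'a measure)"
    using lborel_distr_affine_pm[of "-1" t] by simp
  show "(\<integral>x. f (t + x) \<partial>lborel) = (\<integral>x. f x \<partial>lborel)"
    by (subst (2) 1[symmetric], subst integral_distr) auto
  show "(\<integral>x. f (t - x) \<partial>lborel) = (\<integral>x. f x \<partial>lborel)"
    by (subst (2) 2[symmetric], subst integral_distr) auto
  show "integrable lborel (\<lambda>x. f (t + x)) \<longleftrightarrow> integrable lborel f"
    by (subst (2) 1[symmetric], subst integrable_distr_eq) auto
  show "integrable lborel (\<lambda>x. f (t - x)) \<longleftrightarrow> integrable lborel f"
    by (subst (2) 2[symmetric], subst integrable_distr_eq) auto
qed

lemma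
  assumes R: "R > 0"
  shows integrable_Kern_ball_shift: "integrable lborel (\<lambda>y. indicator (ball x R) y * norm (Kern (x - y)))"
    and integral_Kern_ball_shift: "(\<integral>y. indicator (ball x R) y * norm (Kern (x - y)) \<partial>lborel) \<le> R"
proof -
  let ?k = "\<lambda>z. indicator (ball 0 R) z * norm (Kern z)"
  have [measurable]: "?k \<in> borel_measurable borel" by measurable
  have e: "(\<lambda>y. ?k (x - y)) = (\<lambda>y. indicator (ball x R) y * norm (Kern (x - y)))"
    by (auto simp: indicator_def dist_norm norm_minus_commute)
  show "integrable lborel (\<lambda>y. indicator (ball x R) y * norm (Kern (x - y)))"
    using integrable_lborel_reflect[of ?k x] integrable_Kern_ball(1)[OF R] unfolding e by simp
  show "(\<integral>y. indicator (ball x R) y * norm (Kern (x - y)) \<partial>lborel) \<le> R"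
    using integral_lborel_reflect[of ?k x] integrable_Kern_ball(2)[OF R] unfolding e by simp
qed

text \<open>Splitting at radius \<open>R\<close>: inside the ball the sup bound meets the local
  integrability of the kernel; outside, the kernel is at most \<open>1 / (2 * pi * R)\<close> and
  the \<open>L^1\<close> norm takes over. \<open>R\<close> stays free because the decay of the drift
  comes from letting it grow with time.\<close>

lemma
  fixes f :: "pt \<Rightarrow> real"
  assumes f: "integrable lborel f" and N: "\<And>x. \<bar>f x\<bar> \<le> N" and R: "R > 0"
  shows integrable_Kconv_norm: "integrable lborel (\<lambda>y. \<bar>f y\<bar> * norm (Kern (x - y)))"
    and integral_Kconv_norm: "(\<integral>y. \<bar>f y\<bar> * norm (Kern (x - y)) \<partial>lborel) \<le> N * R + (\<integral>y. \<bar>f y\<bar> \<partial>lborel) / (2 * pi * R)"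
    and integrable_Kconv: "integrable lborel (\<lambda>y. f y *\<^sub>R Kern (x - y))"
    and norm_Kconv_le: "norm (Kconv f x) \<le> N * R + (\<integral>y. \<bar>f y\<bar> \<partial>lborel) / (2 * pi * R)"
proof -
  have [measurable]: "f \<in> borel_measurable borel" using f by auto
  define b where "b = (\<lambda>y. N * (indicator (ball x R) y * norm (Kern (x - y))) + \<bar>f y\<bar> * (1 / (2 * pi * R)))"
  have N0: "N \<ge> 0" using N[of 0] by linarith
  have bi: "integrable lborel b"
    unfolding b_def using f
    by (intro Bochner_Integration.integrable_add integrable_mult_right integrable_mult_left integrable_Kern_ball_shift[OF R] integrable_abs)
  have le: "\<bar>f y\<bar> * norm (Kern (x - y)) \<le> b y" for y
  proof (cases "y \<in> ball x R")
    case True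
    then show ?thesis
      unfolding b_def using N[of y] R by (auto intro!: add_increasing2 mult_right_mono)
  next
    case False
    then have "norm (Kern (x - y)) \<le> 1 / (2 * pi * R)"
      using R unfolding norm_Kern by (intro divide_left_mono mult_left_mono mult_pos_pos) (auto simp: dist_norm intro: less_le_trans[of 0 R])
    then have "\<bar>f y\<bar> * norm (Kern (x - y)) \<le> \<bar>f y\<bar> * (1 / (2 * pi * R))"
      by (rule mult_left_mono) simp
    then show ?thesis using False by (simp add: b_def)
  qed
  show i: "integrable lborel (\<lambda>y. \<bar>f y\<bar> * norm (Kern (x - y)))"
  proof (rule Bochner_Integration.integrable_bound[OF bi])
    show "(\<lambda>y. \<bar>f y\<bar> * norm (Kern (x - y))) \<in> borel_measurable lborel" by measurable
  qed (use le in \<open>auto simp: abs_mult intro: order_trans[OF _ abs_ge_self]\<close>)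
  have "(\<integral>y. \<bar>f y\<bar> * norm (Kern (x - y)) \<partial>lborel) \<le> (\<integral>y. b y \<partial>lborel)"
    by (rule integral_mono[OF i bi le])
  also have "\<dots> = N * (\<integral>y. indicator (ball x R) y * norm (Kern (x - y)) \<partial>lborel) + (\<integral>y. \<bar>f y\<bar> \<partial>lborel) * (1 / (2 * pi * R))"
    unfolding b_def using f integrable_Kern_ball_shift[OF R, of x]
    by (subst Bochner_Integration.integral_add) (auto simp del: Bochner_Integration.integral_divide_zero)
  also have "\<dots> \<le> N * R + (\<integral>y. \<bar>f y\<bar> \<partial>lborel) / (2 * pi * R)"
    using integral_Kern_ball_shift[OF R, of x] N0 by (auto intro: mult_left_mono)
  finally show l: "(\<integral>y. \<bar>f y\<bar> * norm (Kern (x - y)) \<partial>lborel) \<le> N * R + (\<integral>y. \<bar>f y\<bar> \<partial>lborel) / (2 * pi * R)" .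
  show i2: "integrable lborel (\<lambda>y. f y *\<^sub>R Kern (x - y))"
  proof (rule Bochner_Integration.integrable_bound[OF i])
    show "(\<lambda>y. f y *\<^sub>R Kern (x - y)) \<in> borel_measurable lborel" by measurable
  qed auto
  have "norm (Kconv f x) \<le> (\<integral>y. norm (f y *\<^sub>R Kern (x - y)) \<partial>lborel)"
    unfolding Kconv_def by (rule integral_norm_bound)
  then show "norm (Kconv f x) \<le> N * R + (\<integral>y. \<bar>f y\<bar> \<partial>lborel) / (2 * pi * R)"
    using l by simp
qed

text \<open>Unlike the kernel, its cap is Lipschitz; its divergence is the uniform density on the ball of radius \<open>e\<close>.\<close>
definition Kern_cap :: "real \<Rightarrow> pt \<Rightarrow> pt" where
  "Kern_cap e z = (1 / (2 * pi * (max (norm z) e)\<^sup>2)) *\<^sub>R z"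

lemma Kern_cap_borel [measurable]: "Kern_cap e \<in> borel_measurable borel"
  unfolding Kern_cap_def by measurable

lemma continuous_Kern_cap:
  assumes "e > 0" shows "continuous_on S (Kern_cap e)"
proof -
  have "max (norm x) e \<noteq> 0" for x :: pt using assms by (auto simp: max_def)
  then show ?thesis unfolding Kern_cap_def by (intro continuous_intros) auto
qed

lemma Kern_cap_eq: "norm z \<ge> e \<Longrightarrow> Kern_cap e z = Kern z"
  by (simp add: Kern_cap_def Kern_def max_def)

lemma norm_Kern_cap_le:
  assumes "e > 0" shows "norm (Kern_cap e z) \<le> norm (Kern z)" "norm (Kern_cap e z) \<le> 1 / (2 * pi * e)"
proof -
  show "norm (Kern_cap e z) \<le> norm (Kern z)"
  proof (cases "z = 0")
    case True then show ?thesis by (simp add: Kern_cap_def)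
  next
    case False
    then show ?thesis unfolding Kern_cap_def Kern_def
      by (auto intro!: mult_right_mono divide_left_mono mult_left_mono power_mono mult_pos_pos simp: max_def)
  qed
  have m: "max (norm z) e > 0" using assms by auto
  have "norm z / (max (norm z) e)\<^sup>2 \<le> 1 / e"
  proof -
    have "norm z * e \<le> max (norm z) e * max (norm z) e" using assms by (intro mult_mono) auto
    then show ?thesis using m assms by (simp add: field_simps power2_eq_square)
  qed
  then have "norm z / (max (norm z) e)\<^sup>2 / (2 * pi) \<le> 1 / e / (2 * pi)"
    by (intro divide_right_mono) auto
  then show "norm (Kern_cap e z) \<le> 1 / (2 * pi * e)"
    by (simp add: Kern_cap_def field_simps)
qed

text \<open>Inside the ball the cap is the kernel times \<open>\<bar>z\<bar>^2 / e^2\<close>, a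
  factor between 0 and 1; outside the two agree.\<close>

lemma norm_Kern_minus_cap:
  assumes "e > 0" shows "norm (Kern z - Kern_cap e z) \<le> indicator (ball 0 e) z * norm (Kern z)"
proof (cases "norm z < e")
  case True
  have "Kern z - Kern_cap e z = (1 - (norm z)\<^sup>2 / e\<^sup>2) *\<^sub>R Kern z"
  proof (cases "z = 0")
    case True
    then show ?thesis by (simp add: Kern_def Kern_cap_def)
  next
    case False
    have "1 / (2 * pi * (norm z)\<^sup>2) - 1 / (2 * pi * e\<^sup>2) = (1 - (norm z)\<^sup>2 / e\<^sup>2) * (1 / (2 * pi * (norm z)\<^sup>2))"
      using False assms by (simp add: field_simps)
    then show ?thesis
      using True by (simp add: Kern_def Kern_cap_def max_def flip: scaleR_left_diff_distrib)
  qed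
  moreover have "0 \<le> (norm z)\<^sup>2 / e\<^sup>2" "(norm z)\<^sup>2 / e\<^sup>2 \<le> 1"
    using True assms by (auto simp: divide_simps power_mono)
  ultimately show ?thesis using True by (auto intro!: mult_left_le_one_le)
qed (use Kern_cap_eq in auto)

text \<open>Uniform limit of the convolutions with the capped kernels: the error is at most
  \<open>N * e\<close>, and a capped kernel is bounded and continuous, so its convolution is
  continuous by dominated convergence.\<close>

lemma continuous_Kconv:
  assumes f: "integrable lborel f" and N: "\<And>x. \<bar>f x\<bar> \<le> N"
  shows "continuous_on UNIV (Kconv f)"
proof -
  have [measurable]: "f \<in> borel_measurable borel" using f by auto
  define Ke where "Ke e x = (\<integral>y. f y *\<^sub>R Kern_cap e (x - y) \<partial>lborel)" for e x
  have N0: "N \<ge> 0" using N[of 0] by linarith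
  have int: "integrable lborel (\<lambda>y. f y *\<^sub>R Kern_cap e (x - y))" if "e > 0" for e x
  proof (rule Bochner_Integration.integrable_bound[OF integrable_Kconv_norm[OF f N zero_less_one, of x]])
    show "(\<lambda>y. f y *\<^sub>R Kern_cap e (x - y)) \<in> borel_measurable lborel" by measurable
  qed (use norm_Kern_cap_le(1)[OF that] in \<open>auto intro!: AE_I2 mult_left_mono\<close>)
  have unif: "dist (Ke e x) (Kconv f x) \<le> N * e" if e: "e > 0" for e x
  proof -
    have "norm (Kconv f x - Ke e x) = norm (\<integral>y. f y *\<^sub>R (Kern (x - y) - Kern_cap e (x - y)) \<partial>lborel)"
      unfolding Kconv_def Ke_def
      by (subst Bochner_Integration.integral_diff[symmetric]) (auto simp: int[OF e] integrable_Kconv[OF f N zero_less_one] scaleR_diff_right)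
    also have "\<dots> \<le> (\<integral>y. N * (indicator (ball x e) y * norm (Kern (x - y))) \<partial>lborel)"
    proof (rule Bochner_Integration.integral_norm_bound_integral)
      show "integrable lborel (\<lambda>y. f y *\<^sub>R (Kern (x - y) - Kern_cap e (x - y)))"
        unfolding scaleR_diff_right using int[OF e] integrable_Kconv[OF f N zero_less_one]
        by (intro Bochner_Integration.integrable_diff)
      show "integrable lborel (\<lambda>y. N * (indicator (ball x e) y * norm (Kern (x - y))))"
        using integrable_Kern_ball_shift[OF e, of x] by (intro integrable_mult_right)
      fix y
      have "indicator (ball x e) y = (indicator (ball 0 e) (x - y) :: real)"
        by (auto simp: indicator_def dist_norm norm_minus_commute)
      then show "norm (f y *\<^sub>R (Kern (x - y) - Kern_cap e (x - y))) \<le> N * (indicator (ball x e) y * norm (Kern (x - y)))"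
        using norm_Kern_minus_cap[OF e, of "x - y"] N[of y] N0
        by (auto intro!: mult_mono)
    qed
    also have "\<dots> \<le> N * e"
      using integral_Kern_ball_shift[OF e, of x] N0 by (auto intro: mult_left_mono)
    finally show ?thesis by (simp add: dist_norm norm_minus_commute)
  qed
  have cont: "continuous_on UNIV (Ke e)" if e: "e > 0" for e
  proof -
    have "(\<lambda>n. Ke e (xs n)) \<longlonglongrightarrow> Ke e x" if xs: "xs \<longlonglongrightarrow> x" for xs x
      unfolding Ke_def
    proof (rule integral_dominated_convergence[where w = "\<lambda>y. \<bar>f y\<bar> * (1 / (2 * pi * e))"])
      show "integrable lborel (\<lambda>y. \<bar>f y\<bar> * (1 / (2 * pi * e)))"
        using f by (intro integrable_mult_left integrable_abs)
      show "AE y in lborel. (\<lambda>n. f y *\<^sub>R Kern_cap e (xs n - y)) \<longlonglongrightarrow> f y *\<^sub>R Kern_cap e (x - y)"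
        using continuous_Kern_cap[OF e, of UNIV] xs
        by (intro AE_I2 tendsto_intros continuous_on_tendsto_compose[of UNIV "Kern_cap e"]) auto
      show "AE y in lborel. norm (f y *\<^sub>R Kern_cap e (xs n - y)) \<le> \<bar>f y\<bar> * (1 / (2 * pi * e))" for n
        using norm_Kern_cap_le(2)[OF e] by (intro AE_I2) (simp del: times_divide_eq_right mult_1_right, intro mult_left_mono, auto)
    qed measurable
    then show ?thesis by (auto simp: continuous_on_sequentially o_def)
  qed
  have ul: "uniform_limit UNIV (\<lambda>n. Ke (1 / real (Suc n))) (Kconv f) sequentially"
  proof (rule uniform_limitI)
    fix r :: real assume "r > 0"
    have "(\<lambda>n. N * (1 / real (Suc n))) \<longlonglongrightarrow> N * 0"
      by (intro tendsto_intros LIMSEQ_Suc lim_1_over_n)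
    then have "\<forall>\<^sub>F n in sequentially. N * (1 / real (Suc n)) < r"
      using \<open>r > 0\<close> by (auto dest: order_tendstoD(2))
    then show "\<forall>\<^sub>F n in sequentially. \<forall>x\<in>UNIV. dist (Ke (1 / real (Suc n)) x) (Kconv f x) < r"
    proof (rule eventually_mono, intro ballI)
      fix n x assume "N * (1 / real (Suc n)) < r"
      then show "dist (Ke (1 / real (Suc n)) x) (Kconv f x) < r"
        using unif[of "1 / real (Suc n)" x] by (simp only: zero_less_divide_1_iff) simp
    qed
  qed
  show ?thesis
    by (rule uniform_limit_theorem[OF _ ul]) (auto intro!: always_eventually cont)
qed

subsection \<open>Divergence theorem for compactly supported Lipschitz fields\<close>

lemma has_derivative_along_line:
  fixes f :: "'a::real_normed_vector \<Rightarrow> 'b::real_normed_vector"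
  assumes "(f has_derivative f') (at (x + s *\<^sub>R v))"
  shows "((\<lambda>s. f (x + s *\<^sub>R v)) has_derivative (\<lambda>h. h *\<^sub>R f' v)) (at s)"
proof -
  interpret f': bounded_linear f' using assms by (rule has_derivative_bounded_linear)
  have "((\<lambda>s. x + s *\<^sub>R v) has_derivative (\<lambda>h. h *\<^sub>R v)) (at s)"
    by (auto intro!: derivative_eq_intros)
  from has_derivative_compose[OF this assms] show ?thesis
    by (simp add: f'.scaleR o_def)
qed

lemma tendsto_difference_quotient:
  fixes V :: "pt \<Rightarrow> pt"
  assumes V: "(V has_derivative V') (at x)" and h: "h \<longlonglongrightarrow> 0" "\<And>n::nat. h n \<noteq> 0"
  shows "(\<lambda>n. (V (h n *\<^sub>R v + x) $ i - V x $ i) / h n) \<longlonglongrightarrow> V' v $ i"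
proof -
  have "((\<lambda>s. V (x + s *\<^sub>R v)) has_derivative (\<lambda>h. h *\<^sub>R V' v)) (at 0)"
    using has_derivative_along_line[of V V' x 0 v] V by simp
  from bounded_linear.has_derivative[OF bounded_linear_vec_nth this, of i]
  have "((\<lambda>s. V (x + s *\<^sub>R v) $ i) has_real_derivative V' v $ i) (at 0)"
    by (simp add: has_field_derivative_def mult.commute[of "V' v $ i"] mult_commute_abs)
  then have "((\<lambda>s. (V (x + s *\<^sub>R v) $ i - V x $ i) / s) \<longlongrightarrow> V' v $ i) (at 0)"
    by (simp add: DERIV_def)
  moreover have "filterlim h (at 0) sequentially"
    using h by (auto simp: filterlim_at)
  ultimately have "((\<lambda>n. (V (x + h n *\<^sub>R v) $ i - V x $ i) / h n) \<longlonglongrightarrow> V' v $ i)"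
    by (rule filterlim_compose)
  then show ?thesis by (simp add: add.commute)
qed

lemma tr2_eq: "tr2 L = L (axis 1 1) $ 1 + L (axis 2 1) $ 2"
  by (simp add: tr2_def sum_2)

lemma axis_offdiag: "(axis 1 1 :: pt) $ 2 = 0" "(axis 2 1 :: pt) $ 1 = 0"
  by (simp_all add: axis_def)

lemma tr2_scaleR_rank_one: "tr2 (\<lambda>h. p *\<^sub>R h + (q * (y \<bullet> h)) *\<^sub>R y) = 2 * p + q * (y \<bullet> y)"
  using axis_offdiag by (simp add: tr2_eq inner_vec_def sum_2 algebra_simps)

text \<open>By translation invariance the difference quotients integrate to 0, and they converge dominatedly.\<close>
lemma
  fixes V :: "pt \<Rightarrow> pt"
  assumes lip: "\<And>x y. norm (V x - V y) \<le> L * norm (x - y)"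
    and supp: "\<And>x. norm x \<ge> R \<Longrightarrow> V x = 0"
    and der: "AE x in lborel. \<exists>V'. (V has_derivative V') (at x) \<and> tr2 V' = d x"
    and d [measurable]: "d \<in> borel_measurable borel"
  shows integrable_divergence: "integrable lborel d"
    and integral_divergence_zero: "(\<integral>x. d x \<partial>lborel) = 0"
proof -
  define h where "h n = 1 / real (Suc n)" for n
  have h: "h \<longlonglongrightarrow> 0" "h n > 0" "h n \<le> 1" for n
    unfolding h_def using LIMSEQ_Suc[OF lim_1_over_n] by auto
  define q where "q n x = (\<Sum>i\<in>UNIV. (V (h n *\<^sub>R axis i 1 + x) $ i - V x $ i) / h n)" for n x
  have "L-lipschitz_on UNIV V"
    unfolding lipschitz_on_def using lip[of "axis 1 1" 0]
    by (auto simp: dist_norm lip intro: order_trans[OF norm_ge_zero])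
  then have Vc: "continuous_on UNIV V" by (rule lipschitz_on_continuous_on)
  have L0: "L \<ge> 0" using order_trans[OF norm_ge_zero lip[of "axis 1 1" 0]] by simp
  have Vm [measurable]: "V \<in> borel_measurable borel"
    using Vc by (rule borel_measurable_continuous_onI)
  have Vmi [measurable]: "(\<lambda>x. V x $ i) \<in> borel_measurable borel" for i
    using Vc by (intro borel_measurable_continuous_onI continuous_intros)
  have wi: "integrable lborel (\<lambda>x::pt. c * indicator (ball 0 r) x)" for c r :: real
    by simp
  \<comment> \<open>Boundedness comes from comparing \<open>V x\<close> with the value at
    \<open>\<bar>R\<bar> *\<^sub>R axis 1 1\<close>, which is 0; the absolute value is there because
    \<open>R\<close> may be negative.\<close>
  have bd: "\<bar>V x $ i\<bar> \<le> (L * (2 * \<bar>R\<bar>)) * indicator (ball 0 \<bar>R\<bar>) x" for x i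
  proof (cases "norm x < \<bar>R\<bar>")
    case True
    have "norm (V x) \<le> L * norm (x - \<bar>R\<bar> *\<^sub>R axis 1 1)"
      using lip[of x "\<bar>R\<bar> *\<^sub>R axis 1 1"] supp[of "\<bar>R\<bar> *\<^sub>R axis 1 1"] by simp
    also have "norm (x - \<bar>R\<bar> *\<^sub>R axis 1 1) \<le> 2 * \<bar>R\<bar>"
      using True norm_triangle_ineq4[of x "\<bar>R\<bar> *\<^sub>R axis 1 1"] by simp
    finally have "norm (V x) \<le> L * (2 * \<bar>R\<bar>)" using L0 by (simp add: mult_left_mono)
    then show ?thesis using True component_le_norm_cart[of "V x" i] by simp
  qed (use supp[of x] in auto)
  have Vi: "integrable lborel (\<lambda>x. V x $ i)" for i
    by (rule Bochner_Integration.integrable_bound[OF wi[of "L * (2 * \<bar>R\<bar>)" "\<bar>R\<bar>"]])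
       (use bd[of _ i] in \<open>auto intro!: AE_I2 order_trans[OF _ abs_ge_self]\<close>)
  have Vti: "integrable lborel (\<lambda>x. V (t + x) $ i)" for i t
    using Vi[of i] integrable_lborel_translate[OF Vmi, of t i] by simp
  have q0: "(\<integral>x. q n x \<partial>lborel) = 0" for n
    unfolding q_def using Vi Vti
    by (subst Bochner_Integration.integral_sum)
       (auto simp: integral_lborel_translate[OF Vmi] intro!: Bochner_Integration.integrable_diff integrable_divide)
  have qm: "q n \<in> borel_measurable lborel" for n
  proof -
    have "(\<lambda>x. V (h n *\<^sub>R axis i 1 + x) $ i) \<in> borel_measurable lborel" for i
      using Vti[of "h n *\<^sub>R axis i 1" i] by (rule borel_measurable_integrable)
    then show ?thesis unfolding q_def by measurable
  qed
  have lim: "AE x in lborel. (\<lambda>n. q n x) \<longlonglongrightarrow> d x"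
    using der
  proof eventually_elim
    case (elim x)
    then obtain V' where V': "(V has_derivative V') (at x)" "tr2 V' = d x" by auto
    show ?case unfolding q_def V'(2)[symmetric] tr2_def
      using h by (intro tendsto_sum tendsto_difference_quotient[OF V'(1)]) (auto simp: less_imp_neq[symmetric])
  qed
  \<comment> \<open>As \<open>h n \<le> 1\<close>, all difference quotients vanish outside one ball,
    so a single multiple of its indicator dominates them.\<close>
  have dom: "norm (q n x) \<le> (2 * L) * indicator (ball 0 (\<bar>R\<bar> + 1)) x" for n x
  proof (cases "norm x < \<bar>R\<bar> + 1")
    case True
    have "\<bar>(V (h n *\<^sub>R axis i 1 + x) $ i - V x $ i) / h n\<bar> \<le> L" for i
    proof -
      have "\<bar>V (h n *\<^sub>R axis i 1 + x) $ i - V x $ i\<bar> \<le> L * h n"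
        using lip[of "h n *\<^sub>R axis i 1 + x" x] component_le_norm_cart[of "V (h n *\<^sub>R axis i 1 + x) - V x" i] h(2)[of n]
        by (simp add: norm_axis_1)
      then show ?thesis using h(2)[of n] by (simp add: abs_divide divide_simps)
    qed
    then have "norm (q n x) \<le> (\<Sum>i\<in>(UNIV::2 set). L)"
      unfolding q_def real_norm_def by (intro order_trans[OF sum_abs] sum_mono)
    then show ?thesis using True by simp
  next
    case False
    have "V (h n *\<^sub>R axis i 1 + x) = 0" for i
    proof (rule supp)
      have "norm x \<le> norm (h n *\<^sub>R axis i 1 + x) + norm (h n *\<^sub>R (axis i 1 :: pt))"
        by (metis add_diff_cancel_left' norm_triangle_ineq4 add.commute)
      then show "R \<le> norm (h n *\<^sub>R axis i 1 + x)"
        using False h(2,3)[of n] by (simp add: norm_axis_1)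
    qed
    moreover have "V x = 0" using False by (intro supp) auto
    ultimately show ?thesis using False by (simp add: q_def)
  qed
  have dm: "d \<in> borel_measurable lborel" using d by simp
  note dc = dm qm wi[of "2 * L" "\<bar>R\<bar> + 1"] lim AE_I2[OF dom]
  show "integrable lborel d"
    by (rule integrable_dominated_convergence[OF dc])
  have "(\<lambda>n. \<integral>x. q n x \<partial>lborel) \<longlonglongrightarrow> (\<integral>x. d x \<partial>lborel)"
    by (rule integral_dominated_convergence[OF dc])
  then show "(\<integral>x. d x \<partial>lborel) = 0"
    unfolding q0 by (simp add: LIMSEQ_const_iff)
qed

lemma has_derivative_zero_outside:
  fixes V :: "'a::real_normed_vector \<Rightarrow> 'b::real_normed_vector"
  assumes V: "(V has_derivative V') (at x)" and supp: "\<And>x. norm x \<ge> R \<Longrightarrow> V x = 0" and x: "norm x > R"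
  shows "V' = (\<lambda>_. 0)"
proof -
  have o: "open {x :: 'a. norm x > R}" by (intro open_Collect_less continuous_intros)
  have "((\<lambda>_. 0) has_derivative (\<lambda>_. 0 :: 'b)) (at x)" by simp
  then have "(V has_derivative (\<lambda>_. 0)) (at x)"
    by (rule has_derivative_transform_within_open[OF _ o]) (use x in \<open>auto simp: supp less_imp_le\<close>)
  then show ?thesis using V by (rule has_derivative_unique[symmetric])
qed

lemma lipschitz_compact_support:
  fixes V :: "pt \<Rightarrow> pt"
  assumes V: "\<And>x. (V has_derivative V' x) (at x)"
    and c: "\<And>i j. continuous_on UNIV (\<lambda>x. V' x (axis j 1) $ i)"
    and supp: "\<And>x. norm x \<ge> R \<Longrightarrow> V x = 0"
  obtains L where "\<And>x y. norm (V x - V y) \<le> L * norm (x - y)"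
proof -
  let ?S = "\<lambda>x. \<Sum>j\<in>UNIV. \<Sum>i\<in>UNIV. \<bar>V' x (axis j 1) $ i\<bar>"
  have "continuous_on (cball 0 \<bar>R\<bar>) ?S"
    by (intro continuous_intros continuous_on_subset[OF c]) auto
  then have "bounded (?S ` cball 0 \<bar>R\<bar>)"
    by (intro compact_imp_bounded compact_continuous_image) auto
  then obtain L where L: "L > 0" "\<forall>v\<in>?S ` cball 0 \<bar>R\<bar>. norm v \<le> L"
    unfolding bounded_pos by blast
  have on: "onorm (V' x) \<le> L" for x
  proof (rule onorm_le)
    fix h :: pt
    interpret V': bounded_linear "V' x" using V by (rule has_derivative_bounded_linear)
    have "norm (V' x h) \<le> ?S x * norm h"
    proof -
      have "V' x h = V' x (\<Sum>j\<in>UNIV. h $ j *\<^sub>R axis j 1)"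
        using basis_expansion[of h] by (simp add: scalar_mult_eq_scaleR)
      also have "\<dots> = (\<Sum>j\<in>UNIV. h $ j *\<^sub>R V' x (axis j 1))"
        by (simp add: V'.sum V'.scaleR)
      also have "norm \<dots> \<le> (\<Sum>j\<in>UNIV. norm h * (\<Sum>i\<in>UNIV. \<bar>V' x (axis j 1) $ i\<bar>))"
        using component_le_norm_cart[of h] norm_le_l1_cart
        by (intro order_trans[OF norm_sum] sum_mono) (auto intro!: mult_mono sum_nonneg)
      finally show ?thesis by (simp add: sum_distrib_left mult.commute)
    qed
    also have "?S x * norm h \<le> L * norm h"
    proof (cases "norm x \<le> \<bar>R\<bar>")
      case True
      then have "norm (?S x) \<le> L" by (intro L(2)[rule_format] imageI) simp
      then show ?thesis by (intro mult_right_mono) auto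
    next
      case False
      then have "V' x = (\<lambda>_. 0)" using has_derivative_zero_outside[OF V supp] by auto
      then show ?thesis using L(1) by simp
    qed
    finally show "norm (V' x h) \<le> L * norm h" .
  qed
  have "norm (V x - V y) \<le> L * norm (x - y)" for x y
    by (rule differentiable_bound[of UNIV V V']) (use V on in auto)
  then show ?thesis by (rule that)
qed

text \<open>Continuous partial derivatives and compact support supply the Lipschitz constant.
  Continuity is stated entrywise because this is how it is given for the Hessian of the
  solution.\<close>

lemma integral_divergence_zero_C1:
  fixes V :: "pt \<Rightarrow> pt"
  assumes V: "\<And>x. (V has_derivative V' x) (at x)"
    and c: "\<And>i j. continuous_on UNIV (\<lambda>x. V' x (axis j 1) $ i)"
    and supp: "\<And>x. norm x \<ge> R \<Longrightarrow> V x = 0"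
  shows "integrable lborel (\<lambda>x. tr2 (V' x))" "(\<integral>x. tr2 (V' x) \<partial>lborel) = 0"
proof -
  obtain L where L: "\<And>x y. norm (V x - V y) \<le> L * norm (x - y)"
    using lipschitz_compact_support[OF assms] by blast
  have m: "(\<lambda>x. tr2 (V' x)) \<in> borel_measurable borel"
    unfolding tr2_def by (intro borel_measurable_continuous_onI continuous_intros c)
  show "integrable lborel (\<lambda>x. tr2 (V' x))" "(\<integral>x. tr2 (V' x) \<partial>lborel) = 0"
    by (rule integrable_divergence[of V L R] integral_divergence_zero[of V L R]; use L supp m V in blast)+
qed

text \<open>Regularity stops at \<open>C^1\<close> so that a test function times a slice of the
  solution is again a test function; the gradient and a support radius are carried along
  explicitly.\<close>

definition test_fun :: "real \<Rightarrow> (pt \<Rightarrow> real) \<Rightarrow> (pt \<Rightarrow> pt) \<Rightarrow> bool" where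
  "test_fun R \<eta> g \<longleftrightarrow> (\<forall>x. (\<eta> has_derivative (\<lambda>h. g x \<bullet> h)) (at x)) \<and> continuous_on UNIV g \<and>
     (\<forall>x. norm x \<ge> R \<longrightarrow> \<eta> x = 0)"

lemma test_fun_continuous:
  assumes "test_fun R \<eta> g" shows "continuous_on UNIV \<eta>" "continuous_on UNIV g"
  using assms by (auto simp: test_fun_def intro: continuous_at_imp_continuous_on has_derivative_continuous)

lemma test_fun_zero: "test_fun R \<eta> g \<Longrightarrow> norm x \<ge> R \<Longrightarrow> \<eta> x = 0"
  by (simp add: test_fun_def)

lemma test_fun_grad_zero:
  assumes "test_fun R \<eta> g" "norm x > R" shows "g x = 0"
proof -
  have "(\<lambda>h. g x \<bullet> h) = (\<lambda>_. 0)"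
    using assms by (intro has_derivative_zero_outside[of \<eta> _ x R]) (auto simp: test_fun_def)
  then show ?thesis by (metis inner_eq_zero_iff)
qed

lemma test_fun_bounds:
  assumes t: "test_fun R \<eta> g"
  obtains N where "N > 0" "\<And>x. norm (g x) \<le> N * indicator (cball 0 \<bar>R\<bar>) x" "\<And>x y. \<bar>\<eta> x - \<eta> y\<bar> \<le> N * norm (x - y)"
    "\<And>x. \<bar>\<eta> x\<bar> \<le> N * indicator (cball 0 \<bar>R\<bar>) x"
proof -
  note c = test_fun_continuous(2,1)[OF t]
  have "bounded (g ` cball 0 \<bar>R\<bar>)" "bounded (\<eta> ` cball 0 \<bar>R\<bar>)"
    by (intro compact_imp_bounded compact_continuous_image continuous_on_subset[OF c(1)] continuous_on_subset[OF c(2)]; simp)+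
  then obtain N1 N2 where N': "N1 > 0" "\<forall>v\<in>g ` cball 0 \<bar>R\<bar>. norm v \<le> N1" "N2 > 0" "\<forall>v\<in>\<eta> ` cball 0 \<bar>R\<bar>. norm v \<le> N2"
    unfolding bounded_pos by blast
  have N: "N1 > 0" "\<And>x. norm x \<le> \<bar>R\<bar> \<Longrightarrow> norm (g x) \<le> N1" "N2 > 0" "\<And>x. norm x \<le> \<bar>R\<bar> \<Longrightarrow> \<bar>\<eta> x\<bar> \<le> N2"
    using N' by auto
  define N where "N = max N1 N2"
  have N0: "N > 0" "N1 \<le> N" "N2 \<le> N" using N by (auto simp: N_def)
  have g: "norm (g x) \<le> N * indicator (cball 0 \<bar>R\<bar>) x" for x
    using N(2)[of x] N0 test_fun_grad_zero[OF t, of x] by (cases "norm x \<le> \<bar>R\<bar>") auto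
  have e: "\<bar>\<eta> x\<bar> \<le> N * indicator (cball 0 \<bar>R\<bar>) x" for x
    using N(4)[of x] N0 t by (cases "norm x \<le> \<bar>R\<bar>") (auto simp: test_fun_def)
  have "onorm (\<lambda>h. g x \<bullet> h) \<le> N" for x
  proof (rule onorm_le)
    fix h
    have "norm (g x) \<le> N" using g[of x] N0 by (cases "norm x \<le> \<bar>R\<bar>") auto
    then show "norm (g x \<bullet> h) \<le> N * norm h"
      using Cauchy_Schwarz_ineq2[of "g x" h] by (metis mult_right_mono norm_ge_zero order_trans real_norm_def)
  qed
  then have "norm (\<eta> x - \<eta> y) \<le> N * norm (x - y)" for x y
    using t by (intro differentiable_bound[of UNIV \<eta> "\<lambda>x h. g x \<bullet> h"]) (auto simp: test_fun_def)
  then show ?thesis using that[OF N0(1) g _ e] by simp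
qed

text \<open>Supplies the Lipschitz hypothesis of the divergence theorem. With
  \<open>m z = max (norm z) e\<close>, itself 1-Lipschitz, the difference splits into a change of
  the vector (\<open>1 / e^2\<close>) and a change of the factor \<open>1 / m^2\<close>
  (\<open>2 / e^2\<close>), whence the 3.\<close>

lemma Kern_cap_lipschitz:
  assumes e: "e > 0"
  shows "norm (Kern_cap e x - Kern_cap e y) \<le> 3 / (2 * pi * e\<^sup>2) * norm (x - y)"
proof -
  define m where "m z = max (norm z) e" for z :: pt
  have m: "m z > 0" "e \<le> m z" "norm z \<le> m z" for z using e by (auto simp: m_def)
  have ml: "\<bar>m y - m x\<bar> \<le> norm (x - y)"
    using norm_triangle_ineq3[of x y] by (auto simp: m_def)
  have eq: "(1 / (m x)\<^sup>2) *\<^sub>R x - (1 / (m y)\<^sup>2) *\<^sub>R y = (1 / (m x)\<^sup>2) *\<^sub>R (x - y) + (((m y - m x) * (m y + m x)) / ((m x)\<^sup>2 * (m y)\<^sup>2)) *\<^sub>R y"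
  proof -
    have "1 / (m x)\<^sup>2 - 1 / (m y)\<^sup>2 = ((m y - m x) * (m y + m x)) / ((m x)\<^sup>2 * (m y)\<^sup>2)"
      using m(1)[of x] m(1)[of y] by (simp add: field_simps power2_eq_square)
    then have "((m y - m x) * (m y + m x)) / ((m x)\<^sup>2 * (m y)\<^sup>2) = 1 / (m x)\<^sup>2 - 1 / (m y)\<^sup>2" by simp
    then show ?thesis
      by (simp only: scaleR_left_diff_distrib scaleR_right_diff_distrib) simp
  qed
  have a: "1 / (m x)\<^sup>2 \<le> 1 / e\<^sup>2"
    using m[of x] e by (intro divide_left_mono power_mono) auto
  have b: "(m y + m x) / ((m x)\<^sup>2 * (m y)\<^sup>2) * norm y \<le> 2 / e\<^sup>2"
  proof -
    have "(m y + m x) / ((m x)\<^sup>2 * (m y)\<^sup>2) * norm y \<le> (m y + m x) / ((m x)\<^sup>2 * (m y)\<^sup>2) * m y"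
      using m(1,3)[of y] m(1)[of x] by (intro mult_left_mono) auto
    also have "\<dots> = 1 / (m x)\<^sup>2 + 1 / (m x * m y)"
      using m(1)[of y] m(1)[of x] by (simp add: field_simps power2_eq_square)
    also have "\<dots> \<le> 1 / e\<^sup>2 + 1 / e\<^sup>2"
      using m[of x] m[of y] e unfolding power2_eq_square by (intro add_mono divide_left_mono mult_mono mult_pos_pos) auto
    finally show ?thesis by simp
  qed
  have "norm ((1 / (m x)\<^sup>2) *\<^sub>R x - (1 / (m y)\<^sup>2) *\<^sub>R y) \<le> 1 / (m x)\<^sup>2 * norm (x - y) + \<bar>m y - m x\<bar> * ((m y + m x) / ((m x)\<^sup>2 * (m y)\<^sup>2) * norm y)"
    unfolding eq using m(1)[of x] m(1)[of y] by (intro order_trans[OF norm_triangle_ineq]) (simp add: abs_mult abs_divide)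
  also have "\<dots> \<le> 1 / e\<^sup>2 * norm (x - y) + norm (x - y) * (2 / e\<^sup>2)"
    using a b ml m(1)[of x] m(1)[of y] by (intro add_mono mult_mono) auto
  also have "\<dots> = 3 / e\<^sup>2 * norm (x - y)" by (simp add: field_simps)
  finally have *: "norm ((1 / (m x)\<^sup>2) *\<^sub>R x - (1 / (m y)\<^sup>2) *\<^sub>R y) \<le> 3 / e\<^sup>2 * norm (x - y)" .
  have "Kern_cap e x - Kern_cap e y = (1 / (2 * pi)) *\<^sub>R ((1 / (m x)\<^sup>2) *\<^sub>R x - (1 / (m y)\<^sup>2) *\<^sub>R y)"
    by (simp add: Kern_cap_def m_def scaleR_right_diff_distrib)
  then have "norm (Kern_cap e x - Kern_cap e y) = (1 / (2 * pi)) * norm ((1 / (m x)\<^sup>2) *\<^sub>R x - (1 / (m y)\<^sup>2) *\<^sub>R y)"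
    by simp
  also have "\<dots> \<le> (1 / (2 * pi)) * (3 / e\<^sup>2 * norm (x - y))"
    using * by (intro mult_left_mono) auto
  finally show ?thesis by (simp add: field_simps)
qed

text \<open>Inside the ball the cap is a multiple of the identity, outside it is the divergence-free
  kernel. The circle where the two formulas meet is excluded; it is a null set.\<close>

lemma Kern_cap_divergence:
  assumes e: "e > 0" and x: "norm x \<noteq> e"
  shows "\<exists>K'. (Kern_cap e has_derivative K') (at x) \<and> tr2 K' = indicator (ball 0 e) x * (1 / (pi * e\<^sup>2))"
proof (cases "norm x < e")
  case True
  let ?K' = "\<lambda>h::pt. (1 / (2 * pi * e\<^sup>2)) *\<^sub>R h"
  have "((\<lambda>z. (1 / (2 * pi * e\<^sup>2)) *\<^sub>R z) has_derivative ?K') (at x)"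
    by (auto intro!: derivative_eq_intros)
  then have "(Kern_cap e has_derivative ?K') (at x)"
    by (rule has_derivative_transform_within_open[of _ _ _ _ "ball 0 e"]) (use True in \<open>auto simp: Kern_cap_def max_def\<close>)
  moreover have "tr2 ?K' = indicator (ball 0 e) x * (1 / (pi * e\<^sup>2))"
    using True by (simp add: tr2_def axis_def)
  ultimately show ?thesis by blast
next
  case False
  then have gt: "norm x > e" using x by auto
  then have x0: "x \<noteq> 0" using e by auto
  let ?K' = "\<lambda>h. (1 / (2 * pi * (x \<bullet> x))) *\<^sub>R h - ((x \<bullet> h) / (pi * (x \<bullet> x)\<^sup>2)) *\<^sub>R x"
  have "((\<lambda>z. (1 / (2 * pi * (z \<bullet> z))) *\<^sub>R z) has_derivative ?K') (at x)"
    using x0 by (auto intro!: derivative_eq_intros ext simp: inner_commute power2_eq_square field_simps scaleR_add_left)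
  moreover have "open {z :: pt. norm z > e}" by (intro open_Collect_less continuous_intros)
  ultimately have "(Kern_cap e has_derivative ?K') (at x)"
    by (rule has_derivative_transform_within_open) (use gt in \<open>auto simp: Kern_cap_def max_def power2_norm_eq_inner\<close>)
  moreover have "tr2 ?K' = indicator (ball 0 e) x * (1 / (pi * e\<^sup>2))"
  proof -
    have xx: "x \<bullet> x = x $ 1 * x $ 1 + x $ 2 * x $ 2" by (simp add: inner_vec_def sum_2)
    have "tr2 ?K' = 2 / (2 * pi * (x \<bullet> x)) - (x $ 1 * x $ 1 + x $ 2 * x $ 2) / (pi * (x \<bullet> x)\<^sup>2)"
      by (simp add: tr2_eq inner_axis axis_nth add_divide_distrib)
    also have "\<dots> = 0" unfolding xx[symmetric] using x0 by (simp add: power2_eq_square field_simps)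
    finally show ?thesis using gt by simp
  qed
  ultimately show ?thesis by blast
qed

subsection \<open>The weak divergence of the convolution\<close>

lemma AE_norm_neq: "AE x in lborel. norm (x::pt) \<noteq> e"
proof -
  have "{x::pt. norm x = e} \<in> null_sets lborel"
  proof -
    have "sphere (0::pt) e \<in> null_sets lebesgue"
      using negligible_sphere[of "0::pt" e] by (simp add: negligible_iff_null_sets)
    then have "sphere (0::pt) e \<in> null_sets lborel"
      by (auto simp: null_sets_def)
    moreover have "{x::pt. norm x = e} = sphere 0 e" by auto
    ultimately show ?thesis by simp
  qed
  then show ?thesis by (rule AE_I') auto
qed

text \<open>This is the trace of the product rule,
  \<open>div (\<eta> V) = \<eta> div V + \<nabla>\<eta> \<bullet> V\<close>.\<close>

lemma tr2_scaleR_sum: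
  assumes "bounded_linear K"
  shows "tr2 (\<lambda>h. c *\<^sub>R K h + (g \<bullet> h) *\<^sub>R v) = c * tr2 K + g \<bullet> v"
  using axis_offdiag by (simp add: tr2_eq inner_vec_def sum_2 algebra_simps)

lemma test_fun_integrable:
  assumes t: "test_fun R \<eta> g"
  shows "integrable lborel \<eta>" "integrable lborel (\<lambda>x. norm (g x))"
    "\<eta> \<in> borel_measurable borel" "g \<in> borel_measurable borel"
proof -
  obtain N where N: "N > 0" "\<And>x. norm (g x) \<le> N * indicator (cball 0 \<bar>R\<bar>) x" "\<And>x. \<bar>\<eta> x\<bar> \<le> N * indicator (cball 0 \<bar>R\<bar>) x"
    using test_fun_bounds[OF t] by metis
  show m[measurable]: "\<eta> \<in> borel_measurable borel" "g \<in> borel_measurable borel"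
    using test_fun_continuous[OF t] by (auto intro: borel_measurable_continuous_onI)
  have i: "integrable lborel (\<lambda>x::pt. N * indicator (cball 0 \<bar>R\<bar>) x)"
    by simp
  show "integrable lborel \<eta>"
    by (rule Bochner_Integration.integrable_bound[OF i]) (use m N(3) in \<open>auto intro!: AE_I2 order_trans[OF _ abs_ge_self]\<close>)
  have "(\<lambda>x. norm (g x)) \<in> borel_measurable lborel" by measurable
  then show "integrable lborel (\<lambda>x. norm (g x))"
    by (rule Bochner_Integration.integrable_bound[OF i]) (use m N(2) in \<open>auto intro!: AE_I2 order_trans[OF _ abs_ge_self]\<close>)
qed

lemma integrable_test_mult:
  fixes w :: "pt \<Rightarrow> pt"
  assumes t: "test_fun R \<eta> g" and w: "w \<in> borel_measurable borel" "\<And>x. norm (w x) \<le> B"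
  shows "integrable lborel (\<lambda>x. w x \<bullet> g x)"
proof -
  note [measurable] = test_fun_integrable(4)[OF t] w(1)
  have "integrable lborel (\<lambda>x. B * norm (g x))"
    using test_fun_integrable(2)[OF t] by simp
  moreover have "(\<lambda>x. w x \<bullet> g x) \<in> borel_measurable lborel" by measurable
  moreover have "AE x in lborel. norm (w x \<bullet> g x) \<le> norm (B * norm (g x))"
  proof (rule AE_I2)
    fix x
    have "\<bar>w x \<bullet> g x\<bar> \<le> norm (w x) * norm (g x)" by (rule Cauchy_Schwarz_ineq2)
    also have "\<dots> \<le> B * norm (g x)" using w(2)[of x] by (intro mult_right_mono) auto
    finally show "norm (w x \<bullet> g x) \<le> norm (B * norm (g x))" by simp
  qed
  ultimately show ?thesis by (rule Bochner_Integration.integrable_bound)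
qed

text \<open>Divergence theorem for the field \<open>\<eta>\<close> times the capped kernel. The
  right-hand side is minus the mean of \<open>\<eta>\<close> over the ball, an approximation of the
  point evaluation at 0.\<close>

lemma integral_Kern_cap_grad:
  assumes t: "test_fun R \<eta> g" and e: "e > 0"
  shows "(\<integral>x. Kern_cap e x \<bullet> g x \<partial>lborel) = - (\<integral>x. indicator (ball 0 e) x * \<eta> x \<partial>lborel) / (pi * e\<^sup>2)"
proof -
  obtain N where N: "N > 0" "\<And>x y. \<bar>\<eta> x - \<eta> y\<bar> \<le> N * norm (x - y)" "\<And>x. \<bar>\<eta> x\<bar> \<le> N * indicator (cball 0 \<bar>R\<bar>) x"
    using test_fun_bounds[OF t] by metis
  have N': "\<bar>\<eta> x\<bar> \<le> N" for x using N(1) N(3)[of x] by (cases "norm x \<le> \<bar>R\<bar>") auto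
  note [measurable] = test_fun_integrable(3,4)[OF t]
  define V where "V x = \<eta> x *\<^sub>R Kern_cap e x" for x
  define d where "d x = (indicator (ball 0 e) x * \<eta> x) / (pi * e\<^sup>2) + Kern_cap e x \<bullet> g x" for x
  have lip: "norm (V x - V y) \<le> (N * (1 / (2 * pi * e)) + N * (3 / (2 * pi * e\<^sup>2))) * norm (x - y)" for x y
  proof -
    have "V x - V y = (\<eta> x - \<eta> y) *\<^sub>R Kern_cap e x + \<eta> y *\<^sub>R (Kern_cap e x - Kern_cap e y)"
      by (simp add: V_def algebra_simps)
    also have "norm \<dots> \<le> (N * norm (x - y)) * (1 / (2 * pi * e)) + N * (3 / (2 * pi * e\<^sup>2) * norm (x - y))"
      using N(2)[of x y] N'[of y] norm_Kern_cap_le(2)[OF e, of x] Kern_cap_lipschitz[OF e, of x y] N(1)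
      by (intro order_trans[OF norm_triangle_ineq] add_mono) (auto simp only: norm_scaleR intro!: mult_mono, auto)
    finally show ?thesis by (simp add: algebra_simps)
  qed
  have supp: "V x = 0" if "norm x \<ge> R" for x using t that by (simp add: V_def test_fun_def)
  have der: "AE x in lborel. \<exists>V'. (V has_derivative V') (at x) \<and> tr2 V' = d x"
    using AE_norm_neq[of e]
  proof eventually_elim
    case (elim x)
    then obtain K' where K: "(Kern_cap e has_derivative K') (at x)" "tr2 K' = indicator (ball 0 e) x * (1 / (pi * e\<^sup>2))"
      using Kern_cap_divergence[OF e] by blast
    have "(\<eta> has_derivative (\<lambda>h. g x \<bullet> h)) (at x)" using t by (simp add: test_fun_def)
    from has_derivative_scaleR[OF this K(1)]
    have "(V has_derivative (\<lambda>h. \<eta> x *\<^sub>R K' h + (g x \<bullet> h) *\<^sub>R Kern_cap e x)) (at x)"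
      unfolding V_def .
    moreover have "tr2 (\<lambda>h. \<eta> x *\<^sub>R K' h + (g x \<bullet> h) *\<^sub>R Kern_cap e x) = d x"
      using tr2_scaleR_sum[OF has_derivative_bounded_linear[OF K(1)]] K(2) by (simp add: d_def inner_commute[of "g x" "Kern_cap e x"])
    ultimately show ?case by blast
  qed
  have dm: "d \<in> borel_measurable borel" unfolding d_def by measurable
  have "(\<integral>x. d x \<partial>lborel) = 0"
    by (rule integral_divergence_zero[OF lip supp der dm])
  moreover have i1: "integrable lborel (\<lambda>x. Kern_cap e x \<bullet> g x)"
    by (rule integrable_test_mult[OF t _ norm_Kern_cap_le(2)[OF e]]) measurable
  moreover have i2: "integrable lborel (\<lambda>x. indicator (ball 0 e) x * \<eta> x)"
  proof (rule Bochner_Integration.integrable_bound[OF test_fun_integrable(1)[OF t]])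
    show "(\<lambda>x. indicator (ball 0 e) x * \<eta> x) \<in> borel_measurable lborel" by measurable
  qed (auto simp: indicator_def)
  ultimately show ?thesis
    unfolding d_def by (subst (asm) Bochner_Integration.integral_add) auto
qed

lemma integrable_Kern_grad:
  assumes t: "test_fun R \<eta> g"
  shows "integrable lborel (\<lambda>x. Kern x \<bullet> g x)"
proof -
  obtain N where N: "N > 0" "\<And>x. norm (g x) \<le> N * indicator (cball 0 \<bar>R\<bar>) x"
    using test_fun_bounds[OF t] by metis
  note [measurable] = test_fun_integrable(4)[OF t]
  have "integrable lborel (\<lambda>x. N * (indicator (ball 0 (\<bar>R\<bar> + 1)) x * norm (Kern x)))"
    by (intro integrable_mult_right integrable_Kern_ball) simp
  moreover have "(\<lambda>x. Kern x \<bullet> g x) \<in> borel_measurable lborel" by measurable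
  moreover have "AE x in lborel. norm (Kern x \<bullet> g x) \<le> norm (N * (indicator (ball 0 (\<bar>R\<bar> + 1)) x * norm (Kern x)))"
  proof (rule AE_I2)
    fix x
    have "norm (Kern x \<bullet> g x) \<le> norm (Kern x) * (N * indicator (ball 0 (\<bar>R\<bar> + 1)) x)"
    proof -
      have "N * indicator (cball 0 \<bar>R\<bar>) x \<le> N * indicator (ball 0 (\<bar>R\<bar> + 1)) x"
        using N(1) by (intro mult_left_mono) (auto simp: indicator_def)
      then have "norm (g x) \<le> N * indicator (ball 0 (\<bar>R\<bar> + 1)) x" using N(2)[of x] by linarith
      then have "norm (Kern x) * norm (g x) \<le> norm (Kern x) * (N * indicator (ball 0 (\<bar>R\<bar> + 1)) x)"
        by (rule mult_left_mono) simp
      then show ?thesis using Cauchy_Schwarz_ineq2[of "Kern x" "g x"] by simp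
    qed
    then show "norm (Kern x \<bullet> g x) \<le> norm (N * (indicator (ball 0 (\<bar>R\<bar> + 1)) x * norm (Kern x)))"
      using N(1) by (simp add: abs_mult mult_ac)
  qed
  ultimately show ?thesis by (rule Bochner_Integration.integrable_bound)
qed

text \<open>In the sense of distributions the divergence of the kernel is the Dirac mass at 0; this
  is the limit of the capped identity as the radius shrinks.\<close>

lemma integral_Kern_grad:
  assumes t: "test_fun R \<eta> g"
  shows "(\<integral>x. Kern x \<bullet> g x \<partial>lborel) = - \<eta> 0"
proof -
  obtain N where N: "N > 0" "\<And>x. norm (g x) \<le> N * indicator (cball 0 \<bar>R\<bar>) x" "\<And>x y. \<bar>\<eta> x - \<eta> y\<bar> \<le> N * norm (x - y)"
    using test_fun_bounds[OF t] by metis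
  have N': "norm (g x) \<le> N" for x using N(1) N(2)[of x] by (cases "norm x \<le> \<bar>R\<bar>") auto
  note [measurable] = test_fun_integrable(3,4)[OF t]
  have "\<bar>(\<integral>x. Kern x \<bullet> g x \<partial>lborel) + \<eta> 0\<bar> \<le> 0 + e" if "e > 0" for e
  proof -
    \<comment> \<open>Two errors of size \<open>N * r\<close> must add up to \<open>e\<close>: one
      from capping the kernel, one from replacing the mean of \<open>\<eta>\<close> over the ball by
      \<open>\<eta> 0\<close>.\<close>
    define r where "r = e / (2 * N)"
    have r: "r > 0" using that N(1) by (simp add: r_def)
    have ib: "integrable lborel (\<lambda>x::pt. indicator (ball 0 r) x :: real)"
      by simp
    have cap: "integrable lborel (\<lambda>x. Kern_cap r x \<bullet> g x)"
      by (rule integrable_test_mult[OF t _ norm_Kern_cap_le(2)[OF r]]) measurable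
    have "\<bar>(\<integral>x. Kern x \<bullet> g x \<partial>lborel) - (\<integral>x. Kern_cap r x \<bullet> g x \<partial>lborel)\<bar>
        = norm (\<integral>x. (Kern x - Kern_cap r x) \<bullet> g x \<partial>lborel)"
      using cap integrable_Kern_grad[OF t] by (simp add: inner_diff_left)
    also have "\<dots> \<le> (\<integral>x. N * (indicator (ball 0 r) x * norm (Kern x)) \<partial>lborel)"
    proof (rule Bochner_Integration.integral_norm_bound_integral)
      show "integrable lborel (\<lambda>x. (Kern x - Kern_cap r x) \<bullet> g x)"
        using cap integrable_Kern_grad[OF t] by (simp add: inner_diff_left)
      show "integrable lborel (\<lambda>x. N * (indicator (ball 0 r) x * norm (Kern x)))"
        by (intro integrable_mult_right integrable_Kern_ball r)
      fix x
      have "norm ((Kern x - Kern_cap r x) \<bullet> g x) \<le> norm (Kern x - Kern_cap r x) * norm (g x)"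
        using Cauchy_Schwarz_ineq2 by simp
      also have "\<dots> \<le> (indicator (ball 0 r) x * norm (Kern x)) * N"
        using norm_Kern_minus_cap[OF r] N' by (intro mult_mono) auto
      finally show "norm ((Kern x - Kern_cap r x) \<bullet> g x) \<le> N * (indicator (ball 0 r) x * norm (Kern x))"
        by (simp add: mult_ac)
    qed
    also have "\<dots> \<le> N * r" using integrable_Kern_ball(2)[OF r] N(1) by simp
    finally have 1: "\<bar>(\<integral>x. Kern x \<bullet> g x \<partial>lborel) - (\<integral>x. Kern_cap r x \<bullet> g x \<partial>lborel)\<bar> \<le> N * r" .
    have i2: "integrable lborel (\<lambda>x. indicator (ball 0 r) x * \<eta> x)"
    proof (rule Bochner_Integration.integrable_bound[OF test_fun_integrable(1)[OF t]])
      show "(\<lambda>x. indicator (ball 0 r) x * \<eta> x) \<in> borel_measurable lborel" by measurable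
    qed (auto simp: indicator_def)
    have "\<bar>(\<integral>x. indicator (ball 0 r) x * \<eta> x \<partial>lborel) - \<eta> 0 * (pi * r\<^sup>2)\<bar>
        = norm (\<integral>x. indicator (ball 0 r) x * (\<eta> x - \<eta> 0) \<partial>lborel)"
    proof -
      have "integrable lborel (\<lambda>x. indicator (ball (0::pt) r) x * \<eta> 0)" using ib by (intro integrable_mult_left)
      then have "(\<integral>x. indicator (ball 0 r) x * (\<eta> x - \<eta> 0) \<partial>lborel)
          = (\<integral>x. indicator (ball 0 r) x * \<eta> x \<partial>lborel) - (\<integral>x. indicator (ball (0::pt) r) x * \<eta> 0 \<partial>lborel)"
        using i2 by (subst Bochner_Integration.integral_diff[symmetric]) (auto simp: right_diff_distrib)
      then show ?thesis using r by (simp add: measure_ball_2 mult.commute[of "\<eta> 0"])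
    qed
    also have "\<dots> \<le> (\<integral>x. (N * r) * indicator (ball (0::pt) r) x \<partial>lborel)"
    proof (rule Bochner_Integration.integral_norm_bound_integral)
      show "integrable lborel (\<lambda>x. indicator (ball 0 r) x * (\<eta> x - \<eta> 0))"
        using i2 ib by (simp add: right_diff_distrib)
      show "integrable lborel (\<lambda>x::pt. (N * r) * indicator (ball 0 r) x)"
        using ib by (intro integrable_mult_right)
      fix x :: pt
      show "norm (indicator (ball 0 r) x * (\<eta> x - \<eta> 0)) \<le> N * r * indicator (ball 0 r) x"
      proof (cases "norm x < r")
        case True
        then have "\<bar>\<eta> x - \<eta> 0\<bar> \<le> N * r"
          using N(1) N(3)[of x 0] by (intro order_trans[OF N(3)] mult_left_mono) auto
        then show ?thesis using True by simp
      qed simp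
    qed
    also have "\<dots> = N * r * (pi * r\<^sup>2)" using r by (simp add: measure_ball_2)
    finally have "\<bar>((\<integral>x. indicator (ball 0 r) x * \<eta> x \<partial>lborel) - \<eta> 0 * (pi * r\<^sup>2)) / (pi * r\<^sup>2)\<bar> \<le> N * r"
      using r by (simp add: abs_divide divide_simps)
    moreover have "((\<integral>x. indicator (ball 0 r) x * \<eta> x \<partial>lborel) - \<eta> 0 * (pi * r\<^sup>2)) / (pi * r\<^sup>2)
       = - (\<integral>x. Kern_cap r x \<bullet> g x \<partial>lborel) - \<eta> 0"
      unfolding integral_Kern_cap_grad[OF t r] using r by (simp add: field_simps)
    ultimately have "\<bar>- (\<integral>x. Kern_cap r x \<bullet> g x \<partial>lborel) - \<eta> 0\<bar> \<le> N * r" by (simp only:)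
    then have "\<bar>(\<integral>x. Kern_cap r x \<bullet> g x \<partial>lborel) + \<eta> 0\<bar> \<le> N * r" by linarith
    with 1 have "\<bar>(\<integral>x. Kern x \<bullet> g x \<partial>lborel) + \<eta> 0\<bar> \<le> 2 * (N * r)" by linarith
    also have "\<dots> = e" using N(1) by (simp add: r_def)
    finally show ?thesis by simp
  qed
  then have "\<bar>(\<integral>x. Kern x \<bullet> g x \<partial>lborel) + \<eta> 0\<bar> \<le> 0" by (rule field_le_epsilon)
  then show ?thesis by simp
qed

lemma test_fun_translate:
  assumes t: "test_fun R \<eta> g"
  shows "test_fun (\<bar>R\<bar> + norm y) (\<lambda>x. \<eta> (y + x)) (\<lambda>x. g (y + x))"
  unfolding test_fun_def
proof (intro conjI allI impI)
  fix x
  have "(\<eta> has_derivative (\<lambda>h. g (y + x) \<bullet> h)) (at (y + x))" using t by (simp add: test_fun_def)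
  moreover have "((\<lambda>x. y + x) has_derivative (\<lambda>h. h)) (at x)" by (auto intro!: derivative_eq_intros)
  ultimately show "((\<lambda>x. \<eta> (y + x)) has_derivative (\<lambda>h. g (y + x) \<bullet> h)) (at x)"
    using has_derivative_compose[of "\<lambda>x. y + x" "\<lambda>h. h" x UNIV \<eta> "\<lambda>h. g (y + x) \<bullet> h"] by simp
  assume "\<bar>R\<bar> + norm y \<le> norm x"
  then have "R \<le> norm (y + x)" using norm_diff_ineq[of x y] by (simp add: add.commute)
  then show "\<eta> (y + x) = 0" using t by (simp add: test_fun_def)
next
  show "continuous_on UNIV (\<lambda>x. g (y + x))"
    using t by (auto simp: test_fun_def intro!: continuous_intros continuous_on_compose2[of UNIV g])
qed

text \<open>The weak form of \<open>div (Kconv f) = f\<close>.\<close>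
lemma integral_Kconv_grad:
  assumes t: "test_fun R \<eta> g" and f: "integrable lborel f" and N: "\<And>x. \<bar>f x\<bar> \<le> N"
  shows "(\<integral>x. Kconv f x \<bullet> g x \<partial>lborel) = - (\<integral>x. f x * \<eta> x \<partial>lborel)"
proof -
  have [measurable]: "f \<in> borel_measurable borel" using f by auto
  note [measurable] = test_fun_integrable(3,4)[OF t]
  define F where "F x y = f y * (Kern (x - y) \<bullet> g x)" for x y
  \<comment> \<open>The near/far splitting at radius 1 bounds the inner integral uniformly in
    \<open>x\<close>; together with the integrability of \<open>norm (g x)\<close> this gives the
    absolute integrability that Fubini requires.\<close>
  define C where "C = N + (\<integral>y. \<bar>f y\<bar> \<partial>lborel) / (2 * pi)"
  have C: "(\<integral>y. \<bar>f y\<bar> * norm (Kern (x - y)) \<partial>lborel) \<le> C" for x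
    using integral_Kconv_norm[OF f N zero_less_one, of x] by (simp add: C_def)
  have Fm [measurable]: "(\<lambda>(x, y). F x y) \<in> borel_measurable (lborel \<Otimes>\<^sub>M lborel)"
    unfolding F_def by measurable
  have Fxi: "integrable lborel (\<lambda>y. F x y)" for x
  proof -
    have "integrable lborel (\<lambda>y. (f y *\<^sub>R Kern (x - y)) \<bullet> g x)"
      by (intro integrable_inner_left integrable_Kconv[OF f N zero_less_one])
    then show ?thesis by (simp add: F_def)
  qed
  have Fn: "integrable lborel (\<lambda>x. \<integral>y. norm (F x y) \<partial>lborel)"
  proof (rule Bochner_Integration.integrable_bound)
    show "integrable lborel (\<lambda>x. C * norm (g x))"
      by (intro integrable_mult_right test_fun_integrable[OF t])
    show "(\<lambda>x. \<integral>y. norm (F x y) \<partial>lborel) \<in> borel_measurable lborel" by measurable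
    show "AE x in lborel. norm (\<integral>y. norm (F x y) \<partial>lborel) \<le> norm (C * norm (g x))"
    proof (rule AE_I2)
      fix x
      have "(\<integral>y. norm (F x y) \<partial>lborel) \<le> (\<integral>y. (\<bar>f y\<bar> * norm (Kern (x - y))) * norm (g x) \<partial>lborel)"
      proof (rule integral_mono)
        show "integrable lborel (\<lambda>y. \<bar>f y\<bar> * norm (Kern (x - y)) * norm (g x))"
          by (intro integrable_mult_left integrable_Kconv_norm[OF f N zero_less_one])
        fix y show "norm (F x y) \<le> \<bar>f y\<bar> * norm (Kern (x - y)) * norm (g x)"
          using Cauchy_Schwarz_ineq2[of "Kern (x - y)" "g x"]
          by (auto simp: F_def abs_mult mult.assoc intro: mult_left_mono)
      qed (use Fxi in \<open>auto intro: integrable_norm\<close>)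
      also have "\<dots> \<le> C * norm (g x)"
        using C[of x] by (auto intro: mult_right_mono)
      finally show "norm (\<integral>y. norm (F x y) \<partial>lborel) \<le> norm (C * norm (g x))" by simp
    qed
  qed
  have Fi: "integrable (lborel \<Otimes>\<^sub>M lborel) (\<lambda>(x, y). F x y)"
    by (rule lborel_pair.Fubini_integrable) (use Fm Fn Fxi in auto)
  have "(\<integral>x. Kconv f x \<bullet> g x \<partial>lborel) = (\<integral>x. (\<integral>y. F x y \<partial>lborel) \<partial>lborel)"
  proof (rule Bochner_Integration.integral_cong[OF refl])
    fix x
    show "Kconv f x \<bullet> g x = (\<integral>y. F x y \<partial>lborel)"
      unfolding Kconv_def
      by (subst integral_inner_left[symmetric]) (auto intro: integrable_Kconv[OF f N zero_less_one] simp: F_def[abs_def])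
  qed
  also have "\<dots> = (\<integral>y. (\<integral>x. F x y \<partial>lborel) \<partial>lborel)"
    by (rule lborel_pair.Fubini_integral[symmetric, OF Fi])
  also have "\<dots> = (\<integral>y. f y * - \<eta> y \<partial>lborel)"
  proof (rule Bochner_Integration.integral_cong[OF refl])
    fix y
    have "(\<integral>x. Kern (x - y) \<bullet> g x \<partial>lborel) = (\<integral>x. Kern (y + x - y) \<bullet> g (y + x) \<partial>lborel)"
      by (rule integral_lborel_translate[symmetric]) measurable
    also have "\<dots> = - \<eta> (y + 0)"
      using integral_Kern_grad[OF test_fun_translate[OF t, of y]] by simp
    finally show "(\<integral>x. F x y \<partial>lborel) = f y * - \<eta> y" by (simp add: F_def)
  qed
  finally show ?thesis by simp
qed

subsection \<open>The divergence of the flux\<close>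

lemma DERIV_max_0_power:
  "((\<lambda>s::real. (max 0 s) ^ (n + 2)) has_real_derivative real (n + 2) * (max 0 s) ^ (n + 1)) (at s)"
proof -
  consider "s > 0" | "s < 0" | "s = 0" by linarith
  then show ?thesis
  proof cases
    case 1
    have "((\<lambda>s::real. s ^ (n + 2)) has_real_derivative real (n + 2) * s ^ (n + 1)) (at s)"
      using DERIV_pow[of "n + 2" s] by simp
    then have "((\<lambda>s::real. (max 0 s) ^ (n + 2)) has_real_derivative real (n + 2) * s ^ (n + 1)) (at s)"
      by (rule has_field_derivative_transform_within_open[of _ _ _ "{0<..}"]) (use 1 in auto)
    then show ?thesis using 1 by simp
  next
    case 2
    have "((\<lambda>s::real. 0) has_real_derivative 0) (at s)" by simp
    then have "((\<lambda>s::real. (max 0 s) ^ (n + 2)) has_real_derivative 0) (at s)"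
      by (rule has_field_derivative_transform_within_open[of _ _ _ "{..<0}"]) (use 2 in auto)
    then show ?thesis using 2 by simp
  next
    case 3
    have e: "(max 0 h) ^ (n + 2) / h = (max 0 h) ^ (n + 1)" if "h \<noteq> 0" for h :: real
      using that by (auto simp: max_def)
    have "((\<lambda>h::real. (max 0 h) ^ (n + 1)) \<longlongrightarrow> (max 0 0) ^ (n + 1)) (at 0)"
      by (intro tendsto_intros)
    then have "((\<lambda>h::real. (max 0 h) ^ (n + 2) / h) \<longlongrightarrow> 0) (at 0)"
      by (subst tendsto_cong[where g = "\<lambda>h. (max 0 h) ^ (n + 1)"]) (use e in \<open>auto simp: eventually_at_filter\<close>)
    then show ?thesis unfolding 3 DERIV_def by simp
  qed
qed

definition bump_arg :: "real \<Rightarrow> pt \<Rightarrow> pt \<Rightarrow> real" where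
  "bump_arg R a x = max 0 (1 - (x - a) \<bullet> (x - a) / R\<^sup>2)"

text \<open>The cube is the least integer power of the truncated paraboloid that is twice
  continuously differentiable. A polynomial profile keeps gradient, Hessian and their constants
  explicit.\<close>

definition bump :: "real \<Rightarrow> pt \<Rightarrow> pt \<Rightarrow> real" where
  "bump R a x = bump_arg R a x ^ 3"

definition bump_grad :: "real \<Rightarrow> pt \<Rightarrow> pt \<Rightarrow> pt" where
  "bump_grad R a x = (- (6 / R\<^sup>2) * bump_arg R a x ^ 2) *\<^sub>R (x - a)"

definition bump_hess :: "real \<Rightarrow> pt \<Rightarrow> pt \<Rightarrow> pt \<Rightarrow> pt" where
  "bump_hess R a x h = (- (6 / R\<^sup>2) * bump_arg R a x ^ 2) *\<^sub>R h + ((24 / R ^ 4 * bump_arg R a x) * ((x - a) \<bullet> h)) *\<^sub>R (x - a)"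

lemma continuous_bump_arg: "continuous_on S (bump_arg R a)"
  unfolding bump_arg_def divide_inverse by (intro continuous_intros)

lemma bump_arg_bounds: "0 \<le> bump_arg R a x" "bump_arg R a x \<le> 1"
  by (auto simp: bump_arg_def)

lemma bump_arg_zero:
  assumes "R > 0" "norm (x - a) \<ge> R" shows "bump_arg R a x = 0"
proof -
  have "R\<^sup>2 \<le> (x - a) \<bullet> (x - a)"
    using assms power_mono[of R "norm (x - a)" 2] by (simp add: power2_norm_eq_inner)
  then show ?thesis using assms by (simp add: bump_arg_def divide_simps)
qed

lemma bump_arg_power_derivative:
  "((\<lambda>x. bump_arg R a x ^ (n + 2)) has_derivative
      (\<lambda>h. real (n + 2) * bump_arg R a x ^ (n + 1) * (- (2 / R\<^sup>2) * ((x - a) \<bullet> h)))) (at x)"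
proof -
  have "((\<lambda>x. 1 - (x - a) \<bullet> (x - a) / R\<^sup>2) has_derivative (\<lambda>h. - (2 / R\<^sup>2) * ((x - a) \<bullet> h))) (at x)"
    unfolding divide_inverse by (auto intro!: derivative_eq_intros simp: inner_commute algebra_simps)
  from has_derivative_compose[OF this DERIV_max_0_power[of n, unfolded has_field_derivative_def]]
  show ?thesis by (simp add: bump_arg_def)
qed

lemma bump_derivative: "(bump R a has_derivative (\<lambda>h. bump_grad R a x \<bullet> h)) (at x)"
  using bump_arg_power_derivative[of R a 1 x]
  by (simp add: bump_def[abs_def] bump_grad_def numeral_eq_Suc mult_ac)

lemma bump_grad_derivative: "(bump_grad R a has_derivative bump_hess R a x) (at x)"
proof -
  have s: "((\<lambda>x. bump_arg R a x ^ 2) has_derivative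
      (\<lambda>h. 2 * bump_arg R a x * (- (2 / R\<^sup>2) * ((x - a) \<bullet> h)))) (at x)"
    using bump_arg_power_derivative[of R a 0 x] by (simp add: numeral_2_eq_2)
  show ?thesis
    unfolding bump_grad_def[abs_def]
    by (rule derivative_eq_intros s | rule refl)+
       (auto simp: bump_hess_def fun_eq_iff power2_eq_square power4_eq_xxxx field_simps)
qed

lemma bump_zero: "R > 0 \<Longrightarrow> norm (x - a) \<ge> R \<Longrightarrow> bump R a x = 0"
  by (simp add: bump_def bump_arg_zero)

lemma bump_bounds: "0 \<le> bump R a x" "bump R a x \<le> 1"
  using bump_arg_bounds[of R a x] by (auto simp: bump_def power_le_one)

lemma test_fun_bump:
  assumes "R > 0" shows "test_fun (norm a + R) (bump R a) (bump_grad R a)"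
  unfolding test_fun_def
proof (intro conjI allI impI bump_derivative)
  show "continuous_on UNIV (bump_grad R a)"
    unfolding bump_grad_def by (intro continuous_intros continuous_bump_arg)
  show "bump R a x = 0" if "norm a + R \<le> norm x" for x
    using that norm_triangle_ineq2[of x a] assms by (intro bump_zero) auto
qed

text \<open>The first bound is scale invariant and absorbs the factor \<open>norm (x - a)\<close> of
  a first-order remainder as \<open>R\<close> tends to 0; the second decays as \<open>R\<close>
  tends to infinity and serves the conservation of mass.\<close>

lemma norm_bump_grad:
  assumes R: "R > 0"
  shows "norm (x - a) * norm (bump_grad R a x) \<le> 6 * indicator (ball a R) x"
    and "norm (bump_grad R a x) \<le> 6 / R"
proof -
  have *: "norm (bump_grad R a x) \<le> 6 / R\<^sup>2 * norm (x - a)"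
    using bump_arg_bounds[of R a x] R
    by (simp add: bump_grad_def abs_mult power_le_one mult_left_le_one_le divide_right_mono mult_right_le_one_le)
  have z: "bump_grad R a x = 0" if "norm (x - a) \<ge> R"
    using bump_arg_zero[OF R that] by (simp add: bump_grad_def)
  show "norm (x - a) * norm (bump_grad R a x) \<le> 6 * indicator (ball a R) x"
  proof (cases "norm (x - a) < R")
    case True
    have "norm (x - a) * norm (bump_grad R a x) \<le> R * (6 / R\<^sup>2 * R)"
      using True R by (intro mult_mono order_trans[OF *]) auto
    then show ?thesis using True R by (simp add: power2_eq_square dist_norm norm_minus_commute)
  qed (use z in auto)
  show "norm (bump_grad R a x) \<le> 6 / R"
  proof (cases "norm (x - a) < R")
    case True
    have "norm (bump_grad R a x) \<le> 6 / R\<^sup>2 * R"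
      using True R by (intro order_trans[OF *] mult_left_mono) auto
    then show ?thesis using R by (simp add: power2_eq_square)
  qed (use z R in auto)
qed

text \<open>The multiple of the identity contributes at most \<open>12 / R^2\<close>, the rank-one
  part at most \<open>24 / R^2\<close>.\<close>

lemma tr2_bump_hess_bound:
  assumes R: "R > 0"
  shows "\<bar>tr2 (bump_hess R a x)\<bar> \<le> 36 / R\<^sup>2"
proof -
  let ?b = "bump_arg R a x" and ?y = "x - a"
  have tr: "tr2 (bump_hess R a x) = - (12 / R\<^sup>2) * ?b\<^sup>2 + 24 / R ^ 4 * ?b * (?y \<bullet> ?y)"
    using tr2_scaleR_rank_one[of "- (6 / R\<^sup>2) * ?b ^ 2" "24 / R ^ 4 * ?b" ?y]
    unfolding bump_hess_def[abs_def] by simp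
  show ?thesis
  proof (cases "norm ?y < R")
    case True
    then have y: "?y \<bullet> ?y \<le> R\<^sup>2" using power_mono[of "norm ?y" R 2] by (simp add: power2_norm_eq_inner)
    have b: "0 \<le> ?b" "?b \<le> 1" "?b\<^sup>2 \<le> 1" using bump_arg_bounds[of R a x] by (auto simp: power_le_one)
    have "24 / R ^ 4 * ?b * (?y \<bullet> ?y) \<le> 24 / R ^ 4 * 1 * R\<^sup>2"
      using b y R by (intro mult_mono) auto
    also have "\<dots> = 24 / R\<^sup>2" using R by (simp add: power2_eq_square power4_eq_xxxx)
    finally have u: "24 / R ^ 4 * ?b * (?y \<bullet> ?y) \<le> 24 / R\<^sup>2" .
    have l: "0 \<le> 24 / R ^ 4 * ?b * (?y \<bullet> ?y)" using b by simp
    have m: "12 / R\<^sup>2 * ?b\<^sup>2 \<le> 12 / R\<^sup>2 * 1" "0 \<le> 12 / R\<^sup>2 * ?b\<^sup>2" using b by (auto intro!: mult_left_mono divide_right_mono)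
    have "24 / R\<^sup>2 \<le> 36 / R\<^sup>2" "12 / R\<^sup>2 \<le> 36 / R\<^sup>2" by (auto intro!: divide_right_mono)
    then show ?thesis unfolding tr using u l m by (intro abs_leI) linarith+
  next
    case False
    then show ?thesis unfolding tr using bump_arg_zero[OF R, of x a] by simp
  qed
qed

text \<open>On the half ball the truncated paraboloid is at least 3/4, so the bump is at least 27/64
  on a quarter of the area. The lower bound permits dividing by the mass of the bump.\<close>

lemma integral_bump_bounds:
  assumes R: "R > 0"
  shows "integrable lborel (bump R a)"
    and "(\<integral>x. bump R a x \<partial>lborel) \<le> pi * R\<^sup>2"
    and "27 / 256 * (pi * R\<^sup>2) \<le> (\<integral>x. bump R a x \<partial>lborel)"
proof -
  show i: "integrable lborel (bump R a)" by (rule test_fun_integrable(1)[OF test_fun_bump[OF R]])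
  have ib: "integrable lborel (\<lambda>x::pt. indicator (ball a r) x :: real)" for r
    by simp
  have "(\<integral>x. bump R a x \<partial>lborel) \<le> (\<integral>x. indicator (ball a R) x \<partial>lborel)"
    by (intro integral_mono i ib)
       (use bump_bounds[of R a] bump_zero[OF R] in \<open>auto simp: indicator_def dist_norm norm_minus_commute not_less\<close>)
  then show "(\<integral>x. bump R a x \<partial>lborel) \<le> pi * R\<^sup>2" using R by (simp add: measure_ball_2)
  have "(\<integral>x. 27 / 64 * indicator (ball a (R/2)) x \<partial>lborel) \<le> (\<integral>x. bump R a x \<partial>lborel)"
  proof (intro integral_mono i integrable_mult_right ib)
    fix x
    show "27 / 64 * indicator (ball a (R/2)) x \<le> bump R a x"
    proof (cases "norm (x - a) < R / 2")
      case True
      then have "(x - a) \<bullet> (x - a) \<le> (R/2)\<^sup>2" using power_mono[of "norm (x - a)" "R/2" 2] by (simp add: power2_norm_eq_inner)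
      then have "(x - a) \<bullet> (x - a) / R\<^sup>2 \<le> 1/4" using R by (simp add: divide_simps power2_eq_square)
      then have "3/4 \<le> bump_arg R a x" unfolding bump_arg_def by (intro max.coboundedI2) linarith
      then have "(3/4) ^ 3 \<le> bump R a x" unfolding bump_def by (intro power_mono) auto
      then show ?thesis using True by (simp add: indicator_def power3_eq_cube dist_norm norm_minus_commute)
    next
      case False
      then show ?thesis using bump_bounds(1)[of R a x] by (simp add: dist_norm norm_minus_commute)
    qed
  qed
  then show "27 / 256 * (pi * R\<^sup>2) \<le> (\<integral>x. bump R a x \<partial>lborel)" using R by (simp add: measure_ball_2 power2_eq_square)
qed

lemma integrable_continuous_support:
  fixes f :: "pt \<Rightarrow> real"
  assumes c: "continuous_on UNIV f" and s: "\<And>x. norm x > R \<Longrightarrow> f x = 0"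
  shows "integrable lborel f"
proof -
  have "bounded (f ` cball 0 R)"
    by (intro compact_imp_bounded compact_continuous_image continuous_on_subset[OF c]) auto
  then obtain B where B: "B > 0" "\<forall>v\<in>f ` cball 0 R. norm v \<le> B" unfolding bounded_pos by blast
  have i: "integrable lborel (\<lambda>x::pt. B * indicator (cball 0 R) x)"
    by simp
  show ?thesis
  proof (rule Bochner_Integration.integrable_bound[OF i])
    show "f \<in> borel_measurable lborel" using borel_measurable_continuous_onI[OF c] by simp
    show "AE x in lborel. norm (f x) \<le> norm (B * indicator (cball 0 R) x)"
    proof (rule AE_I2)
      fix x show "norm (f x) \<le> norm (B * indicator (cball 0 R) x)"
        using B s[of x] by (cases "norm x \<le> R") auto
    qed
  qed
qed

text \<open>Testing the weak divergence of \<open>Kconv f\<close> against the product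
  \<open>f * \<eta>\<close> and expanding its gradient gives the weak form of
  \<open>div (f u) = f^2 + u \<bullet> \<nabla>f\<close>, with \<open>u = Kconv f\<close>.\<close>

lemma Kconv_weak_product:
  assumes f: "integrable lborel f" and N: "\<And>x. \<bar>f x\<bar> \<le> N"
    and G: "\<And>x. (f has_derivative (\<lambda>h. G x \<bullet> h)) (at x)" "continuous_on UNIV G"
    and t: "test_fun R \<eta> g"
  shows "(\<integral>x. f x * (Kconv f x \<bullet> g x) \<partial>lborel) = - (\<integral>x. \<eta> x * ((f x)\<^sup>2 + Kconv f x \<bullet> G x) \<partial>lborel)"
proof -
  have fc: "continuous_on UNIV f" using G(1) by (auto intro: continuous_at_imp_continuous_on has_derivative_continuous)
  note ec = test_fun_continuous(1)[OF t] and gc = test_fun_continuous(2)[OF t] and ez = test_fun_zero[OF t less_imp_le]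
  note uc = continuous_Kconv[OF f N]
  have gz: "\<And>x. norm x > R \<Longrightarrow> g x = 0" using test_fun_grad_zero[OF t] by simp
  have t': "test_fun R (\<lambda>x. f x * \<eta> x) (\<lambda>x. \<eta> x *\<^sub>R G x + f x *\<^sub>R g x)"
    unfolding test_fun_def
  proof (intro conjI allI impI)
    fix x
    have "(\<eta> has_derivative (\<lambda>h. g x \<bullet> h)) (at x)" using t by (simp add: test_fun_def)
    from has_derivative_mult[OF G(1) this]
    show "((\<lambda>x. f x * \<eta> x) has_derivative (\<lambda>h. (\<eta> x *\<^sub>R G x + f x *\<^sub>R g x) \<bullet> h)) (at x)"
      by (simp add: inner_add_left algebra_simps)
    show "f x * \<eta> x = 0" if "R \<le> norm x" using t that by (simp add: test_fun_def)
  qed (intro continuous_intros fc ec gc G(2))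
  have i1: "integrable lborel (\<lambda>x. f x * (Kconv f x \<bullet> g x))"
    by (rule integrable_continuous_support[of _ R]) (intro continuous_intros fc uc gc, simp add: gz)
  have i2: "integrable lborel (\<lambda>x. \<eta> x * (Kconv f x \<bullet> G x))"
    by (rule integrable_continuous_support[of _ R]) (intro continuous_intros ec uc G(2), simp add: ez)
  have i3: "integrable lborel (\<lambda>x. \<eta> x * (f x)\<^sup>2)"
    by (rule integrable_continuous_support[of _ R]) (intro continuous_intros ec fc, simp add: ez)
  have "(\<integral>x. Kconv f x \<bullet> (\<eta> x *\<^sub>R G x + f x *\<^sub>R g x) \<partial>lborel) = - (\<integral>x. f x * (f x * \<eta> x) \<partial>lborel)"
    by (rule integral_Kconv_grad[OF t' f N])
  also have "(\<lambda>x. f x * (f x * \<eta> x)) = (\<lambda>x. \<eta> x * (f x)\<^sup>2)" by (simp add: power2_eq_square mult_ac)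
  also have "(\<integral>x. Kconv f x \<bullet> (\<eta> x *\<^sub>R G x + f x *\<^sub>R g x) \<partial>lborel)
     = (\<integral>x. \<eta> x * (Kconv f x \<bullet> G x) \<partial>lborel) + (\<integral>x. f x * (Kconv f x \<bullet> g x) \<partial>lborel)"
    using i1 i2 by (simp add: inner_add_right)
  finally have "(\<integral>x. f x * (Kconv f x \<bullet> g x) \<partial>lborel) = - ((\<integral>x. \<eta> x * (f x)\<^sup>2 \<partial>lborel) + (\<integral>x. \<eta> x * (Kconv f x \<bullet> G x) \<partial>lborel))"
    by simp
  then show ?thesis using i2 i3 by (simp add: distrib_left)
qed

text \<open>The flux field is only differentiable at the point, so its divergence is read off by
  testing the weak identity against bumps shrinking to that point.\<close>
lemma divergence_flux:
  assumes f: "integrable lborel f" and N: "\<And>x. \<bar>f x\<bar> \<le> N"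
    and G: "\<And>x. (f has_derivative (\<lambda>h. G x \<bullet> h)) (at x)" "continuous_on UNIV G"
    and D: "((\<lambda>y. f y *\<^sub>R Kconv f y) has_derivative D) (at a)"
  shows "tr2 D = (f a)\<^sup>2 + Kconv f a \<bullet> G a"
proof -
  define u where "u = Kconv f"
  define F where "F y = f y *\<^sub>R u y" for y
  define w where "w y = (f y)\<^sup>2 + u y \<bullet> G y" for y
  have fc: "continuous_on UNIV f" using G(1) by (auto intro: continuous_at_imp_continuous_on has_derivative_continuous)
  have uc: "continuous_on UNIV u" unfolding u_def by (rule continuous_Kconv[OF f N])
  have Fc: "continuous_on UNIV F" unfolding F_def by (intro continuous_intros fc uc)
  have wc: "continuous_on UNIV w" unfolding w_def by (intro continuous_intros fc uc G(2))
  interpret D: bounded_linear D using D by (rule has_derivative_bounded_linear)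
  have Dc: "continuous_on UNIV D" by (rule linear_continuous_on[OF D.bounded_linear_axioms])
  have Dc': "continuous_on UNIV (\<lambda>x. D (x - a))"
    by (rule continuous_on_compose2[OF Dc]) (auto intro!: continuous_intros)
  have "\<bar>tr2 D - w a\<bar> \<le> 0 + e" if e: "e > 0" for e
  proof -
    \<comment> \<open>The errors below sum to \<open>7 * d\<close> against a bump mass of at least
      27/256 of the same area, and \<open>7 * 256 / 27 < 70\<close>.\<close>
    define d where "d = e / 70"
    have d: "d > 0" using e by (simp add: d_def)
    obtain r1 where r1: "r1 > 0" "\<And>x. norm (x - a) < r1 \<Longrightarrow> norm (F x - F a - D (x - a)) \<le> d * norm (x - a)"
      using D d unfolding has_derivative_at_alt F_def u_def by blast
    obtain r2 where r2: "r2 > 0" "\<And>x. dist x a < r2 \<Longrightarrow> dist (w x) (w a) < d"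
      using wc d unfolding continuous_on_iff by (metis UNIV_I)
    define r where "r = min r1 r2"
    have r: "r > 0" using r1(1) r2(1) by (simp add: r_def)
    define k where "k = bump_grad r a"
    define c where "c = bump r a"
    have t: "test_fun (norm a + r) c k" unfolding c_def k_def by (rule test_fun_bump[OF r])
    note cc = test_fun_continuous(1)[OF t] and kc = test_fun_continuous(2)[OF t] and cz = test_fun_zero[OF t less_imp_le]
    have kz: "\<And>x. norm x > norm a + r \<Longrightarrow> k x = 0" using test_fun_grad_zero[OF t] by simp
    have 1: "(\<integral>x. F x \<bullet> k x \<partial>lborel) = - (\<integral>x. c x * w x \<partial>lborel)"
      using Kconv_weak_product[OF f N G t] by (simp add: F_def w_def u_def)
    \<comment> \<open>The affine part of the flux is smooth, so the divergence theorem treats it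
      exactly and produces \<open>tr2 D\<close> times the mass of the bump; only the first-order
      remainder has to be estimated.\<close>
    define V where "V x = c x *\<^sub>R (F a + D (x - a))" for x
    define V' where "V' x h = c x *\<^sub>R D h + (k x \<bullet> h) *\<^sub>R (F a + D (x - a))" for x h
    have V: "(V has_derivative V' x) (at x)" for x
    proof -
      have "(c has_derivative (\<lambda>h. k x \<bullet> h)) (at x)" using t by (simp add: test_fun_def)
      moreover have "((\<lambda>x. F a + D (x - a)) has_derivative (\<lambda>h. D h)) (at x)"
        by (auto intro!: derivative_eq_intros D.has_derivative)
      ultimately show ?thesis
        unfolding V_def[abs_def] V'_def[abs_def] by (rule has_derivative_scaleR)
    qed
    have V'c: "continuous_on UNIV (\<lambda>x. V' x (axis j 1) $ i)" for i j
      unfolding V'_def by (intro continuous_intros cc kc Dc')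
    have "(\<integral>x. tr2 (V' x) \<partial>lborel) = 0"
      by (rule integral_divergence_zero_C1[OF V V'c, of "norm a + r"]) (use t in \<open>auto simp: V_def test_fun_def\<close>)
    moreover have "tr2 (V' x) = c x * tr2 D + k x \<bullet> (F a + D (x - a))" for x
      unfolding V'_def by (rule tr2_scaleR_sum[OF D.bounded_linear_axioms])
    moreover have ic: "integrable lborel c"
      by (rule integrable_continuous_support[OF cc cz])
    moreover have i1: "integrable lborel (\<lambda>x. k x \<bullet> (F a + D (x - a)))"
      by (rule integrable_continuous_support[of _ "norm a + r"]) (intro continuous_intros kc Dc', simp add: kz)
    ultimately have 2: "(\<integral>x. k x \<bullet> (F a + D (x - a)) \<partial>lborel) = - (tr2 D * (\<integral>x. c x \<partial>lborel))"
      by (simp add: mult.commute[of "tr2 D"])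
    have i2: "integrable lborel (\<lambda>x. F x \<bullet> k x)"
      by (rule integrable_continuous_support[of _ "norm a + r"]) (intro continuous_intros kc Fc, simp add: kz)
    have i3: "integrable lborel (\<lambda>x. c x * w x)"
      by (rule integrable_continuous_support[of _ "norm a + r"]) (intro continuous_intros cc wc, simp add: cz)
    have i4: "integrable lborel (\<lambda>x. c x * (w x - w a))"
      by (rule integrable_continuous_support[of _ "norm a + r"]) (intro continuous_intros cc wc, simp add: cz)
    have i5: "integrable lborel (\<lambda>x. (F x - F a - D (x - a)) \<bullet> k x)"
      by (rule integrable_continuous_support[of _ "norm a + r"]) (intro continuous_intros kc Fc Dc', simp add: kz)
    have ib: "integrable lborel (\<lambda>x::pt. indicator (ball a r) x :: real)"
      by simp
    let ?I = "\<integral>x. c x \<partial>lborel"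
    have I: "?I \<le> pi * r\<^sup>2" "27 / 256 * (pi * r\<^sup>2) \<le> ?I"
      unfolding c_def using integral_bump_bounds[OF r] by auto
    have "\<bar>\<integral>x. (F x - F a - D (x - a)) \<bullet> k x \<partial>lborel\<bar> \<le> (\<integral>x. (6 * d) * indicator (ball a r) x \<partial>lborel)"
      unfolding real_norm_def[symmetric]
    proof (rule Bochner_Integration.integral_norm_bound_integral[OF i5])
      show "integrable lborel (\<lambda>x. (6 * d) * indicator (ball a r) x)" using ib by (intro integrable_mult_right)
      fix x
      show "norm ((F x - F a - D (x - a)) \<bullet> k x) \<le> (6 * d) * indicator (ball a r) x"
      proof (cases "norm (x - a) < r")
        case True
        have "norm ((F x - F a - D (x - a)) \<bullet> k x) \<le> norm (F x - F a - D (x - a)) * norm (k x)"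
          using Cauchy_Schwarz_ineq2 by simp
        also have "\<dots> \<le> (d * norm (x - a)) * norm (k x)"
          using True r1(2)[of x] by (intro mult_right_mono) (auto simp: r_def)
        also have "\<dots> \<le> d * (6 * indicator (ball a r) x)"
          using norm_bump_grad(1)[OF r, of x a] d unfolding k_def mult.assoc by (intro mult_left_mono) auto
        finally show ?thesis by simp
      next
        case False
        then have "k x = 0" using bump_arg_zero[OF r, of x a] by (simp add: k_def bump_grad_def)
        then show ?thesis using d by simp
      qed
    qed
    then have A: "\<bar>\<integral>x. (F x - F a - D (x - a)) \<bullet> k x \<partial>lborel\<bar> \<le> 6 * d * (pi * r\<^sup>2)"
      using r by (simp add: measure_ball_2)
    have B: "\<bar>\<integral>x. c x * (w x - w a) \<partial>lborel\<bar> \<le> (\<integral>x. d * c x \<partial>lborel)"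
      unfolding real_norm_def[symmetric]
    proof (rule Bochner_Integration.integral_norm_bound_integral[OF i4])
      show "integrable lborel (\<lambda>x. d * c x)" using ic by simp
      fix x
      have c0: "0 \<le> c x" by (simp add: c_def bump_bounds)
      show "norm (c x * (w x - w a)) \<le> d * c x"
      proof (cases "norm (x - a) < r")
        case True
        then have "\<bar>w x - w a\<bar> \<le> d" using r2(2)[of x] by (simp add: r_def dist_norm)
        then have "c x * \<bar>w x - w a\<bar> \<le> c x * d" using c0 by (rule mult_left_mono)
        then show ?thesis using c0 by (simp add: abs_mult mult.commute[of d])
      next
        case False
        then have "c x = 0" using bump_zero[OF r, of x a] by (simp add: c_def)
        then show ?thesis by simp
      qed
    qed
    have C: "(\<integral>x. (F x - F a - D (x - a)) \<bullet> k x \<partial>lborel) = (\<integral>x. F x \<bullet> k x \<partial>lborel) - (\<integral>x. k x \<bullet> (F a + D (x - a)) \<partial>lborel)"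
    proof -
      have "(\<lambda>x. (F x - F a - D (x - a)) \<bullet> k x) = (\<lambda>x. F x \<bullet> k x - k x \<bullet> (F a + D (x - a)))"
        by (auto simp: inner_diff_left inner_add_left inner_commute[of "k _"])
      then show ?thesis using i1 i2 by simp
    qed
    have E: "(\<integral>x. c x * (w x - w a) \<partial>lborel) = (\<integral>x. c x * w x \<partial>lborel) - w a * ?I"
      using i3 ic by (simp add: right_diff_distrib mult.commute)
    have "\<bar>(tr2 D - w a) * ?I\<bar> \<le> 6 * d * (pi * r\<^sup>2) + d * ?I"
      using A B ic unfolding C E 1 2 by (simp add: left_diff_distrib)
    also have "\<dots> \<le> 7 * d * (pi * r\<^sup>2)"
      using I(1) d mult_left_mono[of ?I "pi * r\<^sup>2" d] by simp
    finally have "\<bar>(tr2 D - w a) * ?I\<bar> \<le> 7 * d * (pi * r\<^sup>2)" .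
    moreover have "?I \<ge> 0" using order_trans[OF _ I(2), of 0] by simp
    ultimately have "\<bar>tr2 D - w a\<bar> * ?I \<le> 7 * d * (pi * r\<^sup>2)"
      by (simp add: abs_mult)
    moreover have "\<bar>tr2 D - w a\<bar> * (27 / 256 * (pi * r\<^sup>2)) \<le> \<bar>tr2 D - w a\<bar> * ?I"
      using I(2) by (intro mult_left_mono) auto
    ultimately have "\<bar>tr2 D - w a\<bar> * (27 / 256 * (pi * r\<^sup>2)) \<le> 7 * d * (pi * r\<^sup>2)" by (rule order_trans[rotated])
    then have "(\<bar>tr2 D - w a\<bar> * (27 / 256)) * (pi * r\<^sup>2) \<le> (7 * d) * (pi * r\<^sup>2)" by (simp only: mult.assoc)
    then have "\<bar>tr2 D - w a\<bar> * (27 / 256) \<le> 7 * d" using r by (simp add: mult_le_cancel_right)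
    then show ?thesis using d by (simp add: d_def)
  qed
  then have "\<bar>tr2 D - w a\<bar> \<le> 0" by (rule field_le_epsilon)
  then show ?thesis by (simp add: w_def u_def)
qed

subsection \<open>Maximum principle\<close>

text \<open>The set where \<open>P \<ge> 0\<close> is compact thanks to the sign condition at
  infinity, so its time coordinate attains a minimum; continuity in time gives
  \<open>P \<le> 0\<close> at that time. The space is general because the two-point argument applies
  this to pairs of points.\<close>

lemma first_contact:
  fixes P :: "real \<Rightarrow> 'a::euclidean_space \<Rightarrow> real"
  assumes c: "continuous_on ({0..T} \<times> UNIV) (\<lambda>(t, x). P t x)"
    and init: "\<And>x. P 0 x < 0"
    and inf: "\<And>t x. t \<in> {0..T} \<Longrightarrow> norm x > R \<Longrightarrow> P t x < 0"
    and bad: "t1 \<in> {0..T}" "P t1 x1 \<ge> 0"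
  obtains t0 x0 where "t0 \<in> {0<..T}" "P t0 x0 = 0" "\<And>x. P t0 x \<le> 0" "\<And>t. t \<in> {0..<t0} \<Longrightarrow> P t x0 < 0"
proof -
  define S where "S = {p \<in> {0..T} \<times> cball 0 R. (case p of (t, x) \<Rightarrow> P t x) \<in> {0..}}"
  have cS: "continuous_on ({0..T} \<times> cball 0 R) (\<lambda>(t, x). P t x)"
    by (rule continuous_on_subset[OF c]) auto
  have "closed S"
    unfolding S_def by (rule continuous_closed_preimage[OF cS, unfolded vimage_def Int_def, simplified])
       (auto intro: closed_Times)
  moreover have "bounded S"
    by (rule bounded_subset[of "{0..T} \<times> cball 0 R"]) (auto simp: S_def bounded_Times)
  ultimately have "compact S" by (simp add: compact_eq_bounded_closed)
  moreover have "(t1, x1) \<in> S" using bad inf[OF bad(1), of x1] by (force simp: S_def)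
  ultimately obtain p where p: "p \<in> S" "\<And>q. q \<in> S \<Longrightarrow> fst p \<le> fst q"
    using continuous_attains_inf[of S fst] continuous_on_fst[OF continuous_on_id] by (metis empty_iff)
  obtain t0 x0 where p0: "p = (t0, x0)" by (cases p)
  have t0: "0 \<le> t0" "t0 \<le> T" "P t0 x0 \<ge> 0" using p(1) by (auto simp: S_def p0)
  then have t0': "t0 > 0" using init[of x0] by (cases "t0 = 0") auto
  have before: "P t x < 0" if "t \<in> {0..<t0}" for t x
  proof (rule ccontr)
    assume n: "\<not> P t x < 0"
    have "t \<in> {0..T}" using that t0 by auto
    then have "(t, x) \<in> S" using n inf[of t x] by (force simp: S_def)
    then show False using p(2)[of "(t, x)"] that by (auto simp: p0)
  qed
  have le: "P t0 x \<le> 0" for x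
  proof (rule ccontr)
    assume n: "\<not> P t0 x \<le> 0"
    have "continuous_on {0..T} (\<lambda>t. (\<lambda>(t, x). P t x) (t, x))"
      by (rule continuous_on_compose2[OF c]) (auto intro!: continuous_on_Pair continuous_on_id continuous_on_const)
    then have "continuous_on {0..T} (\<lambda>t. P t x)" by simp
    then obtain d where d: "d > 0" "\<And>t. t \<in> {0..T} \<Longrightarrow> dist t t0 < d \<Longrightarrow> dist (P t x) (P t0 x) < P t0 x"
      using n t0 unfolding continuous_on_iff by (metis atLeastAtMost_iff not_le)
    define t where "t = max 0 (t0 - d / 2)"
    have "t \<in> {0..<t0}" "dist t t0 < d" using d(1) t0' by (auto simp: t_def dist_real_def)
    then show False using before[of t x] d(2)[of t] t0 by (auto simp: dist_real_def)
  qed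
  show ?thesis
    by (rule that[of t0 x0]) (use t0 t0' le before in \<open>auto intro: antisym\<close>)
qed

lemma DERIV_nonneg_left:
  fixes p :: "real \<Rightarrow> real"
  assumes d: "(p has_real_derivative d) (at t0)" and t0: "t0 > 0" and le: "\<And>t. t \<in> {0..<t0} \<Longrightarrow> p t \<le> p t0"
  shows "d \<ge> 0"
proof (rule ccontr)
  assume "\<not> d \<ge> 0"
  then obtain e where e: "e > 0" "\<And>h. h > 0 \<Longrightarrow> h < e \<Longrightarrow> p t0 < p (t0 - h)"
    using DERIV_neg_dec_left[OF d] by auto
  define h where "h = min (e / 2) t0"
  have "h > 0" "h < e" "t0 - h \<in> {0..<t0}" using e(1) t0 by (auto simp: h_def)
  then show False using e(2)[of h] le[of "t0 - h"] by auto
qed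

text \<open>If \<open>k2\<close> were positive, \<open>k1\<close> would be positive just to the
  right of 0 and the mean value theorem would lift \<open>k\<close> above its maximum. Asking
  \<open>k1\<close> to be differentiable only at 0 matches a Hessian given point by point.\<close>

lemma second_derivative_test:
  fixes k :: "real \<Rightarrow> real"
  assumes r: "r > 0"
    and k: "\<And>s. \<bar>s\<bar> < r \<Longrightarrow> (k has_real_derivative k1 s) (at s)"
    and k1: "(k1 has_real_derivative k2) (at 0)"
    and max: "\<And>s. \<bar>s\<bar> < r \<Longrightarrow> k s \<le> k 0"
  shows "k1 0 = 0" "k2 \<le> 0"
proof -
  show z: "k1 0 = 0"
    by (rule DERIV_local_max[OF k r]) (use r max in auto)
  show "k2 \<le> 0"
  proof (rule ccontr)
    assume "\<not> k2 \<le> 0"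
    then obtain e where e: "e > 0" "\<And>h. h > 0 \<Longrightarrow> h < e \<Longrightarrow> k1 0 < k1 (0 + h)"
      using DERIV_pos_inc_right[OF k1] by auto
    define h where "h = min (e / 2) (r / 2)"
    have h: "h > 0" "h < e" "h < r" using e(1) r by (auto simp: h_def)
    have "\<exists>z. 0 < z \<and> z < h \<and> k h - k 0 = (h - 0) * k1 z"
      by (rule MVT2[OF h(1)]) (use h in \<open>auto intro!: k\<close>)
    then obtain z where "0 < z" "z < h" "k h - k 0 = h * k1 z" by auto
    moreover from this have "k1 z > 0" using e(2)[of z] z h by auto
    ultimately have "k h > k 0" using h(1) by (simp add: algebra_simps)
    then show False using max[of h] h by auto
  qed
qed

lemma has_real_derivative_along_line:
  fixes f :: "'a::real_inner \<Rightarrow> real"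
  assumes "(f has_derivative (\<lambda>h. g \<bullet> h)) (at (x + s *\<^sub>R v))"
  shows "((\<lambda>s. f (x + s *\<^sub>R v)) has_real_derivative g \<bullet> v) (at s)"
  using has_derivative_along_line[OF assms] by (simp add: has_field_derivative_def mult_commute_abs)

lemma has_real_derivative_grad_along_line:
  fixes G :: "'a::real_inner \<Rightarrow> 'a"
  assumes "(G has_derivative H) (at (x + s *\<^sub>R v))"
  shows "((\<lambda>s. G (x + s *\<^sub>R v) \<bullet> w) has_real_derivative H v \<bullet> w) (at s)"
  using has_derivative_inner_left[OF has_derivative_along_line[OF assms], of w]
  by (simp add: has_field_derivative_def mult_commute_abs)

text \<open>The drift enters only through a bound \<open>U\<close> on its size, so the predicate is
  indifferent to its direction. The gradient is required everywhere because the derivative tests run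
  along whole lines through \<open>x\<close>; the Hessian is required at \<open>x\<close>
  alone.\<close>

definition subsolution_at :: "real \<Rightarrow> real \<Rightarrow> real \<Rightarrow> (real \<Rightarrow> pt \<Rightarrow> real) \<Rightarrow> real \<Rightarrow> pt \<Rightarrow> bool" where
  "subsolution_at \<nu> U M z t x \<longleftrightarrow> (\<exists>zt G H.
     ((\<lambda>s. z s x) has_real_derivative zt) (at t) \<and>
     (\<forall>y. (z t has_derivative (\<lambda>h. G y \<bullet> h)) (at y)) \<and> (G has_derivative H) (at x) \<and>
     zt \<le> \<nu> * tr2 H + U * norm (G x) + M * z t x)"

text \<open>The growing quadratic penalty does two things: since \<open>z\<close> is bounded above
  it confines a first contact to a compact set, and it is a strict supersolution, so that no contact
  can occur. It is removed by letting its size tend to 0.\<close>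

lemma parabolic_max_principle:
  fixes z :: "real \<Rightarrow> pt \<Rightarrow> real"
  assumes c: "continuous_on ({0..T} \<times> UNIV) (\<lambda>(t, x). z t x)"
    and bd: "\<And>t x. t \<in> {0..T} \<Longrightarrow> z t x \<le> B"
    and init: "\<And>x. z 0 x \<le> 0"
    and nonneg: "\<nu> \<ge> 0" "U \<ge> 0" "M \<ge> 0"
    and sub: "\<And>t x. t \<in> {0<..T} \<Longrightarrow> z t x > 0 \<Longrightarrow> subsolution_at \<nu> U M z t x"
    and t: "t \<in> {0..T}"
  shows "z t x \<le> 0"
proof (rule field_le_epsilon)
  fix \<epsilon> :: real assume "\<epsilon> > 0"
  define q where "q = (\<lambda>x::pt. 1 + x \<bullet> x)"
  have q1: "q y \<ge> 1" for y by (simp add: q_def)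
  \<comment> \<open>The terms pay for the Laplacian of the penalty (\<open>4 \<le> 4 * q\<close>),
    its gradient (\<open>2 * norm x \<le> q\<close>) and the zero-order term; the extra 1 makes the
    inequality strict.\<close>
  define L where "L = 4 * \<nu> + U + M + 1"
  \<comment> \<open>With this size the penalty at the target point \<open>(t, x)\<close> is exactly
    \<open>\<epsilon>\<close>.\<close>
  define e where "e = \<epsilon> / (exp (L * t) * q x)"
  have e: "e > 0" using \<open>\<epsilon> > 0\<close> q1[of x] by (simp add: e_def)
  define P where "P = (\<lambda>t x. z t x - e * exp (L * t) * q x)"
  have "P t x < 0"
  proof (rule ccontr)
    assume n: "\<not> P t x < 0"
    define R where "R = \<bar>B\<bar> / e + 1"
    have L0: "L \<ge> 1" using nonneg by (simp add: L_def)
    have Pc: "continuous_on ({0..T} \<times> UNIV) (\<lambda>(t, x). P t x)"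
      unfolding P_def q_def case_prod_beta
      using c unfolding case_prod_beta by (intro continuous_intros)
    have P0: "P 0 y < 0" for y
    proof -
      have "e * q y > 0" using e q1[of y] by (intro mult_pos_pos) auto
      then show ?thesis using init[of y] by (simp add: P_def)
    qed
    have Pinf: "P s y < 0" if s: "s \<in> {0..T}" and y: "norm y > R" for s y
    proof -
      have R1: "R \<ge> 1" using e by (simp add: R_def)
      have "norm y * 1 \<le> norm y * norm y" using y R1 by (intro mult_left_mono) auto
      then have "R < q y" using y by (simp add: q_def power2_norm_eq_inner[symmetric] power2_eq_square)
      then have "\<bar>B\<bar> < e * q y" using e by (simp add: R_def field_simps)
      moreover have "e * 1 * q y \<le> e * exp (L * s) * q y"
        using e q1[of y] s L0 by (intro mult_right_mono mult_left_mono) auto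
      ultimately show ?thesis using bd[OF s, of y] by (simp add: P_def)
    qed
    obtain t0 x0 where t0: "t0 \<in> {0<..T}" "P t0 x0 = 0" "\<And>x. P t0 x \<le> 0" "\<And>t. t \<in> {0..<t0} \<Longrightarrow> P t x0 < 0"
      using first_contact[OF Pc P0 Pinf t n[unfolded not_less]] by metis
    define e' where "e' = e * exp (L * t0)"
    have e': "e' > 0" using e by (simp add: e'_def)
    have zz: "z t0 x0 = e' * q x0" using t0(2) by (simp add: P_def e'_def)
    then have "z t0 x0 > 0" using e' q1[of x0] by simp
    from sub[OF t0(1) this] obtain zt G H where
      zt: "((\<lambda>s. z s x0) has_real_derivative zt) (at t0)" and
      G: "\<And>y. (z t0 has_derivative (\<lambda>h. G y \<bullet> h)) (at y)" and H: "(G has_derivative H) (at x0)" and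
      ineq: "zt \<le> \<nu> * tr2 H + U * norm (G x0) + M * z t0 x0" unfolding subsolution_at_def by blast
    have "((\<lambda>s. P s x0) has_real_derivative (zt - L * e' * q x0)) (at t0)"
      unfolding P_def e'_def by (auto intro!: derivative_eq_intros zt)
    then have time: "0 \<le> zt - L * e' * q x0"
      by (rule DERIV_nonneg_left) (use t0 in \<open>auto simp: less_imp_le\<close>)
    have dir: "G x0 \<bullet> v - 2 * e' * (x0 \<bullet> v) = 0 \<and> H v \<bullet> v - 2 * e' * (v \<bullet> v) \<le> 0" for v
    proof -
      define k where "k s = P t0 (x0 + s *\<^sub>R v)" for s
      define k1 where "k1 s = G (x0 + s *\<^sub>R v) \<bullet> v - 2 * e' * ((x0 + s *\<^sub>R v) \<bullet> v)" for s
      have k: "(k has_real_derivative k1 s) (at s)" for s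
      proof -
        have "(q has_derivative (\<lambda>h. (2 *\<^sub>R y) \<bullet> h)) (at y)" for y
          unfolding q_def by (auto intro!: derivative_eq_intros simp: inner_commute)
        from has_real_derivative_along_line[OF this] has_real_derivative_along_line[OF G]
        show ?thesis unfolding k_def[abs_def] k1_def P_def e'_def[symmetric]
          by (auto intro!: derivative_eq_intros)
      qed
      have k1: "(k1 has_real_derivative H v \<bullet> v - 2 * e' * (v \<bullet> v)) (at 0)"
      proof -
        have "((\<lambda>s. G (x0 + s *\<^sub>R v) \<bullet> v) has_real_derivative H v \<bullet> v) (at 0)"
          by (rule has_real_derivative_grad_along_line) (use H in simp)
        then show ?thesis unfolding k1_def[abs_def]
          by (auto intro!: derivative_eq_intros simp: inner_add_left)
      qed
      have km: "k s \<le> k 0" for s using t0(2,3) by (simp add: k_def)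
      show ?thesis
        using second_derivative_test[OF zero_less_one k k1 km] by (simp add: k1_def)
    qed
    have "G x0 = (2 * e') *\<^sub>R x0"
    proof -
      have "(G x0 - (2 * e') *\<^sub>R x0) \<bullet> (G x0 - (2 * e') *\<^sub>R x0) = 0"
        using dir[of "G x0 - (2 * e') *\<^sub>R x0"] by (simp add: inner_diff_left)
      then show ?thesis by simp
    qed
    then have "norm (G x0) = e' * (2 * norm x0)" using e' by simp
    also have "\<dots> \<le> e' * q x0"
    proof (rule mult_left_mono)
      have "0 \<le> (norm x0 - 1)\<^sup>2" by simp
      then show "2 * norm x0 \<le> q x0" by (simp add: q_def power2_norm_eq_inner[symmetric] power2_diff)
    qed (use e' in simp)
    finally have drift: "U * norm (G x0) \<le> U * (e' * q x0)" using nonneg by (intro mult_left_mono) auto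
    have diffusion: "\<nu> * tr2 H \<le> \<nu> * (4 * e' * q x0)"
    proof (rule mult_left_mono)
      have "tr2 H \<le> 4 * e'"
        using dir[of "axis 1 1"] dir[of "axis 2 1"] by (simp add: tr2_eq inner_axis)
      also have "\<dots> \<le> 4 * e' * q x0" using e' q1[of x0] by simp
      finally show "tr2 H \<le> 4 * e' * q x0" .
    qed (use nonneg in simp)
    have "e' * q x0 > 0" using e' q1[of x0] by (intro mult_pos_pos) auto
    then show False using time drift diffusion ineq unfolding zz L_def by (simp add: algebra_simps)
  qed
  then have "z t x < e * exp (L * t) * q x" by (simp add: P_def)
  also have "\<dots> = \<epsilon>" using q1[of x] by (simp add: e_def)
  finally show "z t x \<le> 0 + \<epsilon>" by simp
qed

subsection \<open>A priori bounds\<close>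

lemma tr2_diff: "tr2 (\<lambda>h. A h - B h) = tr2 A - tr2 B"
  by (simp add: tr2_def sum_subtractf)

lemma tr2_uminus: "tr2 (\<lambda>h. - B h) = - tr2 B"
  by (simp add: tr2_def sum_negf)

lemma bump_tendsto_1: "(\<lambda>n. bump (real (Suc n)) 0 x) \<longlonglongrightarrow> 1"
proof -
  have "(\<lambda>n. (x \<bullet> x) * (1 / real (Suc n)) ^ 2) \<longlonglongrightarrow> (x \<bullet> x) * 0 ^ 2"
    by (intro tendsto_intros LIMSEQ_Suc lim_1_over_n)
  then have "(\<lambda>n. (max 0 (1 - (x \<bullet> x) * (1 / real (Suc n)) ^ 2)) ^ 3) \<longlonglongrightarrow> (max 0 (1 - (x \<bullet> x) * 0 ^ 2)) ^ 3"
    by (intro tendsto_power[of _ _ _ 3] tendsto_max tendsto_diff tendsto_const)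
  then show ?thesis by (simp add: bump_def bump_arg_def power_divide)
qed

lemma integral_lborel_eq_integral_cbox:
  fixes f :: "pt \<Rightarrow> real"
  assumes i: "integrable lborel f" and z: "\<And>x. x \<notin> cbox a b \<Longrightarrow> f x = 0"
  shows "(\<integral>x. f x \<partial>lborel) = integral (cbox a b) f"
proof -
  have "integral (cbox a b) f = integral UNIV (\<lambda>x. if x \<in> cbox a b then f x else 0)"
    by (simp add: integral_restrict_UNIV)
  also have "(\<lambda>x. if x \<in> cbox a b then f x else 0) = f" using z by auto
  finally show ?thesis using integral_lborel[OF i] by simp
qed

lemma gaussian_gradient:
  "((\<lambda>x::pt. exp (- (c + k * (x \<bullet> x)))) has_derivative (\<lambda>h. ((- 2 * k * exp (- (c + k * (x \<bullet> x)))) *\<^sub>R x) \<bullet> h)) (at x)"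
  by (auto intro!: derivative_eq_intros simp: inner_commute algebra_simps)

lemma gaussian_hessian:
  "((\<lambda>x::pt. (- 2 * k * exp (- (c + k * (x \<bullet> x)))) *\<^sub>R x) has_derivative
    (\<lambda>h. (- 2 * k * exp (- (c + k * (x \<bullet> x)))) *\<^sub>R h + ((4 * k\<^sup>2 * exp (- (c + k * (x \<bullet> x)))) * (x \<bullet> h)) *\<^sub>R x)) (at x)"
  by (auto intro!: derivative_eq_intros ext simp: inner_commute power2_eq_square algebra_simps)

text \<open>Fixes the witnesses hidden in the existential of \<open>is_solution\<close>, with
  \<open>\<nu>\<close> for \<open>1 / \<beta>\<close>. Properties of the initial datum are assumed
  lemma by lemma.\<close>

locale limit_solution =
  fixes \<nu> :: real and \<rho> :: "real \<Rightarrow> pt \<Rightarrow> real" and \<rho>t :: "real \<Rightarrow> pt \<Rightarrow> real" and G :: "real \<Rightarrow> pt \<Rightarrow> pt"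
    and H DF :: "real \<Rightarrow> pt \<Rightarrow> pt \<Rightarrow> pt"
  assumes nu: "\<nu> > 0"
    and rho_cont: "continuous_on ({0..} \<times> UNIV) (\<lambda>(t, x). \<rho> t x)"
    and rho_int: "\<And>t. t \<ge> 0 \<Longrightarrow> integrable lborel (\<rho> t)"
    and rho_L1: "\<And>s. s \<ge> 0 \<Longrightarrow> ((\<lambda>t. \<integral>x. \<bar>\<rho> t x - \<rho> s x\<bar> \<partial>lborel) \<longlongrightarrow> 0) (at s within {0..})"
    and rho_bdd: "\<And>T. \<exists>M. \<forall>t\<in>{0..T}. \<forall>x. \<bar>\<rho> t x\<bar> \<le> M"
    and grad: "\<And>t x. t \<ge> 0 \<Longrightarrow> (\<rho> t has_derivative (\<lambda>h. G t x \<bullet> h)) (at x)"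
    and G_cont: "continuous_on ({0..} \<times> UNIV) (\<lambda>(t, x). G t x)"
    and time: "\<And>t x. t > 0 \<Longrightarrow> ((\<lambda>s. \<rho> s x) has_real_derivative \<rho>t t x) (at t)"
    and time_cont: "continuous_on ({0<..} \<times> UNIV) (\<lambda>(t, x). \<rho>t t x)"
    and hess: "\<And>t x. t > 0 \<Longrightarrow> (G t has_derivative H t x) (at x)"
    and hess_cont: "\<And>i j. continuous_on ({0<..} \<times> UNIV) (\<lambda>(t, x). H t x (axis j 1) $ i)"
    and flux: "\<And>t x. t > 0 \<Longrightarrow> ((\<lambda>y. \<rho> t y *\<^sub>R Kconv (\<rho> t) y) has_derivative DF t x) (at x)"
    and pde: "\<And>t x. t > 0 \<Longrightarrow> \<rho>t t x + tr2 (DF t x) = \<nu> * tr2 (H t x)"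
begin

definition u :: "real \<Rightarrow> pt \<Rightarrow> pt" where "u t = Kconv (\<rho> t)"

lemma slice: "continuous_on (S \<times> UNIV) (\<lambda>(t, x). f t x) \<Longrightarrow> t \<in> S \<Longrightarrow> continuous_on UNIV (f t)"
  for f :: "real \<Rightarrow> pt \<Rightarrow> 'b::topological_space"
proof -
  assume c: "continuous_on (S \<times> UNIV) (\<lambda>(t, x). f t x)" and t: "t \<in> S"
  have "continuous_on UNIV (\<lambda>x. (\<lambda>(t, x). f t x) (t, x))"
    by (rule continuous_on_compose2[OF c]) (use t in \<open>auto intro!: continuous_on_Pair continuous_on_id continuous_on_const\<close>)
  then show ?thesis by simp
qed

lemma rho_slice: "t \<ge> 0 \<Longrightarrow> continuous_on UNIV (\<rho> t)"
  and G_slice: "t \<ge> 0 \<Longrightarrow> continuous_on UNIV (G t)"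
  and time_slice: "t > 0 \<Longrightarrow> continuous_on UNIV (\<rho>t t)"
  and hess_slice: "t > 0 \<Longrightarrow> continuous_on UNIV (\<lambda>x. H t x (axis j 1) $ i)"
  using slice[OF rho_cont, of t] slice[OF G_cont, of t] slice[OF time_cont, of t] slice[OF hess_cont, of t j i] by auto

lemma rho_bound: obtains M where "\<And>t x. t \<in> {0..T} \<Longrightarrow> \<bar>\<rho> t x\<bar> \<le> M" "M \<ge> 0"
proof -
  obtain M where "\<forall>t\<in>{0..T}. \<forall>x. \<bar>\<rho> t x\<bar> \<le> M" using rho_bdd by blast
  then show ?thesis by (intro that[of "max M 0"]) (fastforce intro: max.coboundedI1)+
qed

lemma rho_bound_at: assumes "t \<ge> 0" obtains M where "\<And>x. \<bar>\<rho> t x\<bar> \<le> M"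
  using rho_bound[of t] assms by (metis atLeastAtMost_iff order_refl)

lemma u_slice: assumes "t \<ge> 0" shows "continuous_on UNIV (u t)"
  unfolding u_def using rho_bound_at[OF assms] continuous_Kconv[OF rho_int[OF assms]] by metis

text \<open>Expanding the flux by \<open>divergence_flux\<close> gives the form to which maximum
  principles apply; the absorption \<open>- \<rho>^2\<close> that drives all decay becomes visible
  here.\<close>

lemma equation:
  assumes t: "t > 0"
  shows "\<rho>t t x = \<nu> * tr2 (H t x) - u t x \<bullet> G t x - (\<rho> t x)\<^sup>2"
proof -
  obtain M where M: "\<And>x. \<bar>\<rho> t x\<bar> \<le> M" using rho_bound_at[of t] t by auto
  have "tr2 (DF t x) = (\<rho> t x)\<^sup>2 + u t x \<bullet> G t x"
    unfolding u_def
    by (rule divergence_flux[OF rho_int M grad G_slice flux]) (use t in auto)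
  then show ?thesis using pde[OF t, of x] by simp
qed

section \<open>Local integral bounds and conservation of mass\<close>

lemma L1_bound: obtains A where "\<And>t. t \<in> {0..T} \<Longrightarrow> (\<integral>x. \<bar>\<rho> t x\<bar> \<partial>lborel) \<le> A" "A \<ge> 0"
proof -
  define n where "n t = (\<integral>x. \<bar>\<rho> t x\<bar> \<partial>lborel)" for t
  have "continuous_on {0..} n"
    unfolding continuous_on_def
  proof (intro ballI)
    fix s :: real assume s: "s \<in> {0..}"
    have "\<bar>n t - n s\<bar> \<le> (\<integral>x. \<bar>\<rho> t x - \<rho> s x\<bar> \<partial>lborel)" if t: "t \<ge> 0" for t
    proof -
      have "n t - n s = (\<integral>x. \<bar>\<rho> t x\<bar> - \<bar>\<rho> s x\<bar> \<partial>lborel)"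
        unfolding n_def using rho_int s t by simp
      also have "\<bar>\<dots>\<bar> \<le> (\<integral>x. \<bar>\<rho> t x - \<rho> s x\<bar> \<partial>lborel)"
        unfolding real_norm_def[symmetric]
        using rho_int s t by (intro Bochner_Integration.integral_norm_bound_integral) auto
      finally show ?thesis .
    qed
    then have "\<forall>\<^sub>F t in at s within {0..}. norm (n t - n s) \<le> (\<integral>x. \<bar>\<rho> t x - \<rho> s x\<bar> \<partial>lborel)"
      by (auto simp: eventually_at_filter)
    from Lim_null_comparison[OF this rho_L1] show "(n \<longlongrightarrow> n s) (at s within {0..})"
      using s LIM_zero_cancel by auto
  qed
  then have "continuous_on {0..T} n" by (rule continuous_on_subset) auto
  then have "bounded (n ` {0..T})" by (intro compact_imp_bounded compact_continuous_image) auto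
  then obtain A where A: "A > 0" "\<forall>v\<in>n ` {0..T}. norm v \<le> A" unfolding bounded_pos by blast
  show ?thesis using that[of A] A by (fastforce simp: n_def)
qed

text \<open>A qualitative bound on a finite time interval, just enough to run the maximum principle;
  the decaying bound \<open>drift_bound\<close> rests on results obtained with it.\<close>

lemma u_bound: obtains U where "\<And>t x. t \<in> {0..T} \<Longrightarrow> norm (u t x) \<le> U" "U \<ge> 0"
proof -
  obtain M where M: "\<And>t x. t \<in> {0..T} \<Longrightarrow> \<bar>\<rho> t x\<bar> \<le> M" "M \<ge> 0" using rho_bound by metis
  obtain A where A: "\<And>t. t \<in> {0..T} \<Longrightarrow> (\<integral>x. \<bar>\<rho> t x\<bar> \<partial>lborel) \<le> A" "A \<ge> 0" using L1_bound by metis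
  have "norm (u t x) \<le> M * 1 + A / (2 * pi * 1)" if t: "t \<in> {0..T}" for t x
    unfolding u_def using t A(1)[OF t]
    by (intro order_trans[OF norm_Kconv_le[OF rho_int M(1), of t 1]] add_left_mono divide_right_mono) auto
  then show ?thesis using that[of "M * 1 + A / (2 * pi * 1)"] M A by auto
qed

text \<open>All derivatives are moved onto the bump, so the right-hand side can be estimated from
  the \<open>L^1\<close> norm of the solution and a bound on the drift, with no decay of its
  gradient at infinity.\<close>

lemma localized_mass_derivative:
  assumes t: "t > 0" and R: "R > 0"
  shows "((\<lambda>t. \<integral>x. \<rho> t x * bump R 0 x \<partial>lborel) has_real_derivative
          \<nu> * (\<integral>x. \<rho> t x * tr2 (bump_hess R 0 x) \<partial>lborel) + (\<integral>x. \<rho> t x * (u t x \<bullet> bump_grad R 0 x) \<partial>lborel)) (at t)"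
proof -
  define c where "c = bump R 0"
  define k where "k = bump_grad R 0"
  define hh where "hh = bump_hess R 0"
  have tf: "test_fun R c k" using test_fun_bump[OF R, of 0] by (simp add: c_def k_def)
  note cc = test_fun_continuous(1)[OF tf] and kc = test_fun_continuous(2)[OF tf] and cz = test_fun_zero[OF tf]
  have kz: "\<And>x. norm x \<ge> R \<Longrightarrow> k x = 0" using bump_arg_zero[OF R, of _ 0] by (simp add: k_def bump_grad_def)
  have hhc: "continuous_on UNIV (\<lambda>x. hh x (axis j 1) $ i)" for i j
    unfolding hh_def bump_hess_def by (intro continuous_intros continuous_bump_arg)
  have t0: "t \<ge> 0" using t by simp
  \<comment> \<open>The support of the bump lies in a compact box, where the Leibniz rule allows
    differentiation under the integral.\<close>
  obtain a b where ab: "cball (0::pt) R \<subseteq> cbox a b" using bounded_subset_cbox_symmetric[OF bounded_cball] by metis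
  have out: "norm x \<ge> R" if "x \<notin> cbox a b" for x
    using subsetD[OF ab, of x] that by (cases "norm x \<le> R") auto
  have ii: "integrable lborel (\<lambda>x. f x * c x)" if "continuous_on UNIV f" for f
    by (rule integrable_continuous_support[of _ R]) (intro continuous_intros cc that, simp add: cz)
  have conv: "(\<integral>x. f x * c x \<partial>lborel) = integral (cbox a b) (\<lambda>x. f x * c x)" if "continuous_on UNIV f" for f
    by (rule integral_lborel_eq_integral_cbox[OF ii[OF that]]) (use out cz in auto)
  have "((\<lambda>s. integral (cbox a b) (\<lambda>x. \<rho> s x * c x)) has_real_derivative integral (cbox a b) (\<lambda>x. \<rho>t t x * c x)) (at t within {0<..})"
  proof (rule leibniz_rule_field_derivative)
    fix s :: real and x assume s: "s \<in> {0<..}"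
    show "((\<lambda>s. \<rho> s x * c x) has_real_derivative \<rho>t s x * c x) (at s within {0<..})"
      using s by (intro DERIV_cmult_right DERIV_subset[OF time]) auto
  next
    fix s :: real assume s: "s \<in> {0<..}"
    have "continuous_on (cbox a b) (\<rho> s)" using rho_slice[of s] s by (auto intro: continuous_on_subset)
    then show "(\<lambda>x. \<rho> s x * c x) integrable_on cbox a b"
      by (intro integrable_continuous continuous_intros continuous_on_subset[OF cc]) auto
  next
    show "continuous_on ({0<..} \<times> cbox a b) (\<lambda>(s, x). \<rho>t s x * c x)"
      using continuous_on_subset[OF time_cont, of "{0<..} \<times> cbox a b"] unfolding case_prod_beta
      by (intro continuous_intros continuous_on_compose2[OF cc]) auto
  qed (use t in auto)
  then have "((\<lambda>s. integral (cbox a b) (\<lambda>x. \<rho> s x * c x)) has_real_derivative (\<integral>x. \<rho>t t x * c x \<partial>lborel)) (at t)"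
    using conv[OF time_slice[OF t]] t by (simp add: at_within_open[of t "{0<..}"])
  then have D: "((\<lambda>s. \<integral>x. \<rho> s x * c x \<partial>lborel) has_real_derivative (\<integral>x. \<rho>t t x * c x \<partial>lborel)) (at t)"
    by (rule has_field_derivative_transform_within_open[of _ _ _ "{0<..}"]) (use t conv[OF rho_slice] in auto)
  obtain M where M: "\<And>x. \<bar>\<rho> t x\<bar> \<le> M" using rho_bound_at[OF t0] by auto
  have trHc: "continuous_on UNIV (\<lambda>x. tr2 (H t x))" unfolding tr2_def by (intro continuous_intros hess_slice t)
  have i1: "integrable lborel (\<lambda>x. c x * tr2 (H t x))"
    by (rule integrable_continuous_support[of _ R]) (intro continuous_intros cc trHc, simp add: cz)
  have i2: "integrable lborel (\<lambda>x. c x * ((\<rho> t x)\<^sup>2 + Kconv (\<rho> t) x \<bullet> G t x))"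
    by (rule integrable_continuous_support[of _ R]) (intro continuous_intros cc rho_slice G_slice t0 u_slice[unfolded u_def], simp add: cz)
  have i3: "integrable lborel (\<lambda>x. k x \<bullet> G t x)"
    by (rule integrable_continuous_support[of _ R]) (intro continuous_intros kc G_slice t0, simp add: kz)
  have trc: "continuous_on UNIV (\<lambda>x. tr2 (hh x))" unfolding tr2_def by (intro continuous_intros hhc)
  have i4: "integrable lborel (\<lambda>x. \<rho> t x * tr2 (hh x))"
    by (rule integrable_continuous_support[of _ R])
       (intro continuous_intros trc rho_slice t0, use bump_arg_zero[OF R, of _ 0] in \<open>simp add: hh_def bump_hess_def tr2_def\<close>)
  have w: "(\<integral>x. \<rho> t x * (u t x \<bullet> k x) \<partial>lborel) = - (\<integral>x. c x * ((\<rho> t x)\<^sup>2 + Kconv (\<rho> t) x \<bullet> G t x) \<partial>lborel)"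
    unfolding u_def by (rule Kconv_weak_product[OF rho_int[OF t0] M grad[OF t0] G_slice[OF t0] tf])
  \<comment> \<open>The divergence theorem for \<open>c *\<^sub>R G\<close> and for
    \<open>\<rho> *\<^sub>R k\<close> combines to Green's identity: both Laplacian integrals equal
    minus the integral of \<open>k \<bullet> G\<close>.\<close>
  have 1: "(\<integral>x. tr2 (\<lambda>h. c x *\<^sub>R H t x h + (k x \<bullet> h) *\<^sub>R G t x) \<partial>lborel) = 0"
  proof (rule integral_divergence_zero_C1[where V = "\<lambda>x. c x *\<^sub>R G t x" and R = R])
    fix x
    have "(c has_derivative (\<lambda>h. k x \<bullet> h)) (at x)" using tf by (simp add: test_fun_def)
    from has_derivative_scaleR[OF this hess[OF t]]
    show "((\<lambda>x. c x *\<^sub>R G t x) has_derivative (\<lambda>h. c x *\<^sub>R H t x h + (k x \<bullet> h) *\<^sub>R G t x)) (at x)" .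
  next
    fix i j :: 2
    show "continuous_on UNIV (\<lambda>x. (c x *\<^sub>R H t x (axis j 1) + (k x \<bullet> axis j 1) *\<^sub>R G t x) $ i)"
      unfolding vector_add_component vector_scaleR_component by (intro continuous_intros cc kc G_slice hess_slice t t0)
  qed (simp add: cz)
  have 2: "(\<integral>x. tr2 (\<lambda>h. \<rho> t x *\<^sub>R hh x h + (G t x \<bullet> h) *\<^sub>R k x) \<partial>lborel) = 0"
  proof (rule integral_divergence_zero_C1[where V = "\<lambda>x. \<rho> t x *\<^sub>R k x" and R = R])
    fix x
    from has_derivative_scaleR[OF grad[OF t0] bump_grad_derivative]
    show "((\<lambda>x. \<rho> t x *\<^sub>R k x) has_derivative (\<lambda>h. \<rho> t x *\<^sub>R hh x h + (G t x \<bullet> h) *\<^sub>R k x)) (at x)"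
      unfolding k_def hh_def .
  next
    fix i j :: 2
    show "continuous_on UNIV (\<lambda>x. (\<rho> t x *\<^sub>R hh x (axis j 1) + (G t x \<bullet> axis j 1) *\<^sub>R k x) $ i)"
      unfolding vector_add_component vector_scaleR_component by (intro continuous_intros kc G_slice rho_slice hhc t t0)
  qed (simp add: kz)
  have b1: "bounded_linear (H t x)" for x using hess[OF t] by (rule has_derivative_bounded_linear)
  have b2: "bounded_linear (hh x)" for x unfolding hh_def using bump_grad_derivative by (rule has_derivative_bounded_linear)
  have "(\<integral>x. c x * tr2 (H t x) \<partial>lborel) = - (\<integral>x. k x \<bullet> G t x \<partial>lborel)"
    using 1 i1 i3 by (simp add: tr2_scaleR_sum[OF b1])
  moreover have "(\<integral>x. \<rho> t x * tr2 (hh x) \<partial>lborel) = - (\<integral>x. k x \<bullet> G t x \<partial>lborel)"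
    using 2[unfolded tr2_scaleR_sum[OF b2]] i4 i3 by (simp add: inner_commute[of "G t _"])
  ultimately have lap: "(\<integral>x. c x * tr2 (H t x) \<partial>lborel) = (\<integral>x. \<rho> t x * tr2 (hh x) \<partial>lborel)" by simp
  have "(\<integral>x. \<rho>t t x * c x \<partial>lborel) = (\<integral>x. \<nu> * (c x * tr2 (H t x)) - c x * ((\<rho> t x)\<^sup>2 + Kconv (\<rho> t) x \<bullet> G t x) \<partial>lborel)"
    by (simp add: equation[OF t] u_def algebra_simps)
  also have "\<dots> = \<nu> * (\<integral>x. c x * tr2 (H t x) \<partial>lborel) - (\<integral>x. c x * ((\<rho> t x)\<^sup>2 + Kconv (\<rho> t) x \<bullet> G t x) \<partial>lborel)"
    using i1 i2 by simp
  finally show ?thesis using D w lap by (simp add: c_def k_def hh_def)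
qed

text \<open>The mass localised to radius \<open>R\<close> changes at a rate of at most order
  \<open>1 / R + 1 / R^2\<close>, uniformly on the time interval, and the limit of large
  \<open>R\<close> is taken at both times. The initial time is left out because the equation holds
  for positive times only.\<close>

lemma mass_conserved_pos:
  assumes s: "0 < s" "s \<le> t"
  shows "(\<integral>x. \<rho> t x \<partial>lborel) = (\<integral>x. \<rho> s x \<partial>lborel)"
proof -
  obtain A where A: "\<And>r. r \<in> {0..t} \<Longrightarrow> (\<integral>x. \<bar>\<rho> r x\<bar> \<partial>lborel) \<le> A" "A \<ge> 0" using L1_bound by metis
  obtain U where U: "\<And>r x. r \<in> {0..t} \<Longrightarrow> norm (u r x) \<le> U" "U \<ge> 0" using u_bound by metis
  define j where "j R r = (\<integral>x. \<rho> r x * bump R 0 x \<partial>lborel)" for R r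
  have jb: "\<bar>j R t - j R s\<bar> \<le> (\<nu> * (36 / R\<^sup>2 * A) + U * (6 / R) * A) * \<bar>t - s\<bar>" if R: "R > 0" for R
  proof -
    define j' where "j' r = \<nu> * (\<integral>x. \<rho> r x * tr2 (bump_hess R 0 x) \<partial>lborel) + (\<integral>x. \<rho> r x * (u r x \<bullet> bump_grad R 0 x) \<partial>lborel)" for r
    have b: "norm (j' r) \<le> \<nu> * (36 / R\<^sup>2 * A) + U * (6 / R) * A" if r: "r \<in> {s..t}" for r
    proof -
      have r0: "r \<ge> 0" "r \<in> {0..t}" "r > 0" using r s by auto
      have gen: "\<bar>\<integral>x. \<rho> r x * w x \<partial>lborel\<bar> \<le> B * A" if w: "\<And>x. \<bar>w x\<bar> \<le> B" and wc: "continuous_on UNIV w" for w B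
      proof -
        have B: "B \<ge> 0" using w[of 0] by linarith
        have le: "\<bar>\<rho> r x * w x\<bar> \<le> B * \<bar>\<rho> r x\<bar>" for x
          using mult_left_mono[OF w, of "\<bar>\<rho> r x\<bar>" x] by (simp add: abs_mult mult.commute)
        have i: "integrable lborel (\<lambda>x. B * \<bar>\<rho> r x\<bar>)" using rho_int[OF r0(1)] by simp
        have m: "(\<lambda>x. \<rho> r x * w x) \<in> borel_measurable lborel"
          using borel_measurable_continuous_onI[OF wc] borel_measurable_integrable[OF rho_int[OF r0(1)]] by auto
        have i': "integrable lborel (\<lambda>x. \<rho> r x * w x)"
          by (rule Bochner_Integration.integrable_bound[OF i m])
             (use le in \<open>auto intro!: AE_I2 order_trans[OF _ abs_ge_self]\<close>)
        have "norm (\<integral>x. \<rho> r x * w x \<partial>lborel) \<le> (\<integral>x. B * \<bar>\<rho> r x\<bar> \<partial>lborel)"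
          by (rule Bochner_Integration.integral_norm_bound_integral[OF i' i]) (use le in simp)
        also have "\<dots> \<le> B * A" using A(1)[OF r0(2)] B by (simp add: mult_left_mono)
        finally show ?thesis by simp
      qed
      have g1: "\<bar>\<integral>x. \<rho> r x * tr2 (bump_hess R 0 x) \<partial>lborel\<bar> \<le> 36 / R\<^sup>2 * A"
      proof (rule gen[OF tr2_bump_hess_bound[OF R]])
        show "continuous_on UNIV (\<lambda>x. tr2 (bump_hess R 0 x))"
          unfolding tr2_def bump_hess_def by (intro continuous_intros continuous_bump_arg)
      qed
      have g2: "\<bar>\<integral>x. \<rho> r x * (u r x \<bullet> bump_grad R 0 x) \<partial>lborel\<bar> \<le> U * (6 / R) * A"
      proof (rule gen)
        show "continuous_on UNIV (\<lambda>x. u r x \<bullet> bump_grad R 0 x)"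
          unfolding bump_grad_def by (intro continuous_intros continuous_bump_arg u_slice r0)
        show "\<bar>u r x \<bullet> bump_grad R 0 x\<bar> \<le> U * (6 / R)" for x
          using U r0(2) norm_bump_grad(2)[OF R]
          by (intro order_trans[OF Cauchy_Schwarz_ineq2] mult_mono) auto
      qed
      have "norm (j' r) \<le> \<nu> * \<bar>\<integral>x. \<rho> r x * tr2 (bump_hess R 0 x) \<partial>lborel\<bar> + \<bar>\<integral>x. \<rho> r x * (u r x \<bullet> bump_grad R 0 x) \<partial>lborel\<bar>"
        unfolding j'_def using nu by (auto intro!: order_trans[OF abs_triangle_ineq] simp: abs_mult)
      then show ?thesis using mult_left_mono[OF g1, of \<nu>] g2 nu by linarith
    qed
    have "norm (j R t - j R s) \<le> (\<nu> * (36 / R\<^sup>2 * A) + U * (6 / R) * A) * norm (t - s)"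
    proof (rule field_differentiable_bound[of "{s..t}" "j R" j'])
      fix r assume r: "r \<in> {s..t}"
      show "(j R has_field_derivative j' r) (at r within {s..t})"
        unfolding j_def[abs_def] j'_def
        by (rule DERIV_subset[OF localized_mass_derivative[OF _ R]]) (use r s in auto)
    qed (use b s in auto)
    then show ?thesis by simp
  qed
  have lim: "(\<lambda>n. j (real (Suc n)) r) \<longlonglongrightarrow> (\<integral>x. \<rho> r x \<partial>lborel)" if r: "r \<ge> 0" for r
    unfolding j_def
  proof (rule integral_dominated_convergence[where w = "\<lambda>x. \<bar>\<rho> r x\<bar>"])
    show "AE x in lborel. (\<lambda>n. \<rho> r x * bump (real (Suc n)) 0 x) \<longlonglongrightarrow> \<rho> r x"
      using tendsto_mult[OF tendsto_const bump_tendsto_1, of "\<rho> r _"] by (intro AE_I2) auto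
    show "AE x in lborel. norm (\<rho> r x * bump (real (Suc n)) 0 x) \<le> \<bar>\<rho> r x\<bar>" for n
      using bump_bounds[of "real (Suc n)" 0] by (intro AE_I2) (simp add: abs_mult mult_left_le)
    show "(\<lambda>x. \<rho> r x * bump (real (Suc n)) 0 x) \<in> borel_measurable lborel" for n
      using borel_measurable_integrable[OF rho_int[OF r]] borel_measurable_integrable[OF integral_bump_bounds(1)[of "real (Suc n)" 0]]
      by (intro borel_measurable_times) auto
  qed (use rho_int[OF r] in auto)
  have "(\<lambda>n. \<bar>j (real (Suc n)) t - j (real (Suc n)) s\<bar>) \<longlonglongrightarrow> \<bar>(\<integral>x. \<rho> t x \<partial>lborel) - (\<integral>x. \<rho> s x \<partial>lborel)\<bar>"
    using lim[of t] lim[of s] s by (intro tendsto_intros) auto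
  moreover have "(\<lambda>n. (\<nu> * (36 * (1 / real (Suc n))\<^sup>2 * A) + U * (6 * (1 / real (Suc n))) * A) * \<bar>t - s\<bar>) \<longlonglongrightarrow>
      (\<nu> * (36 * 0\<^sup>2 * A) + U * (6 * 0) * A) * \<bar>t - s\<bar>"
    by (intro tendsto_intros LIMSEQ_Suc lim_1_over_n)
  moreover have "\<bar>j (real (Suc n)) t - j (real (Suc n)) s\<bar> \<le> (\<nu> * (36 * (1 / real (Suc n))\<^sup>2 * A) + U * (6 * (1 / real (Suc n))) * A) * \<bar>t - s\<bar>" for n
    using jb[of "real (Suc n)"] by (simp add: power_divide)
  ultimately have "\<bar>(\<integral>x. \<rho> t x \<partial>lborel) - (\<integral>x. \<rho> s x \<partial>lborel)\<bar> \<le> (\<nu> * (36 * 0\<^sup>2 * A) + U * (6 * 0) * A) * \<bar>t - s\<bar>"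
    by (intro LIMSEQ_le) auto
  then show ?thesis by simp
qed

text \<open>Continuity in \<open>L^1\<close> at time 0 bridges the gap to small positive
  times.\<close>

lemma mass_conserved:
  assumes t: "t \<ge> 0"
  shows "(\<integral>x. \<rho> t x \<partial>lborel) = (\<integral>x. \<rho> 0 x \<partial>lborel)"
proof (cases "t = 0")
  case False
  have "\<bar>(\<integral>x. \<rho> t x \<partial>lborel) - (\<integral>x. \<rho> 0 x \<partial>lborel)\<bar> \<le> 0 + e" if e: "e > 0" for e
  proof -
    have "\<forall>\<^sub>F s in at 0 within {0..}. (\<integral>x. \<bar>\<rho> s x - \<rho> 0 x\<bar> \<partial>lborel) < e"
      using order_tendstoD(2)[OF rho_L1[of 0] e] by simp
    then obtain d where d: "d > 0" "\<And>s. s \<ge> 0 \<Longrightarrow> s \<noteq> 0 \<Longrightarrow> dist s 0 < d \<Longrightarrow> (\<integral>x. \<bar>\<rho> s x - \<rho> 0 x\<bar> \<partial>lborel) < e"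
      unfolding eventually_at by auto
    define s where "s = min (d / 2) t"
    have s: "0 < s" "s \<le> t" "s < d" using d(1) t False by (auto simp: s_def)
    have "(\<integral>x. \<rho> t x \<partial>lborel) - (\<integral>x. \<rho> 0 x \<partial>lborel) = (\<integral>x. \<rho> s x - \<rho> 0 x \<partial>lborel)"
      using mass_conserved_pos[OF s(1,2)] rho_int[of s] rho_int[of 0] s by simp
    also have "\<bar>\<dots>\<bar> \<le> (\<integral>x. \<bar>\<rho> s x - \<rho> 0 x\<bar> \<partial>lborel)"
      using integral_norm_bound[of lborel "\<lambda>x. \<rho> s x - \<rho> 0 x"] by simp
    also have "\<dots> < e" using d(2)[of s] s by simp
    finally show ?thesis by simp
  qed
  then have "\<bar>(\<integral>x. \<rho> t x \<partial>lborel) - (\<integral>x. \<rho> 0 x \<partial>lborel)\<bar> \<le> 0" by (rule field_le_epsilon)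
  then show ?thesis by simp
qed simp

section \<open>Pointwise bounds for the density and the drift\<close>

lemma rho_cont_T: "continuous_on ({0..T} \<times> UNIV) (\<lambda>(t, x). \<rho> t x)"
  by (rule continuous_on_subset[OF rho_cont]) auto

lemma inner_u_le:
  assumes "norm (u t x) \<le> U" shows "\<bar>u t x \<bullet> v\<bar> \<le> U * norm v"
  using assms by (intro order_trans[OF Cauchy_Schwarz_ineq2] mult_right_mono) auto

text \<open>The comparison function solves \<open>m' = - m^2\<close>, the equation for spatially
  constant states. Where \<open>\<rho>\<close> exceeds it, the difference
  \<open>m^2 - \<rho>^2\<close> of the absorption terms is nonpositive.\<close>

lemma upper_bound:
  assumes M: "M > 0" "\<And>x. \<rho> 0 x \<le> M" and t: "t \<ge> 0"
  shows "\<rho> t x \<le> M / (1 + M * t)"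
proof -
  define m where "m s = M / (1 + M * s)" for s
  obtain B where B: "\<And>s x. s \<in> {0..t} \<Longrightarrow> \<bar>\<rho> s x\<bar> \<le> B" "B \<ge> 0" using rho_bound by metis
  obtain U where U: "\<And>s x. s \<in> {0..t} \<Longrightarrow> norm (u s x) \<le> U" "U \<ge> 0" using u_bound by metis
  have den: "1 + M * s > 0" if "s \<ge> 0" for s using that M by (intro add_pos_nonneg) auto
  have m0: "m s > 0" if "s \<ge> 0" for s using den[OF that] M by (simp add: m_def)
  have mc: "continuous_on ({0..t} \<times> UNIV) (\<lambda>p::real \<times> pt. m (fst p))"
    unfolding m_def using den by (intro continuous_intros) (force simp: less_imp_neq[symmetric])
  have "\<rho> t x - m t \<le> 0"
  proof (rule parabolic_max_principle[where z = "\<lambda>s x. \<rho> s x - m s" and T = t and B = B and \<nu> = \<nu> and U = U and M = 0])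
    show "continuous_on ({0..t} \<times> UNIV) (\<lambda>(s, x). \<rho> s x - m s)"
      using rho_cont_T[of t] mc unfolding case_prod_beta by (intro continuous_intros)
    show "\<rho> s y - m s \<le> B" if "s \<in> {0..t}" for s y
      using B(1)[OF that, of y] m0[of s] that by auto
    show "\<rho> 0 y - m 0 \<le> 0" for y using M by (simp add: m_def)
    fix s y assume s: "s \<in> {0<..t}" and pos: "\<rho> s y - m s > 0"
    have s0: "s > 0" "s \<ge> 0" "s \<in> {0..t}" using s by auto
    have dm: "(m has_real_derivative - (m s)\<^sup>2) (at s)"
      unfolding m_def[abs_def] using den[OF s0(2)]
      by (auto intro!: derivative_eq_intros simp: power2_eq_square)
    show "subsolution_at \<nu> U 0 (\<lambda>s x. \<rho> s x - m s) s y"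
      unfolding subsolution_at_def
    proof (intro exI conjI allI)
      show "((\<lambda>s. \<rho> s y - m s) has_real_derivative \<rho>t s y - - (m s)\<^sup>2) (at s)"
        by (intro DERIV_diff time s0 dm)
      show "((\<lambda>x. \<rho> s x - m s) has_derivative (\<lambda>h. G s x \<bullet> h)) (at x)" for x
        using has_derivative_diff[OF grad[OF s0(2)] has_derivative_const] by simp
      show "(G s has_derivative H s y) (at y)" by (rule hess[OF s0(1)])
      have "(m s)\<^sup>2 \<le> (\<rho> s y)\<^sup>2" using pos m0[OF s0(2)] by (intro power_mono) auto
      then show "\<rho>t s y - - (m s)\<^sup>2 \<le> \<nu> * tr2 (H s y) + U * norm (G s y) + 0 * (\<rho> s y - m s)"
        using inner_u_le[OF U(1)[OF s0(3)], of y "G s y"] by (simp add: equation[OF s0(1)])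
    qed
  qed (use nu U t in auto)
  then show ?thesis by (simp add: m_def)
qed

text \<open>For \<open>- \<rho>\<close> the absorption becomes a source \<open>\<rho>^2\<close>;
  where \<open>- \<rho>\<close> is positive it is at most \<open>B\<close> times
  \<open>- \<rho>\<close>, a linear zero-order term.\<close>

lemma nonneg:
  assumes init: "\<And>x. \<rho> 0 x \<ge> 0" and t: "t \<ge> 0"
  shows "\<rho> t x \<ge> 0"
proof -
  obtain B where B: "\<And>s x. s \<in> {0..t} \<Longrightarrow> \<bar>\<rho> s x\<bar> \<le> B" "B \<ge> 0" using rho_bound by metis
  obtain U where U: "\<And>s x. s \<in> {0..t} \<Longrightarrow> norm (u s x) \<le> U" "U \<ge> 0" using u_bound by metis
  have "- \<rho> t x \<le> 0"
  proof (rule parabolic_max_principle[where z = "\<lambda>s x. - \<rho> s x" and T = t and B = B and \<nu> = \<nu> and U = U and M = B])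
    show "continuous_on ({0..t} \<times> UNIV) (\<lambda>(s, x). - \<rho> s x)"
      using rho_cont_T[of t] unfolding case_prod_beta by (intro continuous_intros)
    show "- \<rho> s y \<le> B" if "s \<in> {0..t}" for s y using B(1)[OF that, of y] by auto
    fix s y assume s: "s \<in> {0<..t}" and pos: "- \<rho> s y > 0"
    have s0: "s > 0" "s \<ge> 0" "s \<in> {0..t}" using s by auto
    show "subsolution_at \<nu> U B (\<lambda>s x. - \<rho> s x) s y"
      unfolding subsolution_at_def
    proof (intro exI conjI allI)
      show "((\<lambda>s. - \<rho> s y) has_real_derivative - \<rho>t s y) (at s)"
        by (intro DERIV_minus time s0)
      show "((\<lambda>x. - \<rho> s x) has_derivative (\<lambda>h. (- G s x) \<bullet> h)) (at x)" for x
        using has_derivative_minus[OF grad[OF s0(2)]] by simp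
      show "((\<lambda>x. - G s x) has_derivative (\<lambda>h. - H s y h)) (at y)" by (intro has_derivative_minus hess s0)
      have "(\<rho> s y)\<^sup>2 \<le> B * (- \<rho> s y)"
        using mult_right_mono[OF B(1)[OF s0(3), of y], of "- \<rho> s y"] pos by (simp add: power2_eq_square)
      then show "- \<rho>t s y \<le> \<nu> * tr2 (\<lambda>h. - H s y h) + U * norm (- G s y) + B * (- \<rho> s y)"
        using inner_u_le[OF U(1)[OF s0(3)], of y "G s y"] by (simp add: equation[OF s0(1)] tr2_uminus)
    qed
  qed (use nu U B t init in auto)
  then show ?thesis by simp
qed

lemma upper_bound':
  assumes M: "M \<ge> 1" "\<And>x. \<rho> 0 x \<le> M" and t: "t \<ge> 0"
  shows "\<rho> t x \<le> M / (1 + t)"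
proof -
  have "\<rho> t x \<le> M / (1 + M * t)" by (rule upper_bound) (use assms in auto)
  also have "\<dots> \<le> M / (1 + t)"
    using M t mult_right_mono[of 1 M t] by (intro divide_left_mono mult_pos_pos) auto
  finally show ?thesis .
qed

text \<open>The splitting radius \<open>sqrt (1 + t)\<close> balances the two parts: sup norm of
  order \<open>1 / (1 + t)\<close> times the radius, and unit mass divided by the radius.\<close>

lemma drift_bound:
  assumes M: "M \<ge> 1" "\<And>x. \<rho> 0 x \<le> M" and init: "\<And>x. \<rho> 0 x \<ge> 0" "(\<integral>x. \<rho> 0 x \<partial>lborel) = 1" and t: "t \<ge> 0"
  shows "norm (u t x) \<le> (M + 1) / sqrt (1 + t)"
proof -
  have s: "sqrt (1 + t) > 0" using t by simp
  have n: "\<bar>\<rho> t x\<bar> \<le> M / (1 + t)" for x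
    using upper_bound'[OF M t, of x] nonneg[OF init(1) t, of x] by simp
  have 1: "(\<integral>x. \<bar>\<rho> t x\<bar> \<partial>lborel) = 1"
    using nonneg[OF init(1) t] mass_conserved[OF t] init(2) by simp
  have "norm (u t x) \<le> M / (1 + t) * sqrt (1 + t) + 1 / (2 * pi * sqrt (1 + t))"
    using norm_Kconv_le[OF rho_int[OF t] n s, of x] unfolding u_def 1 .
  also have "M / (1 + t) * sqrt (1 + t) = M / sqrt (1 + t)"
    using t s by (simp add: divide_simps)
  also have "1 / (2 * pi * sqrt (1 + t)) \<le> 1 / sqrt (1 + t)"
  proof -
    have "1 * sqrt (1 + t) \<le> (2 * pi) * sqrt (1 + t)" using pi_ge_two s by (intro mult_right_mono) auto
    then show ?thesis using s by (intro divide_left_mono mult_pos_pos) auto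
  qed
  finally show ?thesis by (simp add: add_divide_distrib)
qed

text \<open>The barrier is a spreading Gaussian of polynomially decaying amplitude. With
  \<open>\<sigma> = norm x / sqrt (1 + t)\<close>, Young's inequality bounds the drift by
  \<open>a * W^2 + a * \<sigma>^2\<close>; the condition \<open>4 * a * \<nu> \<ge> 2\<close> lets
  the diffusion term \<open>4 * \<nu> * a^2 * \<sigma>^2\<close> cover this
  \<open>a * \<sigma>^2\<close> and the equal one from the time derivative. What is independent of
  \<open>\<sigma>\<close> is paid by \<open>A1\<close>.\<close>

lemma lower_bound:
  assumes W: "\<And>t x. t \<ge> 0 \<Longrightarrow> norm (u t x) \<le> W / sqrt (1 + t)"
    and M: "M \<ge> 0" "\<And>t x. t \<ge> 0 \<Longrightarrow> \<rho> t x \<le> M / (1 + t)"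
    and nn: "\<And>t x. t \<ge> 0 \<Longrightarrow> \<rho> t x \<ge> 0"
    and init: "\<And>x. exp (- (A0 + a * (x \<bullet> x))) \<le> \<rho> 0 x"
    and a: "4 * a * \<nu> \<ge> 2" "a > 0" and A1: "A1 \<ge> 4 * a * \<nu> + a * W\<^sup>2 + M"
    and t: "t \<ge> 0"
  shows "exp (- (A0 + A1 * ln (1 + t) + a * (x \<bullet> x) / (1 + t))) \<le> \<rho> t x"
proof -
  define b where "b s y = exp (- ((A0 + A1 * ln (1 + s)) + a / (1 + s) * (y \<bullet> y)))" for s :: real and y :: pt
  have W0: "W \<ge> 0" using W[of 0 0] by (simp add: order_trans[OF norm_ge_zero])
  have A10: "A1 \<ge> 0" using a nu M A1 by (intro order_trans[OF _ A1]) auto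
  have "b t x - \<rho> t x \<le> 0"
  proof (rule parabolic_max_principle[where z = "\<lambda>s x. b s x - \<rho> s x" and T = t and B = "exp (- A0)" and \<nu> = \<nu> and U = W and M = 0])
    show "continuous_on ({0..t} \<times> UNIV) (\<lambda>(s, x). b s x - \<rho> s x)"
      using rho_cont_T[of t] unfolding b_def case_prod_beta by (intro continuous_intros) auto
    show "b s y - \<rho> s y \<le> exp (- A0)" if s: "s \<in> {0..t}" for s y
    proof -
      have "A1 * ln (1 + s) \<ge> 0" "a / (1 + s) * (y \<bullet> y) \<ge> 0" using s A10 a by auto
      then have "b s y \<le> exp (- A0)" by (simp add: b_def)
      then show ?thesis using nn[of s y] s by simp
    qed
    show "b 0 y - \<rho> 0 y \<le> 0" for y using init[of y] by (simp add: b_def)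
    fix s y assume s: "s \<in> {0<..t}" and pos: "b s y - \<rho> s y > 0"
    have s0: "s > 0" "s \<ge> 0" "s \<in> {0..t}" using s by auto
    define \<tau> where "\<tau> = 1 + s"
    have \<tau>: "\<tau> \<ge> 1" "\<tau> > 0" using s0 by (auto simp: \<tau>_def)
    define k where "k = a / \<tau>"
    define E where "E = b s y"
    have E: "E > 0" by (simp add: E_def b_def)
    have Eq: "E = exp (- ((A0 + A1 * ln (1 + s)) + k * (y \<bullet> y)))" by (simp add: E_def b_def k_def \<tau>_def)
    have bs: "b s = (\<lambda>x. exp (- ((A0 + A1 * ln (1 + s)) + k * (x \<bullet> x))))" by (simp add: b_def k_def \<tau>_def fun_eq_iff)
    let ?Gb = "\<lambda>x. (- 2 * k * exp (- ((A0 + A1 * ln (1 + s)) + k * (x \<bullet> x)))) *\<^sub>R x"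
    let ?Hb = "\<lambda>h. (- 2 * k * E) *\<^sub>R h + ((4 * k\<^sup>2 * E) * (y \<bullet> h)) *\<^sub>R y"
    show "subsolution_at \<nu> W 0 (\<lambda>s x. b s x - \<rho> s x) s y"
      unfolding subsolution_at_def
    proof (intro exI conjI allI)
      have "((\<lambda>s. b s y) has_real_derivative E * (- (A1 / \<tau>) + a * (y \<bullet> y) / \<tau>\<^sup>2)) (at s)"
        unfolding b_def using s0
        by (auto intro!: derivative_eq_intros simp: E_def b_def \<tau>_def power2_eq_square)
      then show "((\<lambda>s. b s y - \<rho> s y) has_real_derivative E * (- (A1 / \<tau>) + a * (y \<bullet> y) / \<tau>\<^sup>2) - \<rho>t s y) (at s)"
        by (intro DERIV_diff time s0)
      show "((\<lambda>x. b s x - \<rho> s x) has_derivative (\<lambda>h. (?Gb x - G s x) \<bullet> h)) (at x)" for x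
        unfolding bs inner_diff_left by (intro has_derivative_diff gaussian_gradient grad s0)
      show "((\<lambda>x. ?Gb x - G s x) has_derivative (\<lambda>h. ?Hb h - H s y h)) (at y)"
        unfolding Eq by (intro has_derivative_diff gaussian_hessian hess s0)
      have tr: "tr2 (\<lambda>h. ?Hb h - H s y h) = 2 * (- 2 * k * E) + 4 * k\<^sup>2 * E * (y \<bullet> y) - tr2 (H s y)"
        by (simp only: tr2_diff tr2_scaleR_rank_one)
      \<comment> \<open>The gradient of the solution is written as that of the barrier minus
        \<open>g\<close>; the drift acting on \<open>g\<close> is what the gradient term of the
        maximum principle tolerates.\<close>
      define g where "g = ?Gb y - G s y"
      have Gg: "G s y = (- 2 * k * E) *\<^sub>R y - g" by (simp add: g_def Eq)
      have uW: "norm (u s y) \<le> W"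
      proof -
        have "sqrt \<tau> \<ge> 1" using \<tau> by simp
        then have "W / sqrt \<tau> \<le> W / 1" using W0 by (intro divide_left_mono) auto
        then show ?thesis using W[OF s0(2), of y] by (simp add: \<tau>_def)
      qed
      define \<sigma> where "\<sigma> = norm y / sqrt \<tau>"
      have \<sigma>2: "\<sigma>\<^sup>2 = (y \<bullet> y) / \<tau>" using \<tau> by (simp add: \<sigma>_def power_divide power2_norm_eq_inner)
      have k0: "k > 0" using a \<tau> by (simp add: k_def)
      have uy: "\<bar>u s y \<bullet> y\<bar> \<le> W * \<sigma>"
        using inner_u_le[OF W[OF s0(2)], of y y] by (simp add: \<sigma>_def \<tau>_def)
      have "u s y \<bullet> G s y = - (2 * k * E) * (u s y \<bullet> y) - u s y \<bullet> g" by (simp add: Gg inner_diff_right)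
      also have "\<dots> \<le> (2 * k * E) * (W * \<sigma>) + W * norm g"
      proof -
        have "(2 * k * E) * (- (u s y \<bullet> y)) \<le> (2 * k * E) * (W * \<sigma>)"
          using uy k0 E by (intro mult_left_mono) auto
        moreover have "- (u s y \<bullet> g) \<le> W * norm g" using inner_u_le[OF uW, of g] by linarith
        ultimately show ?thesis by (simp only: mult_minus_left mult_minus_right)
      qed
      finally have d1: "u s y \<bullet> G s y \<le> (2 * k * E) * (W * \<sigma>) + W * norm g" .
      \<comment> \<open>Where the barrier lies above the solution, one factor of the square is
        bounded by the barrier and the other by the decay, so the absorption is linear in
        \<open>E\<close>.\<close>
      have d2: "(\<rho> s y)\<^sup>2 \<le> E * (M / \<tau>)"
        using pos nn[OF s0(2), of y] M(2)[OF s0(2), of y] E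
        unfolding power2_eq_square by (intro mult_mono) (auto simp: E_def \<tau>_def)
      have key: "- (A1 / \<tau>) + a * (y \<bullet> y) / \<tau>\<^sup>2 + 2 * k * (W * \<sigma>) + M / \<tau> \<le> \<nu> * (2 * (- 2 * k) + 4 * k\<^sup>2 * (y \<bullet> y))"
      proof -
        have "2 * W * \<sigma> \<le> W\<^sup>2 + \<sigma>\<^sup>2" using sum_squares_bound[of W \<sigma>] by simp
        then have "a * (2 * W * \<sigma>) \<le> a * (W\<^sup>2 + \<sigma>\<^sup>2)" using a by (intro mult_left_mono) auto
        moreover have "2 * (a * \<sigma>\<^sup>2) \<le> (4 * a * \<nu>) * (a * \<sigma>\<^sup>2)" using a by (intro mult_right_mono) auto
        ultimately have "- A1 + a * \<sigma>\<^sup>2 + 2 * a * (W * \<sigma>) + M \<le> \<nu> * (2 * (- 2 * a) + 4 * a\<^sup>2 * \<sigma>\<^sup>2)"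
          using A1 by (simp add: algebra_simps power2_eq_square)
        then have "(- A1 + a * \<sigma>\<^sup>2 + 2 * a * (W * \<sigma>) + M) / \<tau> \<le> (\<nu> * (2 * (- 2 * a) + 4 * a\<^sup>2 * \<sigma>\<^sup>2)) / \<tau>"
          using \<tau> by (intro divide_right_mono) auto
        moreover have "(- A1 + a * \<sigma>\<^sup>2 + 2 * a * (W * \<sigma>) + M) / \<tau> = - (A1 / \<tau>) + a * (y \<bullet> y) / \<tau>\<^sup>2 + 2 * k * (W * \<sigma>) + M / \<tau>"
          unfolding \<sigma>2 k_def using \<tau> by (simp add: add_divide_distrib diff_divide_distrib power2_eq_square)
        moreover have "(\<nu> * (2 * (- 2 * a) + 4 * a\<^sup>2 * \<sigma>\<^sup>2)) / \<tau> = \<nu> * (2 * (- 2 * k) + 4 * k\<^sup>2 * (y \<bullet> y))"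
          unfolding \<sigma>2 k_def using \<tau> by (simp add: field_simps power2_eq_square)
        ultimately show ?thesis by simp
      qed
      have "E * (- (A1 / \<tau>) + a * (y \<bullet> y) / \<tau>\<^sup>2 + 2 * k * (W * \<sigma>) + M / \<tau>) \<le> E * (\<nu> * (2 * (- 2 * k) + 4 * k\<^sup>2 * (y \<bullet> y)))"
        using key E by (intro mult_left_mono) auto
      then have "E * (- (A1 / \<tau>) + a * (y \<bullet> y) / \<tau>\<^sup>2) - \<rho>t s y \<le> \<nu> * tr2 (\<lambda>h. ?Hb h - H s y h) + W * norm g"
        unfolding tr equation[OF s0(1)] using d1 d2 by (simp add: algebra_simps)
      then show "E * (- (A1 / \<tau>) + a * (y \<bullet> y) / \<tau>\<^sup>2) - \<rho>t s y \<le> \<nu> * tr2 (\<lambda>h. ?Hb h - H s y h) + W * norm (?Gb y - G s y) + 0 * (b s y - \<rho> s y)"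
        by (simp add: g_def)
    qed
  qed (use nu W0 t in auto)
  then show ?thesis by (simp add: b_def algebra_simps)
qed

end

subsection \<open>Two-point maximum principle\<close>

definition perp :: "pt \<Rightarrow> pt" where
  "perp e = (- (e $ 2)) *\<^sub>R axis 1 1 + (e $ 1) *\<^sub>R axis 2 1"

lemma inner_perp_self: "perp e \<bullet> perp e = e \<bullet> e"
  using axis_offdiag by (simp add: perp_def inner_vec_def sum_2 algebra_simps)

text \<open>Evaluates the Laplacian in the frame formed by the direction joining the two points and
  its normal.\<close>

lemma tr2_orthonormal:
  assumes Q: "bounded_linear Q" and e: "e \<bullet> e = 1"
  shows "Q e \<bullet> e + Q (perp e) \<bullet> perp e = tr2 Q"
proof -
  interpret Q: bounded_linear Q by (rule Q)
  note ax = axis_offdiag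
  have e': "e = (e $ 1) *\<^sub>R axis 1 1 + (e $ 2) *\<^sub>R axis 2 1"
    using ax by (simp add: vec_eq_iff forall_2)
  define a b where "a = e $ 1" and "b = e $ 2"
  have ab: "a * a + b * b = 1" using e by (simp add: a_def b_def inner_vec_def sum_2)
  have Qe: "Q e = a *\<^sub>R Q (axis 1 1) + b *\<^sub>R Q (axis 2 1)"
    by (subst e') (simp add: Q.add Q.scaleR a_def b_def)
  have Qp: "Q (perp e) = (- b) *\<^sub>R Q (axis 1 1) + a *\<^sub>R Q (axis 2 1)"
    by (simp only: perp_def Q.add Q.scaleR a_def b_def)
  have "Q e \<bullet> e + Q (perp e) \<bullet> perp e = (a * a + b * b) * (Q (axis 1 1) $ 1 + Q (axis 2 1) $ 2)"
    unfolding Qe Qp using ax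
    by (simp add: perp_def inner_vec_def sum_2 algebra_simps flip: a_def b_def)
  then show ?thesis by (simp add: ab tr2_eq)
qed

text \<open>The slope falls from 2 at the origin to 1 at infinity, so the modulus stays comparable
  to \<open>s\<close>, while its second derivative at the origin is \<open>- 2 * b\<close>;
  \<open>1 / b\<close> is the range on which the concavity is effective.\<close>

definition modulus :: "real \<Rightarrow> real \<Rightarrow> real" where "modulus b s = s + s / (1 + b * s)"
definition modulus' :: "real \<Rightarrow> real \<Rightarrow> real" where "modulus' b s = 1 + 1 / (1 + b * s)\<^sup>2"
definition modulus'' :: "real \<Rightarrow> real \<Rightarrow> real" where "modulus'' b s = - (2 * b) / (1 + b * s) ^ 3"

lemma modulus_deriv:
  assumes "1 + b * s > 0"
  shows "(modulus b has_real_derivative modulus' b s) (at s)"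
    and "(modulus' b has_real_derivative modulus'' b s) (at s)"
proof -
  have n: "1 + b * s \<noteq> 0" using assms by simp
  show "(modulus b has_real_derivative modulus' b s) (at s)"
    unfolding modulus_def[abs_def] modulus'_def using n
    by (auto intro!: derivative_eq_intros simp: power2_eq_square)
  show "(modulus' b has_real_derivative modulus'' b s) (at s)"
  proof -
    have "((\<lambda>s. 1 + 1 / (1 + b * s)\<^sup>2) has_real_derivative - (2 * (1 + b * s) * b) / ((1 + b * s)\<^sup>2 * (1 + b * s)\<^sup>2)) (at s)"
      using n by (auto intro!: derivative_eq_intros)
    moreover have "- (2 * (1 + b * s) * b) / ((1 + b * s)\<^sup>2 * (1 + b * s)\<^sup>2) = modulus'' b s"
      using n unfolding modulus''_def by (simp add: divide_simps power2_eq_square power3_eq_cube)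
    ultimately show ?thesis unfolding modulus'_def[abs_def] by simp
  qed
qed

lemma modulus_bounds:
  assumes "b > 0" "s \<ge> 0"
  shows "s \<le> modulus b s" "modulus b s \<le> 2 * s" "1 \<le> modulus' b s" "modulus' b s \<le> 2" "modulus'' b s \<le> 0"
proof -
  have p: "1 + b * s \<ge> 1" "1 + b * s > 0" using assms by (auto intro: add_pos_nonneg)
  then have p2: "(1 + b * s)\<^sup>2 \<ge> 1" by simp
  show "s \<le> modulus b s" using p assms by (simp add: modulus_def)
  have "s / (1 + b * s) \<le> s / 1" using p assms by (intro divide_left_mono) auto
  then show "modulus b s \<le> 2 * s" by (simp add: modulus_def)
  show "1 \<le> modulus' b s" using p by (simp add: modulus'_def)
  have "1 / (1 + b * s)\<^sup>2 \<le> 1 / 1" using p2 by (intro divide_left_mono) auto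
  then show "modulus' b s \<le> 2" by (simp add: modulus'_def)
  show "modulus'' b s \<le> 0" using p assms by (simp add: modulus''_def)
qed

text \<open>Near \<open>s = 0\<close> the concavity of the modulus beats the drift, for larger \<open>s\<close> the absorption
  term with coefficient \<open>k\<^sup>2\<close> does.\<close>
lemma modulus_supersolution:
  assumes b: "b > 0" and s: "s \<ge> 0" and bW: "\<nu> * b \<ge> 4 * W" and kW: "2 * \<nu> * k\<^sup>2 - 1 \<ge> 4 * W * b" and nu: "\<nu> > 0" and W: "W \<ge> 0"
  shows "4 * \<nu> * modulus'' b s - 2 * \<nu> * k\<^sup>2 * modulus b s * (modulus' b s)\<^sup>2 + 2 * W * modulus' b s + modulus' b s * s / 2 \<le> 0"
proof -
  note m = modulus_bounds[OF b s]
  have p: "1 + b * s \<ge> 1" using b s by simp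
  have k: "2 * \<nu> * k\<^sup>2 - 1 \<ge> 0" using kW W b by (intro order_trans[OF _ kW]) auto
  have "s * 1 \<le> modulus b s * (modulus' b s)\<^sup>2"
    using m s by (intro mult_mono) auto
  then have 1: "2 * \<nu> * k\<^sup>2 * s \<le> 2 * \<nu> * k\<^sup>2 * (modulus b s * (modulus' b s)\<^sup>2)"
    using nu by (intro mult_left_mono) auto
  have 2: "2 * W * modulus' b s \<le> 4 * W" using m W mult_left_mono[of "modulus' b s" 2 "2 * W"] by simp
  \<comment> \<open>This term stems from the moving scale \<open>sqrt (1 + t)\<close> and accounts
    for the \<open>- 1\<close> in the hypothesis on \<open>k\<close>.\<close>
  have 3: "modulus' b s * s / 2 \<le> s" using m s mult_right_mono[of "modulus' b s" 2 s] by simp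
  \<comment> \<open>For \<open>b * s \<le> 1\<close> the concavity is at least \<open>b / 4\<close>
    and yields \<open>\<nu> * b \<ge> 4 * W\<close>; beyond that range the factor
    \<open>s \<ge> 1 / b\<close> lets the absorption yield the same amount.\<close>
  have 4: "4 * \<nu> * modulus'' b s + 4 * W \<le> (2 * \<nu> * k\<^sup>2 - 1) * s"
  proof (cases "b * s \<le> 1")
    case True
    have "(1 + b * s) ^ 3 \<le> 2 ^ 3" using True p by (intro power_mono) auto
    then have "2 * b / 8 \<le> 2 * b / (1 + b * s) ^ 3"
      using p b by (intro divide_left_mono) auto
    then have "modulus'' b s \<le> - (b / 4)" by (simp add: modulus''_def)
    then have "4 * \<nu> * modulus'' b s \<le> 4 * \<nu> * (- (b / 4))" using nu by (intro mult_left_mono) auto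
    moreover have "(2 * \<nu> * k\<^sup>2 - 1) * s \<ge> 0" using k s by simp
    ultimately show ?thesis using bW by simp
  next
    case False
    have "4 * W * 1 \<le> 4 * W * (b * s)" using False W by (intro mult_left_mono) auto
    also have "\<dots> \<le> (2 * \<nu> * k\<^sup>2 - 1) * s" using mult_right_mono[OF kW s] by (simp add: mult.assoc)
    finally have "4 * W \<le> (2 * \<nu> * k\<^sup>2 - 1) * s" by simp
    moreover have "4 * \<nu> * modulus'' b s \<le> 0" using m nu by (simp add: mult_nonneg_nonpos)
    ultimately show ?thesis by linarith
  qed
  show ?thesis using 1 2 3 4 by (simp add: algebra_simps)
qed

lemma square_sum_bounds:
  fixes X Y :: real
  assumes "X \<ge> 0" "Y \<ge> 0"
  shows "X * (1 + X) \<le> 2 * (2 + X\<^sup>2 + Y\<^sup>2)" "(1 + Y) * (X + Y) \<le> 2 * (2 + X\<^sup>2 + Y\<^sup>2)" "X + Y \<le> 2 + X\<^sup>2 + Y\<^sup>2"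
proof -
  have am: "2 * X \<le> 1 + X\<^sup>2" "2 * Y \<le> 1 + Y\<^sup>2" "2 * (X * Y) \<le> X\<^sup>2 + Y\<^sup>2" "0 \<le> X\<^sup>2" "0 \<le> Y\<^sup>2"
    using sum_squares_bound[of X 1] sum_squares_bound[of Y 1] sum_squares_bound[of X Y] by simp_all
  have ex: "X * (1 + X) = X + X\<^sup>2" "(1 + Y) * (X + Y) = X + Y + X * Y + Y\<^sup>2"
    by (simp_all add: power2_eq_square algebra_simps)
  have r: "2 * (2 + X\<^sup>2 + Y\<^sup>2) = 4 + 2 * X\<^sup>2 + 2 * Y\<^sup>2" by simp
  have gen: "X + A \<le> 4 + 2 * A + 2 * B \<and> X + Y + C + B \<le> 4 + 2 * A + 2 * B \<and> X + Y \<le> 2 + A + B"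
    if "2 * X \<le> 1 + A" "2 * Y \<le> 1 + B" "2 * C \<le> A + B" "0 \<le> A" "0 \<le> B" for A B C
    using that by linarith
  show "X * (1 + X) \<le> 2 * (2 + X\<^sup>2 + Y\<^sup>2)" "(1 + Y) * (X + Y) \<le> 2 * (2 + X\<^sup>2 + Y\<^sup>2)" "X + Y \<le> 2 + X\<^sup>2 + Y\<^sup>2"
    unfolding ex r using gen[OF am] by blast+
qed

text \<open>Growth at the first point bounds the penalty, hence \<open>e * (1 + X)\<close>. For the
  second point, \<open>(e * (1 + Y))^2\<close> is at most \<open>2 * e\<close> times the penalty,
  which these two bounds turn into \<open>(2 * K)^2\<close>.\<close>

lemma penalty_linear_bound:
  fixes e X Y K :: real
  assumes e: "e > 0" and X: "X \<ge> 0" and Y: "Y \<ge> 0" and K: "K \<ge> 0" and le: "e * (2 + X\<^sup>2 + Y\<^sup>2) \<le> K * (1 + X)"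
  shows "e * (1 + Y) \<le> 2 * K"
proof -
  have sq: "(1 + Z)\<^sup>2 \<le> 2 * (2 + X\<^sup>2 + Y\<^sup>2)" if "Z = X \<or> Z = Y" for Z
  proof -
    have "2 * Z \<le> 1 + Z\<^sup>2" using sum_squares_bound[of Z 1] by simp
    moreover have "Z\<^sup>2 \<le> X\<^sup>2 + Y\<^sup>2" using that by auto
    moreover have "(1 + Z)\<^sup>2 = 1 + 2 * Z + Z\<^sup>2" by (simp add: power2_sum)
    moreover have "1 + 2 * Z + A \<le> 2 * (2 + B + C)" if "2 * Z \<le> 1 + A" "A \<le> B + C" for A B C
      using that by simp
    ultimately show ?thesis by metis
  qed
  have "(e * (1 + X)) * (1 + X) \<le> (2 * K) * (1 + X)"
    using mult_left_mono[OF sq[of X], of e] e le by (simp add: power2_eq_square algebra_simps)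
  then have eX: "e * (1 + X) \<le> 2 * K" using X by (simp add: mult_le_cancel_right)
  have "(e * (1 + Y))\<^sup>2 = e * (e * (1 + Y)\<^sup>2)" by (simp add: power2_eq_square)
  also have "\<dots> \<le> e * (e * (2 * (2 + X\<^sup>2 + Y\<^sup>2)))" using sq[of Y] e by (intro mult_left_mono) auto
  also have "\<dots> = e * (2 * (e * (2 + X\<^sup>2 + Y\<^sup>2)))" by (subst mult.left_commute[of e 2]) (rule refl)
  also have "\<dots> \<le> e * (2 * (K * (1 + X)))" using le e by (intro mult_left_mono) auto
  also have "\<dots> = (2 * K) * (e * (1 + X))" by simp
  also have "\<dots> \<le> (2 * K) * (2 * K)" using eX K by (intro mult_left_mono) auto
  finally have "(e * (1 + Y))\<^sup>2 \<le> (2 * K)\<^sup>2" by (simp add: power2_eq_square)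
  then show ?thesis by (rule power2_le_imp_le) (use K in simp)
qed

text \<open>The quadratic penalties perturb the absorption term only by a multiple of the penalty itself.\<close>
lemma absorption_estimate:
  fixes x y n p q :: pt and e w k K \<theta>x \<theta>y \<omega> :: real
  assumes n: "n \<bullet> n = 1" and p: "p = w *\<^sub>R n + (2 * e) *\<^sub>R x" and q: "q = w *\<^sub>R n - (2 * e) *\<^sub>R y"
    and e: "e > 0" and w: "0 \<le> w" "w \<le> 2 * k" and K: "K \<ge> 0"
    and \<theta>: "2 * \<omega> \<le> \<theta>x - \<theta>y" "0 \<le> \<theta>x - \<theta>y" "\<theta>x - \<theta>y \<le> 2 * K * (1 + norm x)" "0 \<le> \<theta>y" "\<theta>y \<le> 2 * K * (1 + norm y)"
    and eK: "e * (1 + norm y) \<le> 2 * K"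
  shows "\<theta>y * (q \<bullet> q) - \<theta>x * (p \<bullet> p) \<le> - 2 * \<omega> * w\<^sup>2 + (64 * k * K + 16 * K\<^sup>2) * (e * (2 + (norm x)\<^sup>2 + (norm y)\<^sup>2))"
proof -
  define X Y Q where "X = norm x" and "Y = norm y" and "Q = 2 + X\<^sup>2 + Y\<^sup>2"
  have X: "X \<ge> 0" "Y \<ge> 0" by (auto simp: X_def Y_def)
  note sb = square_sum_bounds[OF X, folded Q_def]
  have k: "k \<ge> 0" using w by linarith
  have nn: "norm n = 1" using n by (simp add: norm_eq_1)
  have nx: "\<bar>n \<bullet> x\<bar> \<le> X" "\<bar>n \<bullet> y\<bar> \<le> Y"
    using Cauchy_Schwarz_ineq2[of n x] Cauchy_Schwarz_ineq2[of n y] nn by (auto simp: X_def Y_def)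
  have we: "0 \<le> 4 * w * e" using w e by simp
  have xx: "x \<bullet> x = X * X" "y \<bullet> y = Y * Y" by (simp_all add: X_def Y_def norm_eq_sqrt_inner)
  have pp: "p \<bullet> p = w\<^sup>2 + 4 * w * e * (n \<bullet> x) + 4 * e\<^sup>2 * X\<^sup>2"
    using n xx by (simp add: p inner_add_left inner_add_right inner_commute[of x n] power2_eq_square algebra_simps)
  have qq: "q \<bullet> q = w\<^sup>2 - 4 * w * e * (n \<bullet> y) + 4 * e\<^sup>2 * Y\<^sup>2"
    using n xx by (simp add: q inner_diff_left inner_diff_right inner_commute[of y n] power2_eq_square algebra_simps)
  have pl: "w\<^sup>2 - 4 * w * e * X \<le> p \<bullet> p"
  proof -
    have "4 * w * e * (- (n \<bullet> x)) \<le> 4 * w * e * X" using nx we by (intro mult_left_mono) auto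
    then have "- (4 * w * e * (n \<bullet> x)) \<le> 4 * w * e * X" by (simp only: mult_minus_right)
    moreover have "0 \<le> 4 * e\<^sup>2 * X\<^sup>2" by simp
    ultimately show ?thesis unfolding pp by linarith
  qed
  \<comment> \<open>The difference is split so that \<open>A\<close> holds the gain from unequal
    coefficients, while \<open>B\<close> holds only the discrepancy of the two gradients, which is
    due to the penalty alone.\<close>
  have A: "- (\<theta>x - \<theta>y) * (p \<bullet> p) \<le> - 2 * \<omega> * w\<^sup>2 + 32 * k * K * (e * Q)"
  proof -
    have "(\<theta>x - \<theta>y) * (w\<^sup>2 - 4 * w * e * X) \<le> (\<theta>x - \<theta>y) * (p \<bullet> p)" using pl \<theta> by (intro mult_left_mono) auto
    moreover have "2 * \<omega> * w\<^sup>2 \<le> (\<theta>x - \<theta>y) * w\<^sup>2" using \<theta> by (intro mult_right_mono) auto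
    moreover have "(\<theta>x - \<theta>y) * (4 * w * e * X) \<le> (2 * K * (1 + X)) * (4 * (2 * k) * e * X)"
      using \<theta> w e X K k by (intro mult_mono) (auto simp: X_def)
    moreover have "(2 * K * (1 + X)) * (4 * (2 * k) * e * X) = (16 * k * K * e) * (X * (1 + X))" by (simp add: algebra_simps)
    moreover have "\<dots> \<le> (16 * k * K * e) * (2 * Q)" using sb(1) k K e by (intro mult_left_mono) auto
    ultimately show ?thesis by (simp add: algebra_simps)
  qed
  have B: "\<theta>y * (q \<bullet> q - p \<bullet> p) \<le> (32 * k * K + 16 * K\<^sup>2) * (e * Q)"
  proof -
    have "4 * w * e * (- (n \<bullet> x) - n \<bullet> y) \<le> 4 * w * e * (X + Y)" using nx we by (intro mult_left_mono) auto
    then have "- (4 * w * e * (n \<bullet> x)) - 4 * w * e * (n \<bullet> y) \<le> 4 * w * e * (X + Y)" by (simp only: right_diff_distrib mult_minus_right)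
    moreover have "4 * w * e * (X + Y) \<le> 4 * (2 * k) * e * (X + Y)" using w e X by (intro mult_right_mono) auto
    moreover have "0 \<le> 4 * e\<^sup>2 * X\<^sup>2" by simp
    ultimately have d: "q \<bullet> q - p \<bullet> p \<le> 8 * k * e * (X + Y) + 4 * e\<^sup>2 * Y\<^sup>2"
      unfolding pp qq by linarith
    have r0: "0 \<le> 8 * k * e * (X + Y) + 4 * e\<^sup>2 * Y\<^sup>2" using k e X by simp
    have "\<theta>y * (q \<bullet> q - p \<bullet> p) \<le> \<theta>y * (8 * k * e * (X + Y) + 4 * e\<^sup>2 * Y\<^sup>2)" using d \<theta> by (intro mult_left_mono) auto
    also have "\<dots> \<le> (2 * K * (1 + Y)) * (8 * k * e * (X + Y) + 4 * e\<^sup>2 * Y\<^sup>2)" using r0 \<theta> by (intro mult_right_mono) (auto simp: Y_def)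
    \<comment> \<open>The last product is cubic in \<open>Y\<close>; separating the factor
      \<open>e * (1 + Y)\<close>, which is at most \<open>2 * K\<close>, reduces it to a multiple of
      the penalty.\<close>
    also have "\<dots> = (16 * k * K * e) * ((1 + Y) * (X + Y)) + (8 * K * e * Y\<^sup>2) * (e * (1 + Y))"
      by (simp add: algebra_simps power2_eq_square)
    also have "\<dots> \<le> (16 * k * K * e) * (2 * Q) + (8 * K * e * Q) * (2 * K)"
    proof (rule add_mono)
      show "(16 * k * K * e) * ((1 + Y) * (X + Y)) \<le> (16 * k * K * e) * (2 * Q)"
        using sb k K e by (intro mult_left_mono) auto
      have "8 * K * e * Y\<^sup>2 \<le> 8 * K * e * Q" using K e by (intro mult_left_mono) (auto simp: Q_def)
      then show "(8 * K * e * Y\<^sup>2) * (e * (1 + Y)) \<le> (8 * K * e * Q) * (2 * K)"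
        by (rule mult_mono) (use eK K e X in \<open>auto simp: Y_def Q_def\<close>)
    qed
    finally show ?thesis by (simp add: algebra_simps power2_eq_square)
  qed
  have "\<theta>y * (q \<bullet> q) - \<theta>x * (p \<bullet> p) = - (\<theta>x - \<theta>y) * (p \<bullet> p) + \<theta>y * (q \<bullet> q - p \<bullet> p)" by (simp add: algebra_simps)
  then show ?thesis using A B by (simp add: Q_def X_def Y_def algebra_simps)
qed

text \<open>Two-point maximum principle: at a first touching of the modulus, second variations in the
  reflecting direction along \<open>x - y\<close> and in the parallel direction across it are compared.\<close>
lemma two_point_estimate:
  fixes \<psi> r :: "real \<Rightarrow> pt \<Rightarrow> real" and v P :: "real \<Rightarrow> pt \<Rightarrow> pt" and Q :: "real \<Rightarrow> pt \<Rightarrow> pt \<Rightarrow> pt"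
  assumes nu: "\<nu> > 0"
    and cont: "continuous_on ({0..T} \<times> UNIV) (\<lambda>(t, x). \<psi> t x)"
    and ge1: "\<And>t x. t \<in> {0..T} \<Longrightarrow> \<psi> t x \<ge> 1"
    and growth: "\<And>t x. t \<in> {0..T} \<Longrightarrow> \<psi> t x \<le> K * (1 + norm x)"
    and grad: "\<And>t x. t \<in> {0<..T} \<Longrightarrow> (\<psi> t has_derivative (\<lambda>h. P t x \<bullet> h)) (at x)"
    and hess: "\<And>t x. t \<in> {0<..T} \<Longrightarrow> (P t has_derivative Q t x) (at x)"
    and time: "\<And>t x. t \<in> {0<..T} \<Longrightarrow> ((\<lambda>s. \<psi> s x) has_real_derivative
       (\<nu> * (tr2 (Q t x) - (2 * \<psi> t x - 1 / \<psi> t x) * (P t x \<bullet> P t x)) - v t x \<bullet> P t x + r t x)) (at t)"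
    and r: "\<And>t x y. t \<in> {0<..T} \<Longrightarrow> \<psi> t y \<le> \<psi> t x \<Longrightarrow> r t x \<le> r t y"
    and v: "\<And>t x. t \<in> {0<..T} \<Longrightarrow> norm (v t x) \<le> W / sqrt (1 + t)" and W: "W \<ge> 0"
    and init: "\<And>x y. \<psi> 0 x - \<psi> 0 y \<le> k * norm (x - y)" and k: "k > 0"
    and b: "b > 0" "\<nu> * b \<ge> 4 * W" "2 * \<nu> * k\<^sup>2 - 1 \<ge> 4 * W * b"
    and t: "t \<in> {0..T}"
  shows "\<psi> t x - \<psi> t y \<le> k * modulus b (norm (x - y) / sqrt (1 + t))"
proof (rule field_le_epsilon)
  fix \<epsilon> :: real assume "\<epsilon> > 0"
  define \<omega> where "\<omega> s d = k * modulus b (d / sqrt (1 + s))" for s d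
  define q where "q p = 2 + fst p \<bullet> fst p + snd p \<bullet> snd p" for p :: "pt \<times> pt"
  have q2: "q p \<ge> 2" for p by (simp add: q_def)
  have K1: "K \<ge> 1" using ge1[OF t, of 0] growth[OF t, of 0] by simp
  \<comment> \<open>Collects the coefficients of all penalty errors: second derivatives, absorption,
    drift. The additional 1 leaves \<open>L * E \<le> (L - 1) * E\<close> as the
    contradiction.\<close>
  define L where "L = 4 * \<nu> + \<nu> * (64 * k * K + 16 * K\<^sup>2) + 2 * W + 1"
  have L1: "L \<ge> 1" using nu k K1 W by (simp add: L_def)
  \<comment> \<open>Makes the penalty at the target pair and time equal to
    \<open>\<epsilon>\<close>.\<close>
  define e where "e = \<epsilon> / (exp (L * t) * q (x, y))"
  have e: "e > 0" using \<open>\<epsilon> > 0\<close> q2[of "(x, y)"] by (simp add: e_def)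
  define Z where "Z s p = \<psi> s (fst p) - \<psi> s (snd p) - \<omega> s (norm (fst p - snd p)) - e * exp (L * s) * q p" for s p
  have \<omega>0: "\<omega> s d \<ge> 0" if "s \<ge> 0" "d \<ge> 0" for s d
    using modulus_bounds(1)[OF b(1), of "d / sqrt (1 + s)"] that k by (auto simp: \<omega>_def intro!: mult_nonneg_nonneg order_trans[OF _ modulus_bounds(1)[OF b(1)]])
  have "Z t (x, y) < 0"
  proof (rule ccontr)
    assume "\<not> Z t (x, y) < 0"
    then have bad: "Z t (x, y) \<ge> 0" by simp
    have Zc: "continuous_on ({0..T} \<times> UNIV) (\<lambda>(s, p). Z s p)"
    proof -
      have c1: "continuous_on ({0..T} \<times> UNIV) (\<lambda>z::real \<times> pt \<times> pt. (\<lambda>(t, x). \<psi> t x) (fst z, fst (snd z)))"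
        by (rule continuous_on_compose2[OF cont]) (auto intro!: continuous_intros)
      have c2: "continuous_on ({0..T} \<times> UNIV) (\<lambda>z::real \<times> pt \<times> pt. (\<lambda>(t, x). \<psi> t x) (fst z, snd (snd z)))"
        by (rule continuous_on_compose2[OF cont]) (auto intro!: continuous_intros)
      have mc: "continuous_on {0..} (modulus b)"
        unfolding modulus_def using b by (intro continuous_intros) (auto simp: add_nonneg_eq_0_iff)
      have c3: "continuous_on ({0..T} \<times> UNIV) (\<lambda>z::real \<times> pt \<times> pt. modulus b (norm (fst (snd z) - snd (snd z)) / sqrt (1 + fst z)))"
        by (rule continuous_on_compose2[OF mc]) (auto intro!: continuous_intros)
      show ?thesis unfolding Z_def \<omega>_def q_def case_prod_beta
        using c1 c2 c3 by (auto intro!: continuous_intros)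
    qed
    have Z0: "Z 0 p < 0" for p
    proof -
      have "k * norm (fst p - snd p) \<le> \<omega> 0 (norm (fst p - snd p))"
        using modulus_bounds(1)[OF b(1)] k by (simp add: \<omega>_def)
      moreover have "e * q p > 0" using e q2[of p] by (intro mult_pos_pos) auto
      ultimately show ?thesis using init[of "fst p" "snd p"] by (simp add: Z_def)
    qed
    \<comment> \<open>The second point and the modulus enter with a favourable sign, so only the
      linear growth of \<open>\<psi>\<close> at the first point has to be beaten by the quadratic
      penalty.\<close>
    have Zinf: "Z s p < 0" if s: "s \<in> {0..T}" and p: "norm p > 2 * K / e + 1" for s p
    proof -
      have Ke: "2 * K / e \<ge> 0" using K1 e by simp
      have np: "(norm p)\<^sup>2 = fst p \<bullet> fst p + snd p \<bullet> snd p"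
        by (cases p) (simp add: power2_norm_eq_inner)
      have "norm (fst p) \<le> norm p" by (cases p) (simp add: norm_Pair)
      then have "\<psi> s (fst p) \<le> K * (1 + norm p)" using K1 by (intro order_trans[OF growth[OF s]] mult_left_mono) auto
      also have "\<dots> \<le> K * (2 * norm p)" using p Ke K1 by (intro mult_left_mono) auto
      also have "\<dots> \<le> (e * norm p) * norm p"
      proof -
        have "2 * K / e \<le> norm p" using p by simp
        then have "2 * K \<le> e * norm p" using e by (simp add: field_simps)
        then have "2 * K * norm p \<le> (e * norm p) * norm p" by (intro mult_right_mono) auto
        then show ?thesis by simp
      qed
      also have "\<dots> = e * (norm p)\<^sup>2" by (simp add: power2_eq_square)
      also have "\<dots> \<le> e * q p" using e by (simp add: np q_def)
      also have "\<dots> \<le> e * exp (L * s) * q p"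
        using e q2[of p] s L1 mult_right_mono[of 1 "exp (L * s)" "e * q p"] by (simp add: mult_ac)
      finally have "\<psi> s (fst p) \<le> e * exp (L * s) * q p" .
      then show ?thesis using ge1[OF s, of "snd p"] \<omega>0[of s "norm (fst p - snd p)"] s by (simp add: Z_def)
    qed
    obtain t0 p0 where t0: "t0 \<in> {0<..T}" "Z t0 p0 = 0" "\<And>p. Z t0 p \<le> 0" "\<And>s. s \<in> {0..<t0} \<Longrightarrow> Z s p0 < 0"
      using first_contact[OF Zc Z0 Zinf t bad] by metis
    obtain a c where p0: "p0 = (a, c)" by (cases p0)
    define \<tau> where "\<tau> = sqrt (1 + t0)"
    have \<tau>: "\<tau> \<ge> 1" "\<tau> > 0" "\<tau>\<^sup>2 = 1 + t0" using t0(1) by (auto simp: \<tau>_def)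
    define e' where "e' = e * exp (L * t0)"
    have e': "e' > 0" using e by (simp add: e'_def)
    have t0T: "t0 \<in> {0..T}" using t0(1) by auto
    have contact: "\<psi> t0 a - \<psi> t0 c = \<omega> t0 (norm (a - c)) + e' * q (a, c)"
      using t0(2) by (simp add: Z_def p0 e'_def)
    have eq0: "e' * q (a, c) > 0" using e' q2[of "(a, c)"] by (intro mult_pos_pos) auto
    \<comment> \<open>On the diagonal the modulus and the difference vanish but the penalty is
      positive. Off the diagonal the distance is differentiable.\<close>
    have "a \<noteq> c"
    proof
      assume "a = c"
      then have "e' * q (a, c) = 0" using contact by (simp add: \<omega>_def modulus_def)
      then show False using eq0 by linarith
    qed
    define d where "d = norm (a - c)"
    have d: "d > 0" using \<open>a \<noteq> c\<close> by (simp add: d_def)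
    define n where "n = (1 / d) *\<^sub>R (a - c)"
    have ac: "a - c = d *\<^sub>R n" using d by (simp add: n_def)
    have nn: "n \<bullet> n = 1" using d by (simp add: n_def power2_norm_eq_inner[symmetric] d_def power2_eq_square)
    define s0 where "s0 = d / \<tau>"
    have s0: "s0 > 0" using d \<tau> by (simp add: s0_def)
    define w where "w = k * modulus' b s0 / \<tau>"
    note mb = modulus_bounds[OF b(1) less_imp_le[OF s0]]
    have om: "(\<omega> t0 has_real_derivative k * modulus' b (z / \<tau>) / \<tau>) (at z)"
      and om': "((\<lambda>z. k * modulus' b (z / \<tau>) / \<tau>) has_real_derivative k * modulus'' b (z / \<tau>) / \<tau>\<^sup>2) (at z)" if z: "z > 0" for z
    proof -
      have z': "1 + b * (z / \<tau>) > 0" using z b(1) \<tau> by (auto intro!: add_pos_nonneg)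
      have l: "((\<lambda>z. z / \<tau>) has_real_derivative 1 / \<tau>) (at z)" using \<tau> by (auto intro!: derivative_eq_intros)
      show "(\<omega> t0 has_real_derivative k * modulus' b (z / \<tau>) / \<tau>) (at z)"
        unfolding \<omega>_def[abs_def] \<tau>_def[symmetric]
        using DERIV_cmult[OF DERIV_chain2[OF modulus_deriv(1)[OF z'] l], of k] by simp
      show "((\<lambda>z. k * modulus' b (z / \<tau>) / \<tau>) has_real_derivative k * modulus'' b (z / \<tau>) / \<tau>\<^sup>2) (at z)"
        using DERIV_cmult[OF DERIV_chain2[OF modulus_deriv(2)[OF z'] l], of "k / \<tau>"] by (simp add: power2_eq_square)
    qed
    \<comment> \<open>At fixed distance the modulus shrinks as the scale grows; this is the price of
      the decay \<open>1 / sqrt (1 + t)\<close>.\<close>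
    have om_time: "((\<lambda>s. \<omega> s d) has_real_derivative - (k * modulus' b s0 * s0 / (2 * \<tau>\<^sup>2))) (at t0)"
    proof -
      have z': "1 + b * (d / sqrt (1 + t0)) > 0"
        using mult_pos_pos[OF b(1) s0] unfolding s0_def \<tau>_def by linarith
      have l: "((\<lambda>s. d / sqrt (1 + s)) has_real_derivative - (s0 / (2 * \<tau>\<^sup>2))) (at t0)"
        using t0(1) \<tau> unfolding s0_def \<tau>_def
        by (auto intro!: derivative_eq_intros simp: field_simps power2_eq_square)
      show ?thesis unfolding \<omega>_def
        using DERIV_cmult[OF DERIV_chain2[OF modulus_deriv(1)[OF z'] l], of k] by (simp add: s0_def \<tau>_def mult_ac)
    qed
    have gradl: "((\<lambda>s. \<psi> t0 (x + s *\<^sub>R h)) has_real_derivative P t0 (x + s *\<^sub>R h) \<bullet> h) (at s)" for x h s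
      by (rule has_real_derivative_along_line[OF grad[OF t0(1)]])
    have hessl: "((\<lambda>s. P t0 (x + s *\<^sub>R h) \<bullet> h) has_real_derivative Q t0 x h \<bullet> h) (at 0)" for x h
      by (rule has_real_derivative_grad_along_line) (use hess[OF t0(1)] in simp)
    have ql: "((\<lambda>s. q (a + s *\<^sub>R g, c + s *\<^sub>R h)) has_real_derivative 2 * ((a + s *\<^sub>R g) \<bullet> g) + 2 * ((c + s *\<^sub>R h) \<bullet> h)) (at s)" for g h s
      unfolding q_def by (auto intro!: derivative_eq_intros simp: has_field_derivative_def inner_commute algebra_simps)
    have dl: "((\<lambda>s. (x + s *\<^sub>R h) \<bullet> h) has_real_derivative h \<bullet> h) (at s)" for x h :: pt and s
      by (auto intro!: derivative_eq_intros simp: has_field_derivative_def algebra_simps)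
    have Zle: "Z t0 (a + s *\<^sub>R g, c + s *\<^sub>R h) \<le> Z t0 (a + 0 *\<^sub>R g, c + 0 *\<^sub>R h)" for s g h
      using t0(2,3) by (simp add: p0)
    have Zt: "Z t0 (x, y) = \<psi> t0 x - \<psi> t0 y - \<omega> t0 (norm (x - y)) - e' * q (x, y)" for x y
      by (simp add: Z_def e'_def)
    \<comment> \<open>Criticality under independent displacements of both points: up to penalty
      terms both gradients equal \<open>w *\<^sub>R n\<close>.\<close>
    have first: "P t0 a \<bullet> g - P t0 c \<bullet> h - w * (n \<bullet> (g - h)) - e' * (2 * (a \<bullet> g) + 2 * (c \<bullet> h)) = 0" for g h
    proof -
      have "((\<lambda>z. norm z) has_derivative (\<lambda>h. n \<bullet> h)) (at (a - c + 0 *\<^sub>R (g - h)))"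
        using has_derivative_norm[of "a - c"] \<open>a \<noteq> c\<close> by (simp add: sgn_div_norm n_def d_def divide_inverse inner_commute)
      from has_real_derivative_along_line[OF this]
      have nd: "((\<lambda>s. norm (a - c + s *\<^sub>R (g - h))) has_real_derivative n \<bullet> (g - h)) (at 0)" .
      have "((\<lambda>s. \<omega> t0 (norm (a - c + s *\<^sub>R (g - h)))) has_real_derivative w * (n \<bullet> (g - h))) (at 0)"
        by (rule DERIV_chain2[OF _ nd]) (use om[OF d] in \<open>simp add: w_def s0_def flip: d_def\<close>)
      then have nd': "((\<lambda>s. \<omega> t0 (norm ((a + s *\<^sub>R g) - (c + s *\<^sub>R h)))) has_real_derivative w * (n \<bullet> (g - h))) (at 0)"
        by (simp add: algebra_simps)
      have "((\<lambda>s. Z t0 (a + s *\<^sub>R g, c + s *\<^sub>R h)) has_real_derivative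
          (P t0 (a + 0 *\<^sub>R g) \<bullet> g - P t0 (c + 0 *\<^sub>R h) \<bullet> h - w * (n \<bullet> (g - h)) - e' * (2 * ((a + 0 *\<^sub>R g) \<bullet> g) + 2 * ((c + 0 *\<^sub>R h) \<bullet> h)))) (at 0)"
        unfolding Zt by (intro DERIV_diff gradl nd' DERIV_cmult ql)
      from DERIV_local_max[OF this zero_less_one] Zle show ?thesis by simp
    qed
    have Pa: "P t0 a = w *\<^sub>R n + (2 * e') *\<^sub>R a"
    proof -
      have "(P t0 a - (w *\<^sub>R n + (2 * e') *\<^sub>R a)) \<bullet> g = 0" for g
        using first[of g 0] by (simp add: inner_diff_left inner_add_left)
      from this[of "P t0 a - (w *\<^sub>R n + (2 * e') *\<^sub>R a)"] show ?thesis by simp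
    qed
    have Pc: "P t0 c = w *\<^sub>R n - (2 * e') *\<^sub>R c"
    proof -
      have "(P t0 c - (w *\<^sub>R n - (2 * e') *\<^sub>R c)) \<bullet> h = 0" for h
        using first[of 0 h] by (simp add: inner_diff_left inner_diff_right)
      from this[of "P t0 c - (w *\<^sub>R n - (2 * e') *\<^sub>R c)"] show ?thesis by simp
    qed
    \<comment> \<open>Moving the points apart symmetrically makes the distance
      \<open>d + 2 * s\<close>, so the second derivative of the modulus appears with factor
      4.\<close>
    have second1: "Q t0 a n \<bullet> n - Q t0 c n \<bullet> n - 4 * (k * modulus'' b s0 / \<tau>\<^sup>2) - 4 * e' \<le> 0"
    proof -
      define Z1 where "Z1 s = P t0 (a + s *\<^sub>R n) \<bullet> n - P t0 (c + s *\<^sub>R (- n)) \<bullet> (- n) - (k * modulus' b ((d + 2 * s) / \<tau>) / \<tau>) * 2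
           - e' * (2 * ((a + s *\<^sub>R n) \<bullet> n) + 2 * ((c + s *\<^sub>R (- n)) \<bullet> (- n)))" for s
      have d2: "((\<lambda>s. d + 2 * s) has_real_derivative 2) (at s)" for s
        by (auto intro!: derivative_eq_intros)
      have nrm: "norm ((a + s *\<^sub>R n) - (c + s *\<^sub>R (- n))) = d + 2 * s" if "\<bar>s\<bar> < d / 2" for s
      proof -
        have "(a + s *\<^sub>R n) - (c + s *\<^sub>R (- n)) = (a - c) + (2 * s) *\<^sub>R n" by (simp add: algebra_simps scaleR_2 flip: scaleR_scaleR)
        also have "\<dots> = (d + 2 * s) *\<^sub>R n" unfolding ac by (simp add: scaleR_add_left)
        finally have "(a + s *\<^sub>R n) - (c + s *\<^sub>R (- n)) = (d + 2 * s) *\<^sub>R n" .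
        moreover have "d + 2 * s > 0" using that by linarith
        moreover have "norm n = 1" using nn by (simp add: norm_eq_1)
        ultimately show ?thesis by simp
      qed
      have 1: "((\<lambda>s. Z t0 (a + s *\<^sub>R n, c + s *\<^sub>R (- n))) has_real_derivative Z1 s) (at s)" if s: "\<bar>s\<bar> < d / 2" for s
      proof -
        have "((\<lambda>s. \<omega> t0 (d + 2 * s)) has_real_derivative (k * modulus' b ((d + 2 * s) / \<tau>) / \<tau>) * 2) (at s)"
          by (rule DERIV_chain2[OF om d2]) (use s in auto)
        then have "((\<lambda>s. \<psi> t0 (a + s *\<^sub>R n) - \<psi> t0 (c + s *\<^sub>R (- n)) - \<omega> t0 (d + 2 * s) - e' * q (a + s *\<^sub>R n, c + s *\<^sub>R (- n))) has_real_derivative Z1 s) (at s)"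
          unfolding Z1_def by (intro DERIV_diff gradl DERIV_cmult ql)
        then show ?thesis
        proof (rule has_field_derivative_transform_within_open[of _ _ _ "{- (d / 2)<..<d / 2}"])
          fix s assume "s \<in> {- (d / 2)<..<d / 2}"
          then have "\<bar>s\<bar> < d / 2" by auto
          from nrm[OF this] show "\<psi> t0 (a + s *\<^sub>R n) - \<psi> t0 (c + s *\<^sub>R (- n)) - \<omega> t0 (d + 2 * s) - e' * q (a + s *\<^sub>R n, c + s *\<^sub>R (- n)) = Z t0 (a + s *\<^sub>R n, c + s *\<^sub>R (- n))"
            unfolding Zt by simp
        qed (use s in auto)
      qed
      have 2: "(Z1 has_real_derivative (Q t0 a n \<bullet> n - Q t0 c (- n) \<bullet> (- n) - (k * modulus'' b ((d + 2 * 0) / \<tau>) / \<tau>\<^sup>2 * 2) * 2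
           - e' * (2 * (n \<bullet> n) + 2 * ((- n) \<bullet> (- n))))) (at 0)"
        unfolding Z1_def[abs_def]
        by (intro DERIV_diff hessl DERIV_cmult DERIV_cmult_right DERIV_add dl DERIV_chain2[OF om' d2]) (use d in simp)
      have "bounded_linear (Q t0 c)" using hess[OF t0(1)] by (rule has_derivative_bounded_linear)
      then have m: "Q t0 c (- n) = - Q t0 c n" by (intro linear_neg bounded_linear.linear)
      have "Q t0 a n \<bullet> n - Q t0 c (- n) \<bullet> (- n) - (k * modulus'' b ((d + 2 * 0) / \<tau>) / \<tau>\<^sup>2 * 2) * 2
           - e' * (2 * (n \<bullet> n) + 2 * ((- n) \<bullet> (- n))) \<le> 0"
        by (rule second_derivative_test(2)[where r = "d / 2", OF _ 1 2]) (use d Zle[of _ n "- n"] in simp_all)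
      then show ?thesis by (simp add: m nn s0_def)
    qed
    define n' where "n' = perp n"
    have nn': "n' \<bullet> n' = 1" using nn by (simp add: n'_def inner_perp_self)
    \<comment> \<open>A common displacement preserves the distance, so the modulus contributes
      nothing.\<close>
    have second2: "Q t0 a n' \<bullet> n' - Q t0 c n' \<bullet> n' - 4 * e' \<le> 0"
    proof -
      define Z1 where "Z1 s = P t0 (a + s *\<^sub>R n') \<bullet> n' - P t0 (c + s *\<^sub>R n') \<bullet> n' - 0
           - e' * (2 * ((a + s *\<^sub>R n') \<bullet> n') + 2 * ((c + s *\<^sub>R n') \<bullet> n'))" for s
      have 1: "((\<lambda>s. Z t0 (a + s *\<^sub>R n', c + s *\<^sub>R n')) has_real_derivative Z1 s) (at s)" for s
      proof -
        have "((\<lambda>s. \<psi> t0 (a + s *\<^sub>R n') - \<psi> t0 (c + s *\<^sub>R n') - \<omega> t0 d - e' * q (a + s *\<^sub>R n', c + s *\<^sub>R n')) has_real_derivative Z1 s) (at s)"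
          unfolding Z1_def by (intro DERIV_diff gradl DERIV_cmult ql DERIV_const)
        then show ?thesis by (simp add: Zt d_def)
      qed
      have 2: "(Z1 has_real_derivative (Q t0 a n' \<bullet> n' - Q t0 c n' \<bullet> n' - 0 - e' * (2 * (n' \<bullet> n') + 2 * (n' \<bullet> n')))) (at 0)"
        unfolding Z1_def[abs_def] by (intro DERIV_diff hessl DERIV_cmult DERIV_add dl DERIV_const)
      have "Q t0 a n' \<bullet> n' - Q t0 c n' \<bullet> n' - 0 - e' * (2 * (n' \<bullet> n') + 2 * (n' \<bullet> n')) \<le> 0"
        by (rule second_derivative_test(2)[OF zero_less_one 1 2]) (use Zle in auto)
      then show ?thesis by (simp add: nn')
    qed
    have trQ: "tr2 (Q t0 a) - tr2 (Q t0 c) \<le> 4 * (k * modulus'' b s0 / \<tau>\<^sup>2) + 8 * e'"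
    proof -
      have bl: "bounded_linear (Q t0 a)" "bounded_linear (Q t0 c)" using hess[OF t0(1)] by (auto intro: has_derivative_bounded_linear)
      show ?thesis
        using second1 second2 tr2_orthonormal[OF bl(1) nn] tr2_orthonormal[OF bl(2) nn] unfolding n'_def by linarith
    qed
    define \<psi>a \<psi>c where "\<psi>a = \<psi> t0 a" and "\<psi>c = \<psi> t0 c"
    define \<theta>a \<theta>c where "\<theta>a = 2 * \<psi>a - 1 / \<psi>a" and "\<theta>c = 2 * \<psi>c - 1 / \<psi>c"
    define X Y where "X = norm a" and "Y = norm c"
    define E where "E = e' * (2 + X\<^sup>2 + Y\<^sup>2)"
    have X: "X \<ge> 0" "Y \<ge> 0" by (auto simp: X_def Y_def)
    have Eq: "E = e' * q (a, c)" by (simp add: E_def q_def X_def Y_def power2_norm_eq_inner)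
    have E0: "E > 0" using eq0 Eq by simp
    have \<psi>1: "\<psi>a \<ge> 1" "\<psi>c \<ge> 1" "\<psi>a \<le> K * (1 + X)" "\<psi>c \<le> K * (1 + Y)"
      using ge1[OF t0T] growth[OF t0T] by (auto simp: \<psi>a_def \<psi>c_def X_def Y_def)
    have ct: "\<psi>a - \<psi>c = \<omega> t0 d + E" using contact by (simp add: \<psi>a_def \<psi>c_def Eq d_def)
    have om0: "\<omega> t0 d \<ge> 0" using \<omega>0 t0(1) d by auto
    \<comment> \<open>Since \<open>- 1 / \<psi>\<close> increases with \<open>\<psi>\<close>, it
      only widens the gap between \<open>\<theta>a\<close> and \<open>\<theta>c\<close> beyond twice
      that of \<open>\<psi>\<close>; the normalisation \<open>\<psi> \<ge> 1\<close> keeps both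
      nonnegative.\<close>
    have inv: "1 / \<psi>a \<le> 1 / \<psi>c" "0 \<le> 1 / \<psi>a" "1 / \<psi>c \<le> 1"
      using \<psi>1 ct om0 E0 by (auto intro!: divide_left_mono)
    have th: "2 * \<omega> t0 d \<le> \<theta>a - \<theta>c" "0 \<le> \<theta>a - \<theta>c" "\<theta>a - \<theta>c \<le> 2 * K * (1 + X)" "0 \<le> \<theta>c" "\<theta>c \<le> 2 * K * (1 + Y)"
      using inv \<psi>1 ct om0 E0 unfolding \<theta>a_def \<theta>c_def by linarith+
    have eK: "e' * (1 + Y) \<le> 2 * K"
      by (rule penalty_linear_bound[OF e' X]) (use K1 ct om0 \<psi>1 in \<open>auto simp: E_def\<close>)
    have w0: "0 \<le> w" "w \<le> 2 * k"
    proof -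
      show "0 \<le> w" using mb k \<tau> by (simp add: w_def)
      have "k * modulus' b s0 / \<tau> \<le> k * 2 / 1" using mb k \<tau> by (intro frac_le mult_left_mono) auto
      then show "w \<le> 2 * k" by (simp add: w_def)
    qed
    have absorb: "\<theta>c * (P t0 c \<bullet> P t0 c) - \<theta>a * (P t0 a \<bullet> P t0 a) \<le> - 2 * \<omega> t0 d * w\<^sup>2 + (64 * k * K + 16 * K\<^sup>2) * E"
      unfolding E_def X_def Y_def
      by (rule absorption_estimate[OF nn Pa Pc e' w0]) (use K1 th eK in \<open>auto simp: X_def Y_def\<close>)
    \<comment> \<open>The two drift terms are bounded separately, without comparing \<open>v\<close>
      at the two points; the cost \<open>2 * (W / \<tau>) * w\<close> has the same scaling as the
      diffusion.\<close>
    have drift: "- (v t0 a \<bullet> P t0 a) + v t0 c \<bullet> P t0 c \<le> 2 * (W / \<tau>) * w + 2 * W * E"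
    proof -
      have nn1: "norm n = 1" using nn by (simp add: norm_eq_1)
      have "norm (P t0 a) \<le> w + 2 * e' * X" "norm (P t0 c) \<le> w + 2 * e' * Y"
        unfolding Pa Pc using w0 e' nn1
        by (auto intro!: order_trans[OF norm_triangle_ineq] order_trans[OF norm_triangle_ineq4] simp: X_def Y_def)
      moreover have "norm (v t0 z) \<le> W / \<tau>" for z using v[OF t0(1), of z] by (simp add: \<tau>_def)
      moreover have "W / \<tau> \<ge> 0" using W \<tau> by simp
      ultimately have "norm (v t0 a) * norm (P t0 a) \<le> (W / \<tau>) * (w + 2 * e' * X)" "norm (v t0 c) * norm (P t0 c) \<le> (W / \<tau>) * (w + 2 * e' * Y)"
        by (blast intro: mult_mono norm_ge_zero)+
      then have "- (v t0 a \<bullet> P t0 a) + v t0 c \<bullet> P t0 c \<le> (W / \<tau>) * (w + 2 * e' * X) + (W / \<tau>) * (w + 2 * e' * Y)"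
        using Cauchy_Schwarz_ineq2[of "v t0 a" "P t0 a"] Cauchy_Schwarz_ineq2[of "v t0 c" "P t0 c"] by linarith
      also have "\<dots> = 2 * (W / \<tau>) * w + (W / \<tau>) * (2 * e' * (X + Y))" by (simp add: algebra_simps)
      also have "(W / \<tau>) * (2 * e' * (X + Y)) \<le> W * (2 * E)"
      proof (rule mult_mono)
        show "W / \<tau> \<le> W" using W \<tau> divide_left_mono[of 1 \<tau> W] by simp
        show "2 * e' * (X + Y) \<le> 2 * E"
          using mult_left_mono[OF square_sum_bounds(3)[OF X], of "2 * e'"] e' by (simp add: E_def)
      qed (use W e' X in auto)
      finally show ?thesis by simp
    qed
    have react: "r t0 a \<le> r t0 c"
      by (rule r[OF t0(1)]) (use ct om0 E0 in \<open>simp add: \<psi>a_def \<psi>c_def\<close>)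
    have "((\<lambda>s. Z s p0) has_real_derivative
        (\<nu> * (tr2 (Q t0 a) - \<theta>a * (P t0 a \<bullet> P t0 a)) - v t0 a \<bullet> P t0 a + r t0 a)
        - (\<nu> * (tr2 (Q t0 c) - \<theta>c * (P t0 c \<bullet> P t0 c)) - v t0 c \<bullet> P t0 c + r t0 c)
        - - (k * modulus' b s0 * s0 / (2 * \<tau>\<^sup>2)) - L * E) (at t0)"
    proof -
      have "((\<lambda>s. e * exp (L * s) * q (a, c)) has_real_derivative L * E) (at t0)"
        unfolding Eq e'_def by (auto intro!: derivative_eq_intros)
      then show ?thesis
        using om_time time[OF t0(1), of a] time[OF t0(1), of c]
        unfolding Z_def p0 fst_conv snd_conv \<theta>a_def \<theta>c_def \<psi>a_def \<psi>c_def d_def by (intro DERIV_diff)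
    qed
    then have "0 \<le> (\<nu> * (tr2 (Q t0 a) - \<theta>a * (P t0 a \<bullet> P t0 a)) - v t0 a \<bullet> P t0 a + r t0 a)
        - (\<nu> * (tr2 (Q t0 c) - \<theta>c * (P t0 c \<bullet> P t0 c)) - v t0 c \<bullet> P t0 c + r t0 c)
        - - (k * modulus' b s0 * s0 / (2 * \<tau>\<^sup>2)) - L * E"
      by (rule DERIV_nonneg_left) (use t0 in \<open>auto simp: less_imp_le\<close>)
    then have "L * E \<le> \<nu> * (tr2 (Q t0 a) - tr2 (Q t0 c)) + \<nu> * (\<theta>c * (P t0 c \<bullet> P t0 c) - \<theta>a * (P t0 a \<bullet> P t0 a))
        + (- (v t0 a \<bullet> P t0 a) + v t0 c \<bullet> P t0 c) + k * modulus' b s0 * s0 / (2 * \<tau>\<^sup>2)"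
      using react by (simp add: algebra_simps)
    also have "\<dots> \<le> \<nu> * (4 * (k * modulus'' b s0 / \<tau>\<^sup>2) + 8 * e') + \<nu> * (- 2 * \<omega> t0 d * w\<^sup>2 + (64 * k * K + 16 * K\<^sup>2) * E)
        + (2 * (W / \<tau>) * w + 2 * W * E) + k * modulus' b s0 * s0 / (2 * \<tau>\<^sup>2)"
      by (rule add_mono[OF add_mono[OF add_mono[OF mult_left_mono[OF trQ] mult_left_mono[OF absorb]] drift] order_refl]) (use nu in auto)
    \<comment> \<open>Every term free of the penalty scales like \<open>k / \<tau>^2\<close>; what
      remains is the expression of \<open>modulus_supersolution\<close> at
      \<open>s0\<close>.\<close>
    also have "\<dots> = (k / \<tau>\<^sup>2) * (4 * \<nu> * modulus'' b s0 - 2 * \<nu> * k\<^sup>2 * modulus b s0 * (modulus' b s0)\<^sup>2 + 2 * W * modulus' b s0 + modulus' b s0 * s0 / 2)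
        + (8 * \<nu> * e' + \<nu> * (64 * k * K + 16 * K\<^sup>2) * E + 2 * W * E)"
    proof -
      have o: "\<omega> t0 d = k * modulus b s0" by (simp add: \<omega>_def s0_def \<tau>_def)
      show ?thesis unfolding o w_def using \<tau>(2) by (simp add: field_simps power2_eq_square)
    qed
    also have "\<dots> \<le> 0 + (4 * \<nu> * E + \<nu> * (64 * k * K + 16 * K\<^sup>2) * E + 2 * W * E)"
    proof (rule add_mono)
      show "(k / \<tau>\<^sup>2) * (4 * \<nu> * modulus'' b s0 - 2 * \<nu> * k\<^sup>2 * modulus b s0 * (modulus' b s0)\<^sup>2 + 2 * W * modulus' b s0 + modulus' b s0 * s0 / 2) \<le> 0"
        using modulus_supersolution[OF b(1) less_imp_le[OF s0] b(2,3) nu W] k by (intro mult_nonneg_nonpos) auto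
      have "2 * e' \<le> E" using e' q2[of "(a, c)"] by (simp add: Eq)
      then have "4 * \<nu> * (2 * e') \<le> 4 * \<nu> * E" using nu by (intro mult_left_mono) auto
      then show "8 * \<nu> * e' + \<nu> * (64 * k * K + 16 * K\<^sup>2) * E + 2 * W * E \<le> 4 * \<nu> * E + \<nu> * (64 * k * K + 16 * K\<^sup>2) * E + 2 * W * E" by simp
    qed
    also have "\<dots> = (L - 1) * E" by (simp add: L_def algebra_simps)
    finally show False using E0 by (simp add: algebra_simps)
  qed
  then have "\<psi> t x - \<psi> t y < \<omega> t (norm (x - y)) + e * exp (L * t) * q (x, y)" by (simp add: Z_def)
  also have "e * exp (L * t) * q (x, y) = \<epsilon>" using q2[of "(x, y)"] by (simp add: e_def)
  finally show "\<psi> t x - \<psi> t y \<le> k * modulus b (norm (x - y) / sqrt (1 + t)) + \<epsilon>" by (simp add: \<omega>_def)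
qed

subsection \<open>The gradient estimate\<close>

text \<open>Moving in the direction of the gradient itself makes the one-sided bound sufficient: the
  difference quotient tends to \<open>g \<bullet> g\<close>.\<close>

lemma norm_gradient_le_lipschitz:
  fixes f :: "'a::real_inner \<Rightarrow> real"
  assumes d: "(f has_derivative (\<lambda>h. g \<bullet> h)) (at x)" and l: "\<And>y. f y - f x \<le> B * norm (y - x)"
    and B: "B \<ge> 0"
  shows "norm g \<le> B"
proof (cases "g = 0")
  case False
  have "((\<lambda>s. f (x + s *\<^sub>R g)) has_real_derivative g \<bullet> g) (at 0)"
    by (rule has_real_derivative_along_line) (use d in simp)
  then have "((\<lambda>s. (f (x + s *\<^sub>R g) - f x) / s) \<longlongrightarrow> g \<bullet> g) (at 0)"
    by (simp add: DERIV_def)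
  then have "((\<lambda>s. (f (x + s *\<^sub>R g) - f x) / s) \<longlongrightarrow> g \<bullet> g) (at_right 0)"
    by (rule filterlim_mono) (auto simp: at_within_le_at)
  moreover have "\<forall>\<^sub>F s in at_right 0. (f (x + s *\<^sub>R g) - f x) / s \<le> B * norm g"
  proof -
    have "(f (x + s *\<^sub>R g) - f x) / s \<le> B * norm g" if "s > 0" for s
      using l[of "x + s *\<^sub>R g"] that by (simp add: divide_simps mult_ac)
    then show ?thesis by (auto simp: eventually_at_filter)
  qed
  ultimately have "g \<bullet> g \<le> B * norm g" by (rule tendsto_upperbound) simp
  then have "norm g * norm g \<le> B * norm g" by (simp add: power2_norm_eq_inner[symmetric] power2_eq_square)
  then show ?thesis using False by simp
qed (use B in simp)

lemma sqrt_log_deriv: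
  fixes c r :: real
  assumes "r > 0" "c - ln r \<ge> 1"
  shows "((\<lambda>r. sqrt (c - ln r)) has_real_derivative - 1 / (2 * (r * sqrt (c - ln r)))) (at r)"
  using assms by (auto intro!: derivative_eq_intros simp: field_simps)

lemma one_plus_square_le: "(1 + X)\<^sup>2 \<le> 2 * (1 + X\<^sup>2)" for X :: real
  using sum_squares_bound[of X 1] by (simp add: power2_sum)

section \<open>Equation and Lipschitz estimate for the square root of the shifted logarithm\<close>

context limit_solution
begin

context
  fixes c :: real and \<psi> :: "real \<Rightarrow> pt \<Rightarrow> real" and P :: "real \<Rightarrow> pt \<Rightarrow> pt" and Q :: "real \<Rightarrow> pt \<Rightarrow> pt \<Rightarrow> pt"
  defines "\<psi> \<equiv> \<lambda>t x. sqrt (c - ln (\<rho> t x))"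
    and "P \<equiv> \<lambda>t x. (- 1 / (2 * (\<rho> t x * \<psi> t x))) *\<^sub>R G t x"
    and "Q \<equiv> \<lambda>t x h. (- 1 / (2 * (\<rho> t x * \<psi> t x))) *\<^sub>R H t x h + (((2 * \<psi> t x - 1 / \<psi> t x) *\<^sub>R P t x) \<bullet> h) *\<^sub>R P t x"
  assumes pos: "\<And>t x. t \<ge> 0 \<Longrightarrow> \<rho> t x > 0" and le: "\<And>t x. t \<ge> 0 \<Longrightarrow> c - ln (\<rho> t x) \<ge> 1"
begin

lemma psi_ge_1: "t \<ge> 0 \<Longrightarrow> \<psi> t x \<ge> 1"
  using le[of t x] by (simp add: \<psi>_def)

lemma psi_grad:
  assumes t: "t \<ge> 0" shows "(\<psi> t has_derivative (\<lambda>h. P t x \<bullet> h)) (at x)"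
  using has_derivative_compose[OF grad[OF t] sqrt_log_deriv[OF pos[OF t] le[OF t], unfolded has_field_derivative_def]]
  by (simp add: \<psi>_def P_def)

text \<open>With \<open>m = \<rho> * \<psi>\<close> one has \<open>G = - 2 * m * P\<close>, so
  differentiating the prefactor \<open>- 1 / (2 * m)\<close> of \<open>P\<close> leaves a rank-one
  term in \<open>P\<close>, with coefficient \<open>2 * \<psi> - 1 / \<psi>\<close>.\<close>

lemma psi_hess:
  assumes t: "t > 0" shows "(P t has_derivative Q t x) (at x)"
proof -
  have t0: "t \<ge> 0" using t by simp
  define m where "m y = \<rho> t y * \<psi> t y" for y
  have m0: "m y > 0" for y using pos[OF t0, of y] psi_ge_1[OF t0, of y] by (simp add: m_def)
  have \<psi>0: "\<psi> t x > 0" using psi_ge_1[OF t0, of x] by simp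
  have GP: "G t x = (- 2 * m x) *\<^sub>R P t x"
    using m0[of x] by (simp add: P_def m_def[symmetric])
  have "(m has_derivative (\<lambda>h. \<rho> t x * (P t x \<bullet> h) + (G t x \<bullet> h) * \<psi> t x)) (at x)"
    unfolding m_def[abs_def] by (rule has_derivative_mult[OF grad[OF t0] psi_grad[OF t0]])
  then have "((\<lambda>y. - 1 / (2 * m y)) has_derivative (\<lambda>h. (\<rho> t x * (P t x \<bullet> h) + (G t x \<bullet> h) * \<psi> t x) / (2 * (m x)\<^sup>2))) (at x)"
    using m0[of x] by (auto intro!: derivative_eq_intros simp: power2_eq_square field_simps)
  from has_derivative_scaleR[OF this hess[OF t]]
  have "(P t has_derivative (\<lambda>h. (- 1 / (2 * m x)) *\<^sub>R H t x h + ((\<rho> t x * (P t x \<bullet> h) + (G t x \<bullet> h) * \<psi> t x) / (2 * (m x)\<^sup>2)) *\<^sub>R G t x)) (at x)"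
    unfolding P_def m_def .
  moreover have "((\<rho> t x * (P t x \<bullet> h) + (G t x \<bullet> h) * \<psi> t x) / (2 * (m x)\<^sup>2)) *\<^sub>R G t x
      = (((2 * \<psi> t x - 1 / \<psi> t x) *\<^sub>R P t x) \<bullet> h) *\<^sub>R P t x" for h
  proof -
    have "((\<rho> t x * (P t x \<bullet> h) + (- 2 * m x * (P t x \<bullet> h)) * \<psi> t x) / (2 * (m x)\<^sup>2)) * (- 2 * m x) = (2 * \<psi> t x - 1 / \<psi> t x) * (P t x \<bullet> h)"
      using m0[of x] \<psi>0 pos[OF t0, of x] by (simp add: m_def field_simps power2_eq_square)
    then show ?thesis unfolding GP by (simp only: inner_scaleR_left scaleR_scaleR)
  qed
  ultimately show ?thesis unfolding Q_def m_def[symmetric] by simp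
qed

text \<open>The trace of the rank-one part of \<open>Q\<close> cancels the nonlinear gradient term,
  so this is the equation for \<open>\<rho>\<close> divided by
  \<open>- 2 * \<rho> * \<psi>\<close>.\<close>

lemma psi_time:
  assumes t: "t > 0"
  shows "((\<lambda>s. \<psi> s x) has_real_derivative
     (\<nu> * (tr2 (Q t x) - (2 * \<psi> t x - 1 / \<psi> t x) * (P t x \<bullet> P t x)) - u t x \<bullet> P t x + \<rho> t x / (2 * \<psi> t x))) (at t)"
proof -
  have t0: "t \<ge> 0" using t by simp
  have p: "\<rho> t x > 0" "\<psi> t x > 0" using pos[OF t0, of x] psi_ge_1[OF t0, of x] by auto
  have "bounded_linear (H t x)" using hess[OF t] by (rule has_derivative_bounded_linear)
  then have tr: "tr2 (Q t x) = (- 1 / (2 * (\<rho> t x * \<psi> t x))) * tr2 (H t x) + (2 * \<psi> t x - 1 / \<psi> t x) * (P t x \<bullet> P t x)"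
    unfolding Q_def by (subst tr2_scaleR_sum) simp_all
  have "((\<lambda>s. \<psi> s x) has_real_derivative (- 1 / (2 * (\<rho> t x * \<psi> t x))) * \<rho>t t x) (at t)"
    using DERIV_chain2[OF sqrt_log_deriv[OF pos[OF t0] le[OF t0]] time[OF t]] by (simp add: \<psi>_def)
  moreover have "(- 1 / (2 * (\<rho> t x * \<psi> t x))) * \<rho>t t x
     = \<nu> * (tr2 (Q t x) - (2 * \<psi> t x - 1 / \<psi> t x) * (P t x \<bullet> P t x)) - u t x \<bullet> P t x + \<rho> t x / (2 * \<psi> t x)"
    unfolding tr equation[OF t] P_def using p by (simp add: field_simps power2_eq_square)
  ultimately show ?thesis by simp
qed

lemma psi_reaction_antimono:
  assumes t: "t > 0" and xy: "\<psi> t y \<le> \<psi> t x"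
  shows "\<rho> t x / (2 * \<psi> t x) \<le> \<rho> t y / (2 * \<psi> t y)"
proof -
  have t0: "t \<ge> 0" using t by simp
  have "\<rho> t x \<le> \<rho> t y" using xy pos[OF t0] by (simp add: \<psi>_def)
  then show ?thesis using xy psi_ge_1[OF t0, of y] pos[OF t0, of x] by (intro frac_le) auto
qed

lemma psi_cont: "continuous_on ({0..T} \<times> UNIV) (\<lambda>(t, x). \<psi> t x)"
proof -
  have "\<rho> (fst p) (snd p) \<noteq> 0" if "p \<in> {0..T} \<times> UNIV" for p
    using pos[of "fst p" "snd p"] that by auto
  then show ?thesis
    using rho_cont_T[of T] unfolding \<psi>_def case_prod_beta by (intro continuous_intros) auto
qed

text \<open>On the time interval up to \<open>t\<close>, \<open>\<psi>\<close> grows linearly with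
  constant \<open>sqrt D\<close>. That this constant depends on \<open>t\<close> is harmless: the
  two-point estimate uses it only to control the penalty, and its conclusion does not contain
  it.\<close>

lemma psi_lipschitz:
  assumes v: "\<And>t x. t \<ge> 0 \<Longrightarrow> norm (u t x) \<le> W / sqrt (1 + t)" and W: "W \<ge> 0"
    and growth: "\<And>t x. t \<ge> 0 \<Longrightarrow> (\<psi> t x)\<^sup>2 \<le> A0 + A1 * ln (1 + t) + a * (norm x)\<^sup>2 / (1 + t)"
    and A: "A0 \<ge> 0" "A1 \<ge> 0" "a \<ge> 0"
    and init: "\<And>x y. \<psi> 0 x - \<psi> 0 y \<le> k * norm (x - y)" and k: "k > 0"
    and b: "b > 0" "\<nu> * b \<ge> 4 * W" "2 * \<nu> * k\<^sup>2 - 1 \<ge> 4 * W * b"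
    and t: "t \<ge> 0"
  shows "\<psi> t x - \<psi> t y \<le> 2 * k / sqrt (1 + t) * norm (x - y)"
proof -
  define D where "D = A0 + A1 * ln (1 + t) + a"
  have D0: "D \<ge> 0" using A t by (simp add: D_def)
  have g: "\<psi> s z \<le> sqrt D * (1 + norm z)" if s: "s \<in> {0..t}" for s z
  proof (rule power2_le_imp_le)
    have "ln (1 + s) \<le> ln (1 + t)" using s by simp
    then have "A1 * ln (1 + s) \<le> A1 * ln (1 + t)" using A by (intro mult_left_mono) auto
    moreover have "a * (norm z)\<^sup>2 / (1 + s) \<le> a * (norm z)\<^sup>2 / 1" using s A by (intro divide_left_mono) auto
    ultimately have "(\<psi> s z)\<^sup>2 \<le> (A0 + A1 * ln (1 + t)) * 1 + a * (norm z)\<^sup>2" using growth[of s z] s by simp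
    also have "\<dots> \<le> (A0 + A1 * ln (1 + t)) * (1 + norm z)\<^sup>2 + a * (1 + norm z)\<^sup>2"
      using A t by (intro add_mono mult_left_mono power_mono) auto
    also have "\<dots> = (sqrt D * (1 + norm z))\<^sup>2" using D0 by (simp add: power_mult_distrib D_def distrib_right)
    finally show "(\<psi> s z)\<^sup>2 \<le> (sqrt D * (1 + norm z))\<^sup>2" .
    show "0 \<le> sqrt D * (1 + norm z)" using D0 by simp
  qed
  have "\<psi> t x - \<psi> t y \<le> k * modulus b (norm (x - y) / sqrt (1 + t))"
    by (rule two_point_estimate[where \<psi> = \<psi> and P = P and Q = Q and v = u and r = "\<lambda>t x. \<rho> t x / (2 * \<psi> t x)" and T = t and K = "sqrt D", OF nu psi_cont])
       (use v W init k b t psi_ge_1 psi_grad psi_hess psi_time psi_reaction_antimono g in auto)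
  also have "\<dots> \<le> k * (2 * (norm (x - y) / sqrt (1 + t)))"
    using k t modulus_bounds(2)[OF b(1), of "norm (x - y) / sqrt (1 + t)"] by (intro mult_left_mono) auto
  finally show ?thesis by (simp add: mult_ac)
qed

lemma gradient_estimate:
  assumes v: "\<And>t x. t \<ge> 0 \<Longrightarrow> norm (u t x) \<le> W / sqrt (1 + t)" and W: "W \<ge> 0"
    and growth: "\<And>t x. t \<ge> 0 \<Longrightarrow> (\<psi> t x)\<^sup>2 \<le> A0 + A1 * ln (1 + t) + a * (norm x)\<^sup>2 / (1 + t)"
    and A: "A0 \<ge> 0" "A1 \<ge> 0" "a \<ge> 0"
    and init: "\<And>x y. \<psi> 0 x - \<psi> 0 y \<le> l * norm (x - y)" and l: "l \<ge> 0"
  shows "\<exists>C>0. \<forall>t\<ge>0. \<forall>x. (norm (G t x) / \<rho> t x)\<^sup>2 \<le> C / (1 + t) * (1 + ln (1 + t) + (norm x)\<^sup>2 / (1 + t))"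
proof -
  \<comment> \<open>Chosen so that \<open>\<nu> * b \<ge> 4 * W\<close>; the 1 keeps it positive
    when \<open>W = 0\<close>.\<close>
  define b where "b = 4 * W / \<nu> + 1"
  have b0: "b > 0" using W nu by (simp add: b_def add_nonneg_pos)
  \<comment> \<open>The summand \<open>l\<close> accommodates the initial datum, the root makes the
    absorption strong enough: \<open>2 * \<nu> * k^2 \<ge> 1 + 4 * W * b\<close>.\<close>
  define k where "k = l + sqrt ((1 + 4 * W * b) / (2 * \<nu>))"
  have q0: "(1 + 4 * W * b) / (2 * \<nu>) > 0" using W b0 nu by (auto intro!: divide_pos_pos add_pos_nonneg)
  then have k0: "k > 0" using l by (simp add: k_def add_nonneg_pos)
  have b1: "\<nu> * b \<ge> 4 * W" using nu by (simp add: b_def distrib_left)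
  have k1: "2 * \<nu> * k\<^sup>2 - 1 \<ge> 4 * W * b"
  proof -
    have "(1 + 4 * W * b) / (2 * \<nu>) = (sqrt ((1 + 4 * W * b) / (2 * \<nu>)))\<^sup>2" using q0 by simp
    also have "\<dots> \<le> k\<^sup>2" using q0 l by (intro power_mono) (auto simp: k_def)
    finally show ?thesis using nu by (simp add: field_simps)
  qed
  have init': "\<psi> 0 x - \<psi> 0 y \<le> k * norm (x - y)" for x y
    using q0 by (intro order_trans[OF init] mult_right_mono) (auto simp: k_def)
  define D where "D = A0 + A1 + a"
  have D0: "D \<ge> 0" "A0 \<le> D" "A1 \<le> D" "a \<le> D" using A by (auto simp: D_def)
  \<comment> \<open>The 16 combines the 4 from \<open>(2 * \<psi>)^2\<close> with the squared
    Lipschitz constant \<open>4 * k^2 / (1 + t)\<close>; the 1 secures a positive constant when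
    \<open>D = 0\<close>.\<close>
  have "(norm (G t x) / \<rho> t x)\<^sup>2 \<le> (16 * k\<^sup>2 * D + 1) / (1 + t) * (1 + ln (1 + t) + (norm x)\<^sup>2 / (1 + t))" if t: "t \<ge> 0" for t x
  proof -
    have "norm (P t x) \<le> 2 * k / sqrt (1 + t)"
      using psi_lipschitz[OF v W growth A init' k0 b0 b1 k1 t] k0 t
      by (intro norm_gradient_le_lipschitz[OF psi_grad[OF t]]) auto
    then have P2: "(norm (P t x))\<^sup>2 \<le> 4 * k\<^sup>2 / (1 + t)"
      using power_mono[of "norm (P t x)" "2 * k / sqrt (1 + t)" 2] t by (simp add: power_divide power_mult_distrib)
    have p: "\<rho> t x > 0" "\<psi> t x > 0" using pos[OF t, of x] psi_ge_1[OF t, of x] by auto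
    have "norm (G t x) / \<rho> t x = 2 * \<psi> t x * norm (P t x)"
      using p by (simp add: P_def field_simps)
    then have "(norm (G t x) / \<rho> t x)\<^sup>2 = 4 * (\<psi> t x)\<^sup>2 * (norm (P t x))\<^sup>2"
      by (simp add: power_mult_distrib)
    also have "\<dots> \<le> 4 * (\<psi> t x)\<^sup>2 * (4 * k\<^sup>2 / (1 + t))" using P2 by (intro mult_left_mono) auto
    also have "\<dots> = (16 * k\<^sup>2 / (1 + t)) * (\<psi> t x)\<^sup>2" by simp
    also have "\<dots> \<le> (16 * k\<^sup>2 / (1 + t)) * (D * (1 + ln (1 + t) + (norm x)\<^sup>2 / (1 + t)))"
    proof (rule mult_left_mono)
      have "A1 * ln (1 + t) \<le> D * ln (1 + t)" "a * ((norm x)\<^sup>2 / (1 + t)) \<le> D * ((norm x)\<^sup>2 / (1 + t))"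
        using D0 t by (auto intro!: mult_right_mono simp del: times_divide_eq_right)
      then show "(\<psi> t x)\<^sup>2 \<le> D * (1 + ln (1 + t) + (norm x)\<^sup>2 / (1 + t))"
        using growth[OF t, of x] D0(2) by (simp add: distrib_left)
    qed (use t in simp)
    also have "\<dots> = (16 * k\<^sup>2 * D) * ((1 + ln (1 + t) + (norm x)\<^sup>2 / (1 + t)) / (1 + t))" by simp
    also have "\<dots> \<le> (16 * k\<^sup>2 * D + 1) * ((1 + ln (1 + t) + (norm x)\<^sup>2 / (1 + t)) / (1 + t))"
      using t by (intro mult_right_mono) auto
    finally show ?thesis by simp
  qed
  moreover have "16 * k\<^sup>2 * D + 1 > 0" using D0 by (simp add: add_nonneg_pos)
  ultimately show ?thesis by blast
qed

end

end

theorem theorem3p1: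
  fixes \<beta> C0 :: real and \<rho>0 :: "pt \<Rightarrow> real" and g0 :: "pt \<Rightarrow> pt"
    and H0 :: "pt \<Rightarrow> pt \<Rightarrow> pt" and \<rho> :: "real \<Rightarrow> pt \<Rightarrow> real"
  assumes beta_pos: "\<beta> > 0"
    and pos: "\<forall>x. \<rho>0 x > 0"
    and prob: "integrable lborel \<rho>0" "(\<integral>x. \<rho>0 x \<partial>lborel) = 1"
    and grad0: "\<forall>x. (\<rho>0 has_derivative (\<lambda>h. g0 x \<bullet> h)) (at x)"
    and W2inf: "\<exists>M. \<forall>x. \<bar>\<rho>0 x\<bar> \<le> M" "\<exists>M. \<forall>x. norm (g0 x) \<le> M"
               "\<exists>L. \<forall>x y. norm (g0 x - g0 y) \<le> L * norm (x - y)"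
    and W21: "\<forall>i. integrable lborel (\<lambda>x. g0 x $ i)"
             "AE x in lborel. (g0 has_derivative H0 x) (at x)"
             "\<forall>i j. integrable lborel (\<lambda>x. H0 x (axis j 1) $ i)"
    and dlog: "\<exists>c. \<forall>x. norm (g0 x) / \<rho>0 x \<le> c * (1 + norm x)"
    and d2log: "\<exists>c. AE x in lborel. \<exists>L.
                  ((\<lambda>y. (1 / \<rho>0 y) *\<^sub>R g0 y) has_derivative L) (at x) \<and>
                  onorm L \<le> c * (1 + (norm x)\<^sup>2)"
    and C0_pos: "C0 > 0"
    and gauss: "\<forall>x. \<rho>0 x \<le> C0 * exp (- (norm x)\<^sup>2 / C0)"
    and sol: "is_solution \<beta> \<rho>0 \<rho>"
  shows "\<exists>C>0. \<forall>t\<ge>0. \<forall>x. \<rho> t x > 0 \<and>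
           (\<exists>g. (\<rho> t has_derivative (\<lambda>h. g \<bullet> h)) (at x) \<and>
                (norm g / \<rho> t x)\<^sup>2 \<le> C / (1 + t) * (1 + ln (1 + t) + (norm x)\<^sup>2 / (1 + t)))"
proof -
  have \<rho>0: "\<And>x. \<rho> 0 x = \<rho>0 x" using sol unfolding is_solution_def by blast
  obtain \<rho>t G H DF where "limit_solution (1 / \<beta>) \<rho> \<rho>t G H DF"
    using sol unfolding is_solution_def
  proof (elim conjE exE, goal_cases)
    case (1 \<rho>t G H DF)
    have "limit_solution (1 / \<beta>) \<rho> \<rho>t G H DF"
    proof
      show "1 / \<beta> > 0" using beta_pos by simp
    qed (assumption | rule 1(3) 1(4-)[rule_format])+
    then show ?case by (rule 1(1))
  qed
  then interpret limit_solution "1 / \<beta>" \<rho> \<rho>t G H DF .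
  \<comment> \<open>The Gaussian bound gives \<open>C0\<close> as an upper bound;
    \<open>M \<ge> 1\<close> is needed to replace \<open>1 + M * t\<close> by \<open>1 + t\<close>
    in the decay estimate.\<close>
  define M where "M = max 1 C0"
  have M: "M \<ge> 1" "C0 \<le> M" by (auto simp: M_def)
  have \<rho>0_le: "\<rho> 0 x \<le> M" for x
  proof -
    have "C0 * exp (- (norm x)\<^sup>2 / C0) \<le> C0 * 1" using C0_pos by (intro mult_left_mono) auto
    then show ?thesis using gauss[rule_format, of x] M(2) \<rho>0[of x] by linarith
  qed
  have \<rho>0_pos: "\<rho> 0 x > 0" for x using pos \<rho>0 by simp
  have \<rho>0_mass: "(\<integral>x. \<rho> 0 x \<partial>lborel) = 1" using prob \<rho>0 by simp
  define W where "W = M + 1"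
  have W0: "W \<ge> 0" using M by (simp add: W_def)
  have drift: "norm (u t x) \<le> W / sqrt (1 + t)" if "t \<ge> 0" for t x
    unfolding W_def by (rule drift_bound[OF M(1) \<rho>0_le less_imp_le[OF \<rho>0_pos] \<rho>0_mass that])
  have upper: "\<rho> t x \<le> M / (1 + t)" if "t \<ge> 0" for t x by (rule upper_bound'[OF M(1) \<rho>0_le that])
  \<comment> \<open>As \<open>M\<close> bounds the solution at all times, this shift yields
    \<open>c - ln \<rho> \<ge> 1\<close> throughout.\<close>
  define c where "c = 1 + ln M"
  define \<psi>0 where "\<psi>0 x = sqrt (c - ln (\<rho> 0 x))" for x
  have init_sq: "c - ln (\<rho> 0 x) \<ge> 1 + (norm x)\<^sup>2 / C0" for x
  proof -
    have "ln (\<rho> 0 x) \<le> ln (C0 * exp (- (norm x)\<^sup>2 / C0))"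
      using gauss \<rho>0 \<rho>0_pos[of x] C0_pos by (subst ln_le_cancel_iff) auto
    also have "\<dots> = ln C0 - (norm x)\<^sup>2 / C0" using C0_pos by (simp add: ln_mult)
    finally have "ln (\<rho> 0 x) \<le> ln C0 - (norm x)\<^sup>2 / C0" .
    moreover have "ln C0 \<le> ln M" using M C0_pos by (intro ln_mono) auto
    ultimately show ?thesis by (simp add: c_def)
  qed
  have init_1: "c - ln (\<rho> 0 x) \<ge> 1" for x using C0_pos by (intro order_trans[OF _ init_sq]) auto
  \<comment> \<open>The Gaussian decay makes \<open>\<psi>0\<close> grow at least linearly; the
    factor 1/2 comes from \<open>(1 + X)^2 \<le> 2 * (1 + X^2)\<close>.\<close>
  define \<delta> where "\<delta> = sqrt (min 1 (1 / C0) / 2)"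
  have \<delta>: "\<delta> > 0" using C0_pos by (simp add: \<delta>_def)
  have \<psi>0_ge: "\<delta> * (1 + norm x) \<le> \<psi>0 x" for x
    unfolding \<psi>0_def
  proof (rule real_le_rsqrt)
    let ?m = "min 1 (1 / C0)"
    have m: "?m > 0" "?m \<le> 1" "?m \<le> 1 / C0" using C0_pos by auto
    have "(\<delta> * (1 + norm x))\<^sup>2 = ?m / 2 * (1 + norm x)\<^sup>2" using m by (simp add: \<delta>_def power_mult_distrib)
    also have "\<dots> \<le> ?m / 2 * (2 * (1 + (norm x)\<^sup>2))" using m one_plus_square_le by (intro mult_left_mono) auto
    also have "\<dots> = ?m * 1 + ?m * (norm x)\<^sup>2" by (simp add: distrib_left)
    also have "\<dots> \<le> 1 * 1 + (1 / C0) * (norm x)\<^sup>2" using m by (intro add_mono mult_right_mono) auto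
    finally show "(\<delta> * (1 + norm x))\<^sup>2 \<le> c - ln (\<rho> 0 x)" using init_sq[of x] by simp
  qed
  obtain c1 where c1: "\<And>x. norm (g0 x) / \<rho>0 x \<le> c1 * (1 + norm x)" using dlog by blast
  have c10: "c1 \<ge> 0"
    using order_trans[OF _ c1[of 0], of 0] pos[rule_format, of 0] by simp
  \<comment> \<open>The gradient of \<open>\<psi>0\<close> is that of \<open>log \<rho>0\<close>
    divided by \<open>2 * \<psi>0\<close> up to sign; the linear growth of the numerator cancels
    against that of the denominator.\<close>
  define l where "l = c1 / (2 * \<delta>)"
  have l0: "l \<ge> 0" using c10 \<delta> by (simp add: l_def)
  have \<psi>0_lip: "\<bar>\<psi>0 x - \<psi>0 y\<bar> \<le> l * norm (x - y)" for x y
  proof -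
    have d: "(\<psi>0 has_derivative (\<lambda>h. (- 1 / (2 * (\<rho> 0 z * \<psi>0 z))) * (g0 z \<bullet> h))) (at z)" for z
    proof -
      have eq: "\<rho> 0 = \<rho>0" using \<rho>0 by auto
      have "((\<lambda>r. sqrt (c - ln r)) has_real_derivative - 1 / (2 * (\<rho> 0 z * sqrt (c - ln (\<rho> 0 z))))) (at (\<rho> 0 z))"
        by (rule sqrt_log_deriv[OF \<rho>0_pos init_1])
      moreover have "(\<rho> 0 has_derivative (\<lambda>h. g0 z \<bullet> h)) (at z)" using grad0 eq by simp
      ultimately show ?thesis
        unfolding \<psi>0_def[abs_def] has_field_derivative_def by (rule has_derivative_compose[rotated])
    qed
    have "onorm (\<lambda>h. (- 1 / (2 * (\<rho> 0 z * \<psi>0 z))) * (g0 z \<bullet> h)) \<le> l" for z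
    proof (rule onorm_le)
      fix h
      have "\<delta> * (1 + norm z) > 0" using \<delta> by (intro mult_pos_pos add_pos_nonneg) auto
      then have p: "\<psi>0 z > 0" "\<delta> * (1 + norm z) > 0" using \<psi>0_ge[of z] by auto
      have "norm ((- 1 / (2 * (\<rho> 0 z * \<psi>0 z))) * (g0 z \<bullet> h)) = \<bar>g0 z \<bullet> h\<bar> / (2 * (\<rho> 0 z * \<psi>0 z))"
        using \<rho>0_pos[of z] p by (simp add: abs_mult)
      also have "\<dots> \<le> (norm (g0 z) * norm h) / (2 * (\<rho> 0 z * \<psi>0 z))"
        using \<rho>0_pos[of z] p by (intro divide_right_mono Cauchy_Schwarz_ineq2) auto
      also have "\<dots> = (norm (g0 z) / \<rho>0 z) / (2 * \<psi>0 z) * norm h" by (simp add: \<rho>0)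
      also have "\<dots> \<le> (c1 * (1 + norm z)) / (2 * (\<delta> * (1 + norm z))) * norm h"
        using c1[of z] \<psi>0_ge[of z] p c10 by (intro mult_right_mono frac_le) auto
      also have "(c1 * (1 + norm z)) / (2 * (\<delta> * (1 + norm z))) = l"
      proof -
        have "1 + norm z \<noteq> 0" using norm_ge_zero[of z] by linarith
        then show ?thesis by (simp add: l_def)
      qed
      finally show "norm ((- 1 / (2 * (\<rho> 0 z * \<psi>0 z))) * (g0 z \<bullet> h)) \<le> l * norm h" .
    qed
    then have "norm (\<psi>0 x - \<psi>0 y) \<le> l * norm (x - y)"
      using d by (intro differentiable_bound[of UNIV \<psi>0]) auto
    then show ?thesis by simp
  qed
  \<comment> \<open>The Lipschitz bound gives \<open>\<psi>0^2 \<le> 2 * (\<psi>0 0)^2 + 2 * l^2 *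
    (x \<bullet> x)\<close>, which dictates \<open>A0\<close> and the first summand; the second
    secures \<open>4 * a / \<beta> \<ge> 2\<close> for the barrier.\<close>
  define a where "a = 2 * l\<^sup>2 + \<beta> / 2"
  define A0 where "A0 = 2 * (\<psi>0 0)\<^sup>2"
  have a0: "a > 0" unfolding a_def using beta_pos by (intro add_nonneg_pos) auto
  have a1: "4 * a * (1 / \<beta>) \<ge> 2" using beta_pos by (simp add: a_def divide_simps)
  have init_lower: "exp (- (A0 + a * (x \<bullet> x))) \<le> \<rho> 0 x" for x
  proof -
    have "\<psi>0 x \<le> \<psi>0 0 + l * norm x" using \<psi>0_lip[of x 0] by (simp add: abs_le_iff)
    moreover have p: "\<psi>0 x \<ge> 0" using \<psi>0_ge[of x] \<delta> by (intro order_trans[OF _ \<psi>0_ge]) auto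
    ultimately have "(\<psi>0 x)\<^sup>2 \<le> (\<psi>0 0 + l * norm x)\<^sup>2" by (intro power_mono)
    also have "\<dots> \<le> 2 * (\<psi>0 0)\<^sup>2 + 2 * (l * norm x)\<^sup>2"
      using sum_squares_bound[of "\<psi>0 0" "l * norm x"] by (simp add: power2_sum)
    also have "\<dots> \<le> A0 + a * (x \<bullet> x)"
      using beta_pos by (simp add: A0_def a_def power_mult_distrib power2_norm_eq_inner distrib_right)
    finally have "c - ln (\<rho> 0 x) \<le> A0 + a * (x \<bullet> x)"
      using init_1[of x] by (simp add: \<psi>0_def)
    moreover have "c \<ge> 0" using M by (simp add: c_def)
    ultimately have "- (A0 + a * (x \<bullet> x)) \<le> ln (\<rho> 0 x)" by simp
    then show ?thesis using \<rho>0_pos[of x] by (simp add: ln_ge_iff)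
  qed
  define A1 where "A1 = 4 * a * (1 / \<beta>) + a * W\<^sup>2 + M"
  have A10: "A1 \<ge> 0" using a0 M beta_pos by (simp add: A1_def)
  have lower: "exp (- (A0 + A1 * ln (1 + t) + a * (x \<bullet> x) / (1 + t))) \<le> \<rho> t x" if "t \<ge> 0" for t x
    by (rule lower_bound[OF drift _ upper nonneg[OF less_imp_le[OF \<rho>0_pos]] init_lower a1 a0 _ that]) (use M in \<open>auto simp: A1_def\<close>)
  have \<rho>_pos: "\<rho> t x > 0" if "t \<ge> 0" for t x using lower[OF that, of x] by (rule less_le_trans[rotated]) simp
  have c_ge: "c - ln (\<rho> t x) \<ge> 1" if "t \<ge> 0" for t x
  proof -
    have "\<rho> t x \<le> M" using upper[OF that, of x] that M divide_left_mono[of 1 "1 + t" M] by simp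
    then have "ln (\<rho> t x) \<le> ln M" using \<rho>_pos[OF that, of x] by (intro ln_mono) auto
    then show ?thesis by (simp add: c_def)
  qed
  have "\<exists>C>0. \<forall>t\<ge>0. \<forall>x. (norm (G t x) / \<rho> t x)\<^sup>2 \<le> C / (1 + t) * (1 + ln (1 + t) + (norm x)\<^sup>2 / (1 + t))"
  proof (rule gradient_estimate[OF \<rho>_pos c_ge drift W0])
    fix t x assume t: "(t::real) \<ge> 0"
    have "ln (exp (- (A0 + A1 * ln (1 + t) + a * (x \<bullet> x) / (1 + t)))) \<le> ln (\<rho> t x)"
      using lower[OF t, of x] by (intro ln_mono) auto
    then have "c - ln (\<rho> t x) \<le> (c + A0) + A1 * ln (1 + t) + a * (norm x)\<^sup>2 / (1 + t)"
      by (simp add: power2_norm_eq_inner)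
    then show "(sqrt (c - ln (\<rho> t x)))\<^sup>2 \<le> (c + A0) + A1 * ln (1 + t) + a * (norm x)\<^sup>2 / (1 + t)"
      using c_ge[OF t, of x] by simp
  next
    show "sqrt (c - ln (\<rho> 0 x)) - sqrt (c - ln (\<rho> 0 y)) \<le> l * norm (x - y)" for x y
      using \<psi>0_lip[of x y] by (simp add: \<psi>0_def abs_le_iff)
    show "c + A0 \<ge> 0" using M by (simp add: c_def A0_def)
  qed (use A10 a0 l0 in auto)
  then obtain C where C: "C > 0" "\<And>t x. t \<ge> 0 \<Longrightarrow> (norm (G t x) / \<rho> t x)\<^sup>2 \<le> C / (1 + t) * (1 + ln (1 + t) + (norm x)\<^sup>2 / (1 + t))"
    by metis
  show ?thesis
  proof (intro exI[of _ C] conjI allI impI)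
    fix t x assume t: "(t::real) \<ge> 0"
    show "\<rho> t x > 0" by (rule \<rho>_pos[OF t])
    show "\<exists>g. (\<rho> t has_derivative (\<lambda>h. g \<bullet> h)) (at x) \<and>
        (norm g / \<rho> t x)\<^sup>2 \<le> C / (1 + t) * (1 + ln (1 + t) + (norm x)\<^sup>2 / (1 + t))"
      using grad[OF t, of x] C(2)[OF t, of x] by (intro exI[of _ "G t x"] conjI)
  qed (rule C(1))
qed

end
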